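(* Let $H$ be a finite-dimensional cocommutative Hopf algebra, $(A,\cdot,(\omega,\omega'))$ a symmetric twisted partial $H$-module algebra, and $t\neq0$ a left integral in $H$. Assume there exists $c$ in the center of $A$ with $t\cdot c=1_A$. Then $A\subset A\#_{\cdot,\omega}H$ is a separable extension, i.e. there exists $e\in (A\#_{\cdot,\omega}H)\otimes_A(A\#_{\cdot,\omega}H)$ with $(x\otimes_A 1)e=e(1\otimes_A x)$ for all $x\in A\#_{\cdot,\omega}H$ and $m(e)=1_A\#1_H$, where $m$ is the multiplication map.
   Context: $k$ a field, $H$ a Hopf algebra with Sweedler notation $\Delta(h)=h_{(1)}\otimes h_{(2)}$, counit $\varepsilon$, antipode $S$; a left integral is $t\in H$ with $ht=\varepsilon(h)t$ for all $h$. $A$ a unital algebra. A twisted partial action: linear maps $h\otimes a\mapsto h\cdot a$, $\omega:H\otimes H\to A$ with $1_H\cdot a=a$, $h\cdot(ab)=(h_{(1)}\cdot a)(h_{(2)}\cdot b)$, (T3) $(h_{(1)}\cdot(l_{(1)}\cdot a))\omega(h_{(2)},l_{(2)})=\omega(h_{(1)},l_{(1)})(h_{(2)}l_{(2)}\cdot a)$, $\omega(h,l)=\omega(h_{(1)},l_{(1)})(h_{(2)}l_{(2)}\cdot 1_A)$; (N) $\omega(1_H,h)=\omega(h,1_H)=h\cdot 1_A$; (C) $(h_{(1)}\cdot\omega(l_{(1)},m_{(1)}))\omega(h_{(2)},l_{(2)}m_{(2)})=\omega(h_{(1)},l_{(1)})\omega(h_{(2)}l_{(2)},m)$. $A\#_{\cdot,\omega}H$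 is the span in $A\otimes H$ of $a\# h:=a(h_{(1)}\cdot 1_A)\otimes h_{(2)}$ with product $(a\otimes h)(b\otimes l)=a(h_{(1)}\cdot b)\omega(h_{(2)},l_{(1)})\otimes h_{(3)}l_{(2)}$, a unital associative algebra containing $A$ via $a\mapsto a\#1_H$. Convolution: $(f*g)(h)=f(h_{(1)})g(h_{(2)})$. With $e(h)=h\cdot1_A$, $f_1(h,k)=(h\cdot 1_A)\varepsilon(k)$, $f_2(h,k)=hk\cdot1_A$, the twisted partial action is symmetric if $e$ is central in $\mathrm{Hom}(H,A)$, $f_1,f_2$ are central in $\mathrm{Hom}(H\otimes H,A)$, $\omega$ satisfies (N),(T3),(C) and has a convolution inverse $\omega'$ with $\omega*\omega'=\omega'*\omega=f_1*f_2$, and $h\cdot(k\cdot1_A)=(h_{(1)}\cdot1_A)(h_{(2)}k\cdot1_A)$ for all $h,k\in H$. *)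

theory Defs
  imports Main
begin

text \<open>A finite-dimensional Hopf algebra H over a field 'k is given by a finite basis
  indexed by the finite type 'i; elements of H are coordinate vectors 'i => 'k.
  hmu i j l: coefficient of b_l in b_i b_j; hun: coordinates of 1_H;
  hcom l i j: coefficient of b_i (x) b_j in Delta(b_l); hcou l = eps(b_l);
  hant i j: coefficient of b_j in S(b_i).\<close>

record ('i, 'k) hopf_data =
  hmu  :: "'i \<Rightarrow> 'i \<Rightarrow> 'i \<Rightarrow> 'k"
  hun  :: "'i \<Rightarrow> 'k"
  hcom :: "'i \<Rightarrow> 'i \<Rightarrow> 'i \<Rightarrow> 'k"
  hcou :: "'i \<Rightarrow> 'k"
  hant :: "'i \<Rightarrow> 'i \<Rightarrow> 'k"

definition bas :: "'i \<Rightarrow> 'i \<Rightarrow> 'k::field" where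
  "bas i = (\<lambda>j. if j = i then 1 else 0)"

definition hadd :: "('i \<Rightarrow> 'k::field) \<Rightarrow> ('i \<Rightarrow> 'k) \<Rightarrow> ('i \<Rightarrow> 'k)" where
  "hadd x y = (\<lambda>i. x i + y i)"

definition hsc :: "'k::field \<Rightarrow> ('i \<Rightarrow> 'k) \<Rightarrow> ('i \<Rightarrow> 'k)" where
  "hsc c x = (\<lambda>i. c * x i)"

definition hmul :: "('i::finite, 'k::field) hopf_data \<Rightarrow> ('i \<Rightarrow> 'k) \<Rightarrow> ('i \<Rightarrow> 'k) \<Rightarrow> ('i \<Rightarrow> 'k)" where
  "hmul H x y = (\<lambda>l. \<Sum>i\<in>UNIV. \<Sum>j\<in>UNIV. x i * y j * hmu H i j l)"

definition hone :: "('i::finite, 'k::field) hopf_data \<Rightarrow> ('i \<Rightarrow> 'k)" where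
  "hone H = hun H"

definition cop :: "('i::finite, 'k::field) hopf_data \<Rightarrow> ('i \<Rightarrow> 'k) \<Rightarrow> ('i \<times> 'i \<Rightarrow> 'k)" where
  "cop H x = (\<lambda>(i, j). \<Sum>l\<in>UNIV. x l * hcom H l i j)"

text \<open>(Delta (x) id) Delta(x) in H (x) H (x) H (i.e. x_(1) (x) x_(2) (x) x_(3)).\<close>
definition cop3 :: "('i::finite, 'k::field) hopf_data \<Rightarrow> ('i \<Rightarrow> 'k) \<Rightarrow> ('i \<times> 'i \<times> 'i \<Rightarrow> 'k)" where
  "cop3 H x = (\<lambda>(p, q, r). \<Sum>l\<in>UNIV. \<Sum>u\<in>UNIV. x l * hcom H l u r * hcom H u p q)"

definition eps :: "('i::finite, 'k::field) hopf_data \<Rightarrow> ('i \<Rightarrow> 'k) \<Rightarrow> 'k" where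
  "eps H x = (\<Sum>l\<in>UNIV. x l * hcou H l)"

definition ant :: "('i::finite, 'k::field) hopf_data \<Rightarrow> ('i \<Rightarrow> 'k) \<Rightarrow> ('i \<Rightarrow> 'k)" where
  "ant H x = (\<lambda>j. \<Sum>i\<in>UNIV. x i * hant H i j)"

definition is_hopf :: "('i::finite, 'k::field) hopf_data \<Rightarrow> bool" where
  "is_hopf H \<longleftrightarrow>
     (\<forall>x y z. hmul H (hmul H x y) z = hmul H x (hmul H y z)) \<and>
     (\<forall>x. hmul H (hone H) x = x \<and> hmul H x (hone H) = x) \<and>
     (\<forall>x p q r. (\<Sum>u\<in>UNIV. cop H x (u, r) * cop H (bas u) (p, q))
              = (\<Sum>v\<in>UNIV. cop H x (p, v) * cop H (bas v) (q, r))) \<and>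
     (\<forall>x. (\<lambda>j. \<Sum>i\<in>UNIV. cop H x (i, j) * eps H (bas i)) = x \<and>
          (\<lambda>i. \<Sum>j\<in>UNIV. cop H x (i, j) * eps H (bas j)) = x) \<and>
     (\<forall>x y p q. cop H (hmul H x y) (p, q) =
        (\<Sum>i\<in>UNIV. \<Sum>j\<in>UNIV. \<Sum>i'\<in>UNIV. \<Sum>j'\<in>UNIV.
           cop H x (i, j) * cop H y (i', j') * hmul H (bas i) (bas i') p * hmul H (bas j) (bas j') q)) \<and>
     (\<forall>p q. cop H (hone H) (p, q) = hone H p * hone H q) \<and>
     (\<forall>x y. eps H (hmul H x y) = eps H x * eps H y) \<and>
     eps H (hone H) = 1 \<and>
     (\<forall>x. (\<lambda>l. \<Sum>i\<in>UNIV. \<Sum>j\<in>UNIV. cop H x (i, j) * hmul H (ant H (bas i)) (bas j) l)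
            = (\<lambda>l. eps H x * hone H l) \<and>
          (\<lambda>l. \<Sum>i\<in>UNIV. \<Sum>j\<in>UNIV. cop H x (i, j) * hmul H (bas i) (ant H (bas j)) l)
            = (\<lambda>l. eps H x * hone H l))"

definition cocommutative :: "('i::finite, 'k::field) hopf_data \<Rightarrow> bool" where
  "cocommutative H \<longleftrightarrow> (\<forall>x i j. cop H x (i, j) = cop H x (j, i))"

definition left_integral :: "('i::finite, 'k::field) hopf_data \<Rightarrow> ('i \<Rightarrow> 'k) \<Rightarrow> bool" where
  "left_integral H t \<longleftrightarrow> (\<forall>h. hmul H h t = (\<lambda>l. eps H h * t l))"

definition kalg :: "('k::field \<Rightarrow> 'a::ring_1) \<Rightarrow> bool" where
  "kalg \<phi> \<longleftrightarrow> (\<forall>x y. \<phi> (x + y) = \<phi> x + \<phi> y) \<and> (\<forall>x y. \<phi> (x * y) = \<phi> x * \<phi> y) \<and>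
     \<phi> 1 = 1 \<and> (\<forall>c a. \<phi> c * a = a * \<phi> c)"

definition hlin :: "('k::field \<Rightarrow> 'a::ring_1) \<Rightarrow> (('i \<Rightarrow> 'k) \<Rightarrow> 'a) \<Rightarrow> bool" where
  "hlin \<phi> f \<longleftrightarrow> (\<forall>x y c. f (hadd x y) = f x + f y \<and> f (hsc c x) = \<phi> c * f x)"

definition hbilin :: "('k::field \<Rightarrow> 'a::ring_1) \<Rightarrow> (('i \<Rightarrow> 'k) \<Rightarrow> ('i \<Rightarrow> 'k) \<Rightarrow> 'a) \<Rightarrow> bool" where
  "hbilin \<phi> f \<longleftrightarrow> (\<forall>x. hlin \<phi> (f x)) \<and> (\<forall>y. hlin \<phi> (\<lambda>x. f x y))"

definition alin :: "('k::field \<Rightarrow> 'a::ring_1) \<Rightarrow> ('a \<Rightarrow> 'a) \<Rightarrow> bool" where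
  "alin \<phi> g \<longleftrightarrow> (\<forall>a b c. g (a + b) = g a + g b \<and> g (\<phi> c * a) = \<phi> c * g a)"

text \<open>sw2 H phi h F = F(h_(1), h_(2)) (summed), for F bilinear; sw3 likewise with three legs.\<close>
definition sw2 :: "('i::finite, 'k::field) hopf_data \<Rightarrow> ('k \<Rightarrow> 'a::ring_1) \<Rightarrow> ('i \<Rightarrow> 'k)
    \<Rightarrow> (('i \<Rightarrow> 'k) \<Rightarrow> ('i \<Rightarrow> 'k) \<Rightarrow> 'a) \<Rightarrow> 'a" where
  "sw2 H \<phi> h F = (\<Sum>p\<in>UNIV. \<phi> (cop H h p) * F (bas (fst p)) (bas (snd p)))"

definition sw3 :: "('i::finite, 'k::field) hopf_data \<Rightarrow> ('k \<Rightarrow> 'a::ring_1) \<Rightarrow> ('i \<Rightarrow> 'k)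
    \<Rightarrow> (('i \<Rightarrow> 'k) \<Rightarrow> ('i \<Rightarrow> 'k) \<Rightarrow> ('i \<Rightarrow> 'k) \<Rightarrow> 'a) \<Rightarrow> 'a" where
  "sw3 H \<phi> h F = (\<Sum>p\<in>UNIV. \<phi> (cop3 H h p) * F (bas (fst p)) (bas (fst (snd p))) (bas (snd (snd p))))"

text \<open>Convolution in Hom(H,A) and in Hom(H (x) H, A) (the latter represented by bilinear maps).\<close>
definition conv1 where
  "conv1 H \<phi> f g = (\<lambda>h. sw2 H \<phi> h (\<lambda>h1 h2. f h1 * g h2))"

definition conv2 where
  "conv2 H \<phi> f g = (\<lambda>h l. sw2 H \<phi> h (\<lambda>h1 h2. sw2 H \<phi> l (\<lambda>l1 l2. f h1 l1 * g h2 l2)))"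

definition tpa :: "('i::finite, 'k::field) hopf_data \<Rightarrow> ('k \<Rightarrow> 'a::ring_1)
    \<Rightarrow> (('i \<Rightarrow> 'k) \<Rightarrow> 'a \<Rightarrow> 'a) \<Rightarrow> (('i \<Rightarrow> 'k) \<Rightarrow> ('i \<Rightarrow> 'k) \<Rightarrow> 'a) \<Rightarrow> bool" where
  "tpa H \<phi> act om \<longleftrightarrow>
     (\<forall>a. hlin \<phi> (\<lambda>h. act h a)) \<and> (\<forall>h. alin \<phi> (act h)) \<and> hbilin \<phi> om \<and>
     (\<forall>a. act (hone H) a = a) \<and>
     (\<forall>h a b. act h (a * b) = sw2 H \<phi> h (\<lambda>h1 h2. act h1 a * act h2 b)) \<and>
     (\<forall>h l a. sw2 H \<phi> h (\<lambda>h1 h2. sw2 H \<phi> l (\<lambda>l1 l2. act h1 (act l1 a) * om h2 l2))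
            = sw2 H \<phi> h (\<lambda>h1 h2. sw2 H \<phi> l (\<lambda>l1 l2. om h1 l1 * act (hmul H h2 l2) a))) \<and>
     (\<forall>h l. om h l = sw2 H \<phi> h (\<lambda>h1 h2. sw2 H \<phi> l (\<lambda>l1 l2. om h1 l1 * act (hmul H h2 l2) 1)))"

definition sym_tpa :: "('i::finite, 'k::field) hopf_data \<Rightarrow> ('k \<Rightarrow> 'a::ring_1)
    \<Rightarrow> (('i \<Rightarrow> 'k) \<Rightarrow> 'a \<Rightarrow> 'a) \<Rightarrow> (('i \<Rightarrow> 'k) \<Rightarrow> ('i \<Rightarrow> 'k) \<Rightarrow> 'a)
    \<Rightarrow> (('i \<Rightarrow> 'k) \<Rightarrow> ('i \<Rightarrow> 'k) \<Rightarrow> 'a) \<Rightarrow> bool" where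
  "sym_tpa H \<phi> act om om' \<longleftrightarrow>
     tpa H \<phi> act om \<and>
     \<comment> \<open>e central in Hom(H,A)\<close>
     (\<forall>f. hlin \<phi> f \<longrightarrow> conv1 H \<phi> (\<lambda>h. act h 1) f = conv1 H \<phi> f (\<lambda>h. act h 1)) \<and>
     \<comment> \<open>f1 and f2 central in Hom(H (x) H, A)\<close>
     (\<forall>f. hbilin \<phi> f \<longrightarrow>
        conv2 H \<phi> (\<lambda>h l. act h 1 * \<phi> (eps H l)) f = conv2 H \<phi> f (\<lambda>h l. act h 1 * \<phi> (eps H l))) \<and>
     (\<forall>f. hbilin \<phi> f \<longrightarrow>
        conv2 H \<phi> (\<lambda>h l. act (hmul H h l) 1) f = conv2 H \<phi> f (\<lambda>h l. act (hmul H h l) 1)) \<and>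
     \<comment> \<open>(N)\<close>
     (\<forall>h. om (hone H) h = act h 1 \<and> om h (hone H) = act h 1) \<and>
     \<comment> \<open>(C)\<close>
     (\<forall>h l m. sw2 H \<phi> h (\<lambda>h1 h2. sw2 H \<phi> l (\<lambda>l1 l2. sw2 H \<phi> m (\<lambda>m1 m2.
                 act h1 (om l1 m1) * om h2 (hmul H l2 m2))))
            = sw2 H \<phi> h (\<lambda>h1 h2. sw2 H \<phi> l (\<lambda>l1 l2. om h1 l1 * om (hmul H h2 l2) m))) \<and>
     \<comment> \<open>convolution inverse om'\<close>
     hbilin \<phi> om' \<and>
     conv2 H \<phi> om om' = conv2 H \<phi> (\<lambda>h l. act h 1 * \<phi> (eps H l)) (\<lambda>h l. act (hmul H h l) 1) \<and>
     conv2 H \<phi> om' om = conv2 H \<phi> (\<lambda>h l. act h 1 * \<phi> (eps H l)) (\<lambda>h l. act (hmul H h l) 1) \<and>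
     \<comment> \<open>symmetry condition\<close>
     (\<forall>h k. act h (act k 1) = sw2 H \<phi> h (\<lambda>h1 h2. act h1 1 * act (hmul H h2 k) 1))"

text \<open>A (x) H is represented by coordinate vectors 'i => 'a: x = sum_i x_i (x) b_i.\<close>

definition sharp :: "('i::finite, 'k::field) hopf_data \<Rightarrow> ('k \<Rightarrow> 'a::ring_1)
    \<Rightarrow> (('i \<Rightarrow> 'k) \<Rightarrow> 'a \<Rightarrow> 'a) \<Rightarrow> 'a \<Rightarrow> ('i \<Rightarrow> 'k) \<Rightarrow> ('i \<Rightarrow> 'a)" where
  "sharp H \<phi> act a h = (\<lambda>m. sw2 H \<phi> h (\<lambda>h1 h2. a * act h1 1 * \<phi> (h2 m)))"

definition smash_set :: "('i::finite, 'k::field) hopf_data \<Rightarrow> ('k \<Rightarrow> 'a::ring_1)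
    \<Rightarrow> (('i \<Rightarrow> 'k) \<Rightarrow> 'a \<Rightarrow> 'a) \<Rightarrow> ('i \<Rightarrow> 'a) set" where
  "smash_set H \<phi> act =
     {x. \<exists>(n::nat) (a :: nat \<Rightarrow> 'a) (h :: nat \<Rightarrow> 'i \<Rightarrow> 'k).
           x = (\<lambda>m. \<Sum>j<n. sharp H \<phi> act (a j) (h j) m)}"

definition smul :: "('i::finite, 'k::field) hopf_data \<Rightarrow> ('k \<Rightarrow> 'a::ring_1)
    \<Rightarrow> (('i \<Rightarrow> 'k) \<Rightarrow> 'a \<Rightarrow> 'a) \<Rightarrow> (('i \<Rightarrow> 'k) \<Rightarrow> ('i \<Rightarrow> 'k) \<Rightarrow> 'a)
    \<Rightarrow> ('i \<Rightarrow> 'a) \<Rightarrow> ('i \<Rightarrow> 'a) \<Rightarrow> ('i \<Rightarrow> 'a)" where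
  "smul H \<phi> act om x y = (\<lambda>m. \<Sum>i\<in>UNIV. \<Sum>j\<in>UNIV.
      sw3 H \<phi> (bas i) (\<lambda>h1 h2 h3. sw2 H \<phi> (bas j) (\<lambda>l1 l2.
        x i * act h1 (y j) * om h2 l1 * \<phi> (hmul H h3 l2 m))))"

definition delta :: "'z \<Rightarrow> 'z \<Rightarrow> int" where
  "delta z = (\<lambda>w. if w = z then 1 else 0)"

text \<open>Elements of the free abelian group on Ms x Ns are finitely supported integer-valued
  functions; tensor_zero is the subgroup generated by the biadditivity and balancing relations,
  so M (x)_R N is the quotient by it.\<close>
inductive_set tensor_zero :: "'m set \<Rightarrow> 'n set \<Rightarrow> ('m \<Rightarrow> 'm \<Rightarrow> 'm) \<Rightarrow> ('n \<Rightarrow> 'n \<Rightarrow> 'n)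
    \<Rightarrow> ('m \<Rightarrow> 'r \<Rightarrow> 'm) \<Rightarrow> ('r \<Rightarrow> 'n \<Rightarrow> 'n) \<Rightarrow> ('m \<times> 'n \<Rightarrow> int) set"
  for Ms Ns addM addN ract lact where
  tz_zero: "(\<lambda>_. 0) \<in> tensor_zero Ms Ns addM addN ract lact"
| tz_add: "p \<in> tensor_zero Ms Ns addM addN ract lact \<Longrightarrow> q \<in> tensor_zero Ms Ns addM addN ract lact
           \<Longrightarrow> (\<lambda>z. p z + q z) \<in> tensor_zero Ms Ns addM addN ract lact"
| tz_neg: "p \<in> tensor_zero Ms Ns addM addN ract lact \<Longrightarrow> (\<lambda>z. - p z) \<in> tensor_zero Ms Ns addM addN ract lact"
| tz_l: "x \<in> Ms \<Longrightarrow> x' \<in> Ms \<Longrightarrow> y \<in> Ns \<Longrightarrow>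
         (\<lambda>z. delta (addM x x', y) z - delta (x, y) z - delta (x', y) z) \<in> tensor_zero Ms Ns addM addN ract lact"
| tz_r: "x \<in> Ms \<Longrightarrow> y \<in> Ns \<Longrightarrow> y' \<in> Ns \<Longrightarrow>
         (\<lambda>z. delta (x, addN y y') z - delta (x, y) z - delta (x, y') z) \<in> tensor_zero Ms Ns addM addN ract lact"
| tz_bal: "x \<in> Ms \<Longrightarrow> y \<in> Ns \<Longrightarrow>
         (\<lambda>z. delta (ract x a, y) z - delta (x, lact a y) z) \<in> tensor_zero Ms Ns addM addN ract lact"

definition push :: "('z \<Rightarrow> 'w) \<Rightarrow> ('z \<Rightarrow> int) \<Rightarrow> ('w \<Rightarrow> int)" where
  "push g p = (\<lambda>w. \<Sum>z\<in>{z. p z \<noteq> 0 \<and> g z = w}. p z)"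

definition vadd :: "('i \<Rightarrow> 'a::plus) \<Rightarrow> ('i \<Rightarrow> 'a) \<Rightarrow> ('i \<Rightarrow> 'a)" where
  "vadd x y = (\<lambda>m. x m + y m)"

text \<open>A \<subseteq> B = A #_{.,omega} H is separable: there is e in B (x)_A B, represented by a finitely
  supported formal sum p of pairs in B x B, with (x (x) 1) e = e (1 (x) x) for all x in B
  and m(e) = 1_A # 1_H.\<close>
definition smash_separable :: "('i::finite, 'k::field) hopf_data \<Rightarrow> ('k \<Rightarrow> 'a::ring_1)
    \<Rightarrow> (('i \<Rightarrow> 'k) \<Rightarrow> 'a \<Rightarrow> 'a) \<Rightarrow> (('i \<Rightarrow> 'k) \<Rightarrow> ('i \<Rightarrow> 'k) \<Rightarrow> 'a) \<Rightarrow> bool" where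
  "smash_separable H \<phi> act om \<longleftrightarrow>
     (\<exists>p :: ('i \<Rightarrow> 'a) \<times> ('i \<Rightarrow> 'a) \<Rightarrow> int.
        finite {z. p z \<noteq> 0} \<and>
        {z. p z \<noteq> 0} \<subseteq> smash_set H \<phi> act \<times> smash_set H \<phi> act \<and>
        (\<forall>x\<in>smash_set H \<phi> act.
           (\<lambda>w. push (\<lambda>z. (smul H \<phi> act om x (fst z), snd z)) p w
               - push (\<lambda>z. (fst z, smul H \<phi> act om (snd z) x)) p w)
           \<in> tensor_zero (smash_set H \<phi> act) (smash_set H \<phi> act) vadd vadd
               (\<lambda>x a. smul H \<phi> act om x (sharp H \<phi> act a (hone H)))
               (\<lambda>a y. smul H \<phi> act om (sharp H \<phi> act a (hone H)) y)) \<and>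
        (\<lambda>m. \<Sum>z\<in>{z. p z \<noteq> 0}. of_int (p z) * smul H \<phi> act om (fst z) (snd z) m)
          = sharp H \<phi> act 1 (hone H))"

end

theory Submission
  imports Defs
begin

text \<open>
  For a cocommutative coalgebra C the coalgebra maps \<open>u, v : C \<rightarrow> H\<close> form a group, and with
  \<open>(u \<rhd> f)(x) = u(x\<^sub>1) \<cdot> f(x\<^sub>2)\<close> and \<open>\<omega>(u,v)(x) = \<omega>(u(x\<^sub>1), v(x\<^sub>2))\<close> the axioms of a twisted partial
  action become, in the convolution algebra Hom(C, A), those of a twisted partial action of a group.
  In these terms \<open>\<gamma>(u) = 1 # u\<close> satisfies \<open>\<gamma>(u) f = (u \<rhd> f) \<gamma>(u)\<close> and \<open>\<gamma>(u) \<gamma>(v) = \<omega>(u,v) \<gamma>(uv)\<close>, and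
  \<open>\<gamma>'(u) = \<omega>'(u\<^sup>-\<^sup>1,u) \<gamma>(u\<^sup>-\<^sup>1)\<close> is a partial inverse of it. The separability element is
  \<open>\<gamma>(t\<^sub>1) c \<otimes> \<gamma>'(t\<^sub>2)\<close>. It is mapped to \<open>t \<cdot> c = 1\<close>. Conjugation by \<open>\<gamma>\<close> preserves A, so \<open>a \<gamma>(h) \<gamma>(t\<^sub>1) c\<close> can be
  rewritten as \<open>\<gamma>(h\<^sub>1 t\<^sub>1) c\<close> times an element of A, which is moved across the tensor sign; the integral
  property \<open>h\<^sub>1 t\<^sub>1 \<otimes> h\<^sub>2 t\<^sub>2 \<otimes> h\<^sub>3 = t\<^sub>1 \<otimes> t\<^sub>2 \<otimes> h\<close> then gives the commutation with \<open>a # h\<close>.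
\<close>

section \<open>Cocommutative coalgebras and their morphisms\<close>

text \<open>Two independent Hopf variables are treated as the projections \<open>fstp\<close> and
  \<open>sndp\<close>, points of C = H (x) H, and a single variable as the identity point of C = H.
  This is why C is kept arbitrary: identities in several Sweedler variables become group
  calculations in Hom(C, A). Cocommutativity is what makes products of points points again and e(u)
  central in Hom(C, A). The tensor product over A is a quotient of a free abelian group in which
  only biadditivity and balancing are available. The separability element is therefore expanded
  along the basis b_j of H as the sum of g_j (x) y_j, with g_j = \<gamma>(b_j) c and y_j the part of
  \<gamma>'(t_2) paired with coordinate j of t_1. Commutation with x reduces to finding one matrix r
  over A with x g_j = sum_k g_k r_kj and y_k x = sum_j r_kj y_j. That a single matrix serves both
  equations comes from \<open>move_right\<close>, \<open>move_left\<close> and the integral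
  property. Centrality of c serves the first equation, where c has to pass over coefficients from
  A.\<close>

text \<open>Linear maps between spaces of coordinate vectors are matrices \<open>M :: 'p \<Rightarrow> 'q \<Rightarrow> 'k\<close>; \<open>bnd\<close> is the
  bind of the free-module monad with unit \<open>bas\<close>, so that Sweedler sums become nested binds whose
  order may be exchanged.\<close>

definition bnd :: "('p::finite \<Rightarrow> 'k::field) \<Rightarrow> ('p \<Rightarrow> 'q \<Rightarrow> 'k) \<Rightarrow> 'q \<Rightarrow> 'k" where
  "bnd v M = (\<lambda>q. \<Sum>p\<in>UNIV. v p * M p q)"

lemma bnd_bas [simp]: "bnd (bas p) M = M p"
  by (simp add: bnd_def bas_def if_distrib [of "\<lambda>x. x * _"] cong: if_cong)

lemma bnd_bas_right [simp]: "bnd v bas = v"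
  by (simp add: bnd_def bas_def if_distrib [of "\<lambda>x. _ * x"] cong: if_cong)

lemma bnd_assoc: "bnd (bnd v M) N = bnd v (\<lambda>p. bnd (M p) N)"
proof
  fix q
  have "(\<Sum>r\<in>UNIV. \<Sum>p\<in>UNIV. v p * M p r * N r q) = (\<Sum>p\<in>UNIV. \<Sum>r\<in>UNIV. v p * M p r * N r q)"
    by (rule sum.swap)
  then show "bnd (bnd v M) N q = bnd v (\<lambda>p. bnd (M p) N) q"
    by (simp add: bnd_def sum_distrib_left sum_distrib_right mult.assoc)
qed

lemma bnd_comm: "bnd v (\<lambda>p. bnd w (\<lambda>q. M p q)) = bnd w (\<lambda>q. bnd v (\<lambda>p. M p q))"
proof
  fix r
  have "(\<Sum>p\<in>UNIV. \<Sum>q\<in>UNIV. v p * (w q * M p q r)) = (\<Sum>q\<in>UNIV. \<Sum>p\<in>UNIV. v p * (w q * M p q r))"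
    by (rule sum.swap)
  then show "bnd v (\<lambda>p. bnd w (\<lambda>q. M p q)) r = bnd w (\<lambda>q. bnd v (\<lambda>p. M p q)) r"
    by (simp add: bnd_def sum_distrib_left mult.left_commute)
qed

lemma bnd_cong: "(\<And>p. M p = N p) \<Longrightarrow> bnd v M = bnd v N"
  by (simp add: bnd_def)

text \<open>The counit takes values in coordinate vectors over the one-point type, which stands for the field.\<close>

definition ccoalg :: "('c::finite \<Rightarrow> 'c \<times> 'c \<Rightarrow> 'k::field) \<Rightarrow> ('c \<Rightarrow> unit \<Rightarrow> 'k) \<Rightarrow> bool" where
  "ccoalg d e \<longleftrightarrow>
     (\<forall>x. bnd (d x) (\<lambda>z. bnd (d (snd z)) (\<lambda>y. bas (fst z, fst y, snd y)))
        = bnd (d x) (\<lambda>z. bnd (d (fst z)) (\<lambda>y. bas (fst y, snd y, snd z)))) \<and>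
     (\<forall>x. bnd (d x) (\<lambda>z. bnd (e (fst z)) (\<lambda>_. bas (snd z))) = bas x) \<and>
     (\<forall>x. bnd (d x) (\<lambda>z. bas (snd z, fst z)) = d x)"

text \<open>Binding the axiom with an arbitrary continuation \<open>F\<close> gives a form that
  rewrites inside a longer Sweedler sum. The other coalgebra axioms get the same form below.\<close>

lemma ccoalg_coassoc:
  assumes "ccoalg d e"
  shows "bnd (d x) (\<lambda>z. bnd (d (snd z)) (\<lambda>y. F (fst z) (fst y) (snd y)))
       = bnd (d x) (\<lambda>z. bnd (d (fst z)) (\<lambda>y. F (fst y) (snd y) (snd z)))"
proof -
  have "bnd (bnd (d x) (\<lambda>z. bnd (d (snd z)) (\<lambda>y. bas (fst z, fst y, snd y))))
      (\<lambda>q. F (fst q) (fst (snd q)) (snd (snd q)))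
      = bnd (bnd (d x) (\<lambda>z. bnd (d (fst z)) (\<lambda>y. bas (fst y, snd y, snd z))))
          (\<lambda>q. F (fst q) (fst (snd q)) (snd (snd q)))"
    using assms by (simp add: ccoalg_def)
  then show ?thesis by (simp add: bnd_assoc)
qed

lemma ccoalg_swap:
  assumes "ccoalg d e"
  shows "bnd (d x) (\<lambda>z. F (fst z) (snd z)) = bnd (d x) (\<lambda>z. F (snd z) (fst z))"
proof -
  have "bnd (bnd (d x) (\<lambda>z. bas (snd z, fst z))) (\<lambda>z. F (fst z) (snd z)) = bnd (d x) (\<lambda>z. F (fst z) (snd z))"
    using assms by (simp add: ccoalg_def)
  then show ?thesis by (simp add: bnd_assoc)
qed

lemma ccoalg_counit_left:
  assumes "ccoalg d e"
  shows "bnd (d x) (\<lambda>z. bnd (e (fst z)) (\<lambda>_. F (snd z))) = F x"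
proof -
  have "bnd (bnd (d x) (\<lambda>z. bnd (e (fst z)) (\<lambda>_. bas (snd z)))) F = F x"
    using assms by (simp add: ccoalg_def)
  then show ?thesis by (simp add: bnd_assoc)
qed

lemma ccoalg_counit_right:
  assumes "ccoalg d e"
  shows "bnd (d x) (\<lambda>z. bnd (e (snd z)) (\<lambda>_. F (fst z))) = F x"
  using ccoalg_counit_left [OF assms, of x F] ccoalg_swap [OF assms, of x "\<lambda>a b. bnd (e a) (\<lambda>_. F b)"]
  by simp

text \<open>Reassociating puts the two legs to be exchanged under one inner comultiplication, where
  cocommutativity swaps them.\<close>

lemma ccoalg_swap_legs:
  assumes "ccoalg d e"
  shows "bnd (d x) (\<lambda>y. bnd (d (snd y)) (\<lambda>w. K (fst y) (fst w) (snd w)))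
       = bnd (d x) (\<lambda>y. bnd (d (snd y)) (\<lambda>w. K (fst w) (fst y) (snd w)))"
  unfolding ccoalg_coassoc [OF assms, of x K] ccoalg_coassoc [OF assms, of x "\<lambda>a b. K b a"]
  by (rule bnd_cong, rule ccoalg_swap [OF assms])

text \<open>Exchange of the middle two of x_1, ..., x_4. Once the sum is nested to the right,
  \<open>ccoalg_swap_legs\<close> applies below x_1.\<close>

lemma ccoalg_interchange:
  assumes C: "ccoalg d e"
  shows "bnd (d x) (\<lambda>z. bnd (d (fst z)) (\<lambda>y. bnd (d (snd z)) (\<lambda>w. F (fst y) (snd y) (fst w) (snd w))))
       = bnd (d x) (\<lambda>z. bnd (d (fst z)) (\<lambda>y. bnd (d (snd z)) (\<lambda>w. F (fst y) (fst w) (snd y) (snd w))))"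
proof -
  have *: "bnd (d x) (\<lambda>z. bnd (d (fst z)) (\<lambda>y. bnd (d (snd z)) (\<lambda>w. G (fst y) (snd y) (fst w) (snd w))))
      = bnd (d x) (\<lambda>z. bnd (d (snd z)) (\<lambda>y. bnd (d (snd y)) (\<lambda>w. G (fst z) (fst y) (fst w) (snd w))))" for G
    using ccoalg_coassoc [OF C, of x "\<lambda>a b c. bnd (d c) (\<lambda>w. G a b (fst w) (snd w))"] by simp
  show ?thesis
    unfolding * [of F] * [of "\<lambda>a b c. F a c b"]
    by (rule bnd_cong, rule ccoalg_swap_legs [OF C])
qed

text \<open>The map \<open>x \<mapsto> u(x\<^sub>1) \<otimes> v(x\<^sub>2)\<close>; cocommutativity makes it a coalgebra map when u and v are.\<close>

definition pair :: "('c::finite \<Rightarrow> 'c \<times> 'c \<Rightarrow> 'k::field) \<Rightarrow> ('c \<Rightarrow> 'i::finite \<Rightarrow> 'k) \<Rightarrow> ('c \<Rightarrow> 'j::finite \<Rightarrow> 'k)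
    \<Rightarrow> 'c \<Rightarrow> 'i \<times> 'j \<Rightarrow> 'k" where
  "pair d u v x = bnd (d x) (\<lambda>z. bnd (u (fst z)) (\<lambda>i. bnd (v (snd z)) (\<lambda>j. bas (i, j))))"

definition cmap :: "('c::finite \<Rightarrow> 'c \<times> 'c \<Rightarrow> 'k::field) \<Rightarrow> ('c \<Rightarrow> unit \<Rightarrow> 'k)
    \<Rightarrow> ('i::finite \<Rightarrow> 'i \<times> 'i \<Rightarrow> 'k) \<Rightarrow> ('i \<Rightarrow> unit \<Rightarrow> 'k) \<Rightarrow> ('c \<Rightarrow> 'i \<Rightarrow> 'k) \<Rightarrow> bool" where
  "cmap d e d' e' u \<longleftrightarrow> (\<forall>x. bnd (u x) d' = pair d u u x \<and> bnd (u x) e' = e x)"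

definition tens_cm :: "('c::finite \<Rightarrow> 'c \<times> 'c \<Rightarrow> 'k::field) \<Rightarrow> ('i::finite \<Rightarrow> 'i \<times> 'i \<Rightarrow> 'k)
    \<Rightarrow> 'c \<times> 'i \<Rightarrow> ('c \<times> 'i) \<times> ('c \<times> 'i) \<Rightarrow> 'k" where
  "tens_cm d d' p = bnd (d (fst p)) (\<lambda>z. bnd (d' (snd p)) (\<lambda>w. bas ((fst z, fst w), (snd z, snd w))))"

definition tens_cu :: "('c::finite \<Rightarrow> unit \<Rightarrow> 'k::field) \<Rightarrow> ('i::finite \<Rightarrow> unit \<Rightarrow> 'k) \<Rightarrow> 'c \<times> 'i \<Rightarrow> unit \<Rightarrow> 'k" where
  "tens_cu e e' p = bnd (e (fst p)) (\<lambda>_. e' (snd p))"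

text \<open>The sums over the two factors are independent, so \<open>bnd_comm\<close> collects the
  binds of each factor and the axioms are checked factor by factor.\<close>

lemma ccoalg_tens:
  assumes C: "ccoalg d e" and D: "ccoalg d' e'"
  shows "ccoalg (tens_cm d d') (tens_cu e e')"
  unfolding ccoalg_def
proof (intro conjI allI)
  fix x :: "'a \<times> 'c"
  let ?x = "fst x" and ?y = "snd x"
  let ?F = "\<lambda>a b c a' b' c'. bas ((a,a'),(b,b'),(c,c'))"
  have "bnd (tens_cm d d' x) (\<lambda>z. bnd (tens_cm d d' (snd z)) (\<lambda>y. bas (fst z, fst y, snd y)))
      = bnd (d ?x) (\<lambda>z. bnd (d' ?y) (\<lambda>w. bnd (d (snd z)) (\<lambda>y. bnd (d' (snd w)) (\<lambda>v.
           ?F (fst z) (fst y) (snd y) (fst w) (fst v) (snd v)))))"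
    by (simp add: tens_cm_def bnd_assoc)
  also have "\<dots> = bnd (d ?x) (\<lambda>z. bnd (d (snd z)) (\<lambda>y. bnd (d' ?y) (\<lambda>w. bnd (d' (snd w)) (\<lambda>v.
           ?F (fst z) (fst y) (snd y) (fst w) (fst v) (snd v)))))"
    by (subst bnd_comm [of "d' ?y"]) simp
  also have "\<dots> = bnd (d ?x) (\<lambda>z. bnd (d (snd z)) (\<lambda>y. bnd (d' ?y) (\<lambda>w. bnd (d' (fst w)) (\<lambda>v.
           ?F (fst z) (fst y) (snd y) (fst v) (snd v) (snd w)))))"
    by (simp add: ccoalg_coassoc [OF D, where F="\<lambda>a b c. bas ((_,a),(_,b),(_,c))"])
  also have "\<dots> = bnd (d ?x) (\<lambda>z. bnd (d (fst z)) (\<lambda>y. bnd (d' ?y) (\<lambda>w. bnd (d' (fst w)) (\<lambda>v.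
           ?F (fst y) (snd y) (snd z) (fst v) (snd v) (snd w)))))"
    by (rule ccoalg_coassoc [OF C, of ?x])
  also have "\<dots> = bnd (d ?x) (\<lambda>z. bnd (d' ?y) (\<lambda>w. bnd (d (fst z)) (\<lambda>y. bnd (d' (fst w)) (\<lambda>v.
           ?F (fst y) (snd y) (snd z) (fst v) (snd v) (snd w)))))"
    by (subst bnd_comm [of "d' ?y"]) simp
  finally show "bnd (tens_cm d d' x) (\<lambda>z. bnd (tens_cm d d' (snd z)) (\<lambda>y. bas (fst z, fst y, snd y))) =
         bnd (tens_cm d d' x) (\<lambda>z. bnd (tens_cm d d' (fst z)) (\<lambda>y. bas (fst y, snd y, snd z)))"
    by (simp add: tens_cm_def bnd_assoc)
  have "bnd (tens_cm d d' x) (\<lambda>z. bnd (tens_cu e e' (fst z)) (\<lambda>_. bas (snd z)))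
     = bnd (d ?x) (\<lambda>z. bnd (d' ?y) (\<lambda>w. bnd (e (fst z)) (\<lambda>_. bnd (e' (fst w)) (\<lambda>_. bas (snd z, snd w)))))"
    by (simp add: tens_cm_def tens_cu_def bnd_assoc)
  also have "\<dots> = bnd (d ?x) (\<lambda>z. bnd (e (fst z)) (\<lambda>_. bnd (d' ?y) (\<lambda>w. bnd (e' (fst w))
      (\<lambda>_. bas (snd z, snd w)))))"
    by (subst bnd_comm [of "d' ?y"]) simp
  also have "\<dots> = bas x"
    by (simp add: ccoalg_counit_left [OF D, where F="\<lambda>w. bas (_, w)"]
      ccoalg_counit_left [OF C, where F="\<lambda>w. bas (w, _)"])
  finally show "bnd (tens_cm d d' x) (\<lambda>z. bnd (tens_cu e e' (fst z)) (\<lambda>_. bas (snd z))) = bas x" .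
  show "bnd (tens_cm d d' x) (\<lambda>z. bas (snd z, fst z)) = tens_cm d d' x"
    unfolding tens_cm_def bnd_assoc bnd_bas fst_conv snd_conv
    by (subst ccoalg_swap [OF C, of ?x "\<lambda>a b. bnd (d' ?y) (\<lambda>w. bas ((a, fst w), (b, snd w)))"],
        rule bnd_cong, rule ccoalg_swap [OF D])
qed

lemma cmap_cm: "cmap d e d' e' u \<Longrightarrow> bnd (u x) d' = pair d u u x"
  and cmap_cu: "cmap d e d' e' u \<Longrightarrow> bnd (u x) e' = e x"
  by (simp_all add: cmap_def)

lemma cmap_cm_cont:
  assumes "cmap d e d' e' u"
  shows "bnd (u x) (\<lambda>i. bnd (d' i) (\<lambda>y. F (fst y) (snd y)))
    = bnd (d x) (\<lambda>z. bnd (u (fst z)) (\<lambda>i. bnd (u (snd z)) (\<lambda>j. F i j)))"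
proof -
  have "bnd (bnd (u x) d') (\<lambda>y. F (fst y) (snd y)) = bnd (pair d u u x) (\<lambda>y. F (fst y) (snd y))"
    using cmap_cm [OF assms] by simp
  then show ?thesis by (simp add: bnd_assoc pair_def)
qed

lemma cmap_cu_cont:
  assumes "cmap d e d' e' u"
  shows "bnd (u x) (\<lambda>i. bnd (e' i) F) = bnd (e x) F"
  using arg_cong [OF cmap_cu [OF assms, of x], of "\<lambda>v. bnd v F"] by (simp add: bnd_assoc)

lemma cmap_pair:
  assumes C: "ccoalg d e" and u: "cmap d e d1 e1 u" and v: "cmap d e d2 e2 v"
  shows "cmap d e (tens_cm d1 d2) (tens_cu e1 e2) (pair d u v)"
  unfolding cmap_def
proof (intro allI conjI)
  fix x
  have "bnd (pair d u v x) (tens_cm d1 d2) = bnd (d x) (\<lambda>z. bnd (u (fst z)) (\<lambda>i. bnd (v (snd z)) (\<lambda>j.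
          bnd (d1 i) (\<lambda>y. bnd (d2 j) (\<lambda>w. bas ((fst y, fst w), (snd y, snd w)))))))"
    by (simp add: pair_def tens_cm_def bnd_assoc)
  also have "\<dots> = bnd (d x) (\<lambda>z. bnd (u (fst z)) (\<lambda>i. bnd (d1 i) (\<lambda>y. bnd (v (snd z)) (\<lambda>j.
          bnd (d2 j) (\<lambda>w. bas ((fst y, fst w), (snd y, snd w)))))))"
    by (subst bnd_comm [of "v _"]) simp
  also have "\<dots> = bnd (d x) (\<lambda>z. bnd (u (fst z)) (\<lambda>i. bnd (d1 i) (\<lambda>y.
          bnd (d (snd z)) (\<lambda>r. bnd (v (fst r)) (\<lambda>k. bnd (v (snd r)) (\<lambda>l. bas ((fst y, k), (snd y, l))))))))"
    by (simp add: cmap_cm_cont [OF v, where F="\<lambda>k l. bas ((_, k), (_, l))"])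
  also have "\<dots> = bnd (d x) (\<lambda>z. bnd (d (fst z)) (\<lambda>y. bnd (u (fst y)) (\<lambda>i. bnd (u (snd y)) (\<lambda>j.
          bnd (d (snd z)) (\<lambda>r. bnd (v (fst r)) (\<lambda>k. bnd (v (snd r)) (\<lambda>l. bas ((i, k), (j, l)))))))))"
    by (subst cmap_cm_cont [OF u]) simp
  also have "\<dots> = bnd (d x) (\<lambda>z. bnd (d (fst z)) (\<lambda>y. bnd (d (snd z)) (\<lambda>r. bnd (u (fst y))
      (\<lambda>i. bnd (u (snd y)) (\<lambda>j.
           bnd (v (fst r)) (\<lambda>k. bnd (v (snd r)) (\<lambda>l. bas ((i, k), (j, l)))))))))"
    by (subst bnd_comm [of "d _" "u _"], subst bnd_comm [of "d _" "u _"]) simp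
  \<comment> \<open>Cocommutativity enters here: u sits on x_1, x_2 and v on x_3, x_4, while a
    coalgebra map needs u, v on x_1, x_2 and again on x_3, x_4.\<close>
  also have "\<dots> = bnd (d x) (\<lambda>z. bnd (d (fst z)) (\<lambda>y. bnd (d (snd z)) (\<lambda>r. bnd (u (fst y))
      (\<lambda>i. bnd (u (fst r)) (\<lambda>j.
           bnd (v (snd y)) (\<lambda>k. bnd (v (snd r)) (\<lambda>l. bas ((i, k), (j, l)))))))))"
    by (rule ccoalg_interchange [OF C, where F="\<lambda>a b c f. bnd (u a) (\<lambda>i. bnd (u b) (\<lambda>j.
           bnd (v c) (\<lambda>k. bnd (v f) (\<lambda>l. bas ((i, k), (j, l))))))"])
  also have "\<dots> = bnd (d x) (\<lambda>z. bnd (d (fst z)) (\<lambda>y. bnd (d (snd z)) (\<lambda>r. bnd (u (fst y))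
      (\<lambda>i. bnd (v (snd y)) (\<lambda>k.
           bnd (u (fst r)) (\<lambda>j. bnd (v (snd r)) (\<lambda>l. bas ((i, k), (j, l)))))))))"
    by (subst bnd_comm [of "u _" "v _"]) simp
  also have "\<dots> = bnd (d x) (\<lambda>z. bnd (d (fst z)) (\<lambda>y. bnd (u (fst y)) (\<lambda>i. bnd (v (snd y)) (\<lambda>k.
           bnd (d (snd z)) (\<lambda>r. bnd (u (fst r)) (\<lambda>j. bnd (v (snd r)) (\<lambda>l. bas ((i, k), (j, l)))))))))"
    by (subst bnd_comm [of "d _" "u _"], subst bnd_comm [of "d _" "v _"]) simp
  also have "\<dots> = pair d (pair d u v) (pair d u v) x"
    by (simp add: pair_def bnd_assoc)
  finally show "bnd (pair d u v x) (tens_cm d1 d2) = pair d (pair d u v) (pair d u v) x" .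
  have "bnd (pair d u v x) (tens_cu e1 e2) = bnd (d x) (\<lambda>z. bnd (u (fst z)) (\<lambda>i. bnd (v (snd z))
      (\<lambda>j. bnd (e1 i) (\<lambda>_. e2 j))))"
    by (simp add: pair_def tens_cu_def bnd_assoc)
  also have "\<dots> = bnd (d x) (\<lambda>z. bnd (u (fst z)) (\<lambda>i. bnd (e1 i) (\<lambda>_. bnd (v (snd z)) e2)))"
    by (subst bnd_comm [of "v _" "e1 _"]) simp
  also have "\<dots> = e x"
    by (simp add: cmap_cu [OF v] cmap_cu_cont [OF u] ccoalg_counit_left [OF C])
  finally show "bnd (pair d u v x) (tens_cu e1 e2) = e x" .
qed

lemma cmap_comp:
  assumes u: "cmap d e d1 e1 u" and v: "cmap d1 e1 d2 e2 v"
  shows "cmap d e d2 e2 (\<lambda>x. bnd (u x) v)"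
  unfolding cmap_def
proof (intro allI conjI)
  fix x
  have "bnd (bnd (u x) v) d2 = bnd (u x) (\<lambda>i. bnd (d1 i) (\<lambda>z. bnd (v (fst z)) (\<lambda>k. bnd (v (snd z))
      (\<lambda>l. bas (k, l)))))"
    by (simp add: bnd_assoc cmap_cm [OF v] pair_def)
  also have "\<dots> = bnd (d x) (\<lambda>z. bnd (u (fst z)) (\<lambda>i. bnd (u (snd z)) (\<lambda>j. bnd (v i) (\<lambda>k. bnd (v j)
      (\<lambda>l. bas (k, l))))))"
    by (rule cmap_cm_cont [OF u, where F="\<lambda>i j. bnd (v i) (\<lambda>k. bnd (v j) (\<lambda>l. bas (k, l)))"])
  also have "\<dots> = bnd (d x) (\<lambda>z. bnd (u (fst z)) (\<lambda>i. bnd (v i) (\<lambda>k. bnd (u (snd z)) (\<lambda>j. bnd (v j)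
      (\<lambda>l. bas (k, l))))))"
    by (subst bnd_comm [of "u _" "v _"]) simp
  finally show "bnd (bnd (u x) v) d2 = pair d (\<lambda>x. bnd (u x) v) (\<lambda>x. bnd (u x) v) x"
    by (simp add: pair_def bnd_assoc)
  show "bnd (bnd (u x) v) e2 = e x"
    by (simp add: bnd_assoc cmap_cu [OF v] cmap_cu [OF u])
qed

lemma cmap_bas: "cmap d e d e bas"
  by (simp add: cmap_def pair_def)

text \<open>Applying v (x) v to the compatibility of u with the comultiplications and precomposing
  with v cancels every copy of u. The antipode is later shown to be a coalgebra map in this
  way.\<close>

lemma cmap_inverse:
  assumes u: "cmap d e d' e' u" and 1: "\<And>x. bnd (u x) v = bas x" and 2: "\<And>y. bnd (v y) u = bas y"
  shows "cmap d' e' d e v"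
  unfolding cmap_def
proof (intro allI conjI)
  fix y
  let ?vv = "\<lambda>w. bnd (v (fst w)) (\<lambda>i. bnd (v (snd w)) (\<lambda>j. bas (i, j)))"
  have *: "bnd (bnd (u x) d') ?vv = d x" for x
  proof -
    have "bnd (bnd (u x) d') ?vv = bnd (d x) (\<lambda>z. bnd (u (fst z)) (\<lambda>i. bnd (u (snd z)) (\<lambda>j.
       bnd (v i) (\<lambda>k. bnd (v j) (\<lambda>l. bas (k, l))))))"
      by (simp add: cmap_cm [OF u] pair_def bnd_assoc)
    also have "\<dots> = bnd (d x) (\<lambda>z. bnd (bnd (u (fst z)) v) (\<lambda>k. bnd (bnd (u (snd z)) v) (\<lambda>l. bas (k, l))))"
      by (subst bnd_comm [of "u _" "v _"]) (simp add: bnd_assoc)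
    finally show ?thesis by (simp add: 1)
  qed
  have "bnd (v y) d = bnd (v y) (\<lambda>x. bnd (bnd (u x) d') ?vv)" using * by simp
  also have "\<dots> = bnd (bnd (v y) u) (\<lambda>i. bnd (d' i) ?vv)" by (simp add: bnd_assoc)
  finally show "bnd (v y) d = pair d' v v y" by (simp add: 2 pair_def)
  have "bnd (v y) e = bnd (bnd (v y) u) e'" by (simp add: bnd_assoc cmap_cu [OF u])
  then show "bnd (v y) e = e' y" by (simp add: 2)
qed

section \<open>Points of a cocommutative Hopf algebra\<close>

definition hcm :: "('i::finite, 'k::field) hopf_data \<Rightarrow> 'i \<Rightarrow> 'i \<times> 'i \<Rightarrow> 'k" where
  "hcm H i = cop H (bas i)"

definition hcu :: "('i::finite, 'k::field) hopf_data \<Rightarrow> 'i \<Rightarrow> unit \<Rightarrow> 'k" where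
  "hcu H i = (\<lambda>_. eps H (bas i))"

definition hmk :: "('i::finite, 'k::field) hopf_data \<Rightarrow> 'i \<times> 'i \<Rightarrow> 'i \<Rightarrow> 'k" where
  "hmk H z = hmul H (bas (fst z)) (bas (snd z))"

definition hak :: "('i::finite, 'k::field) hopf_data \<Rightarrow> 'i \<Rightarrow> 'i \<Rightarrow> 'k" where
  "hak H i = ant H (bas i)"

lemma sum_bas_mult [simp]:
  fixes f :: "'i::finite \<Rightarrow> 'k::field"
  shows "(\<Sum>l\<in>UNIV. bas i l * f l) = f i" "(\<Sum>l\<in>UNIV. f l * bas l i) = f i"
  by (simp_all add: bas_def if_distrib [of "\<lambda>x. x * _"] if_distrib [of "\<lambda>x. _ * x"] cong: if_cong)

lemma bas_sym: "bas i j = bas j i"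
  by (simp add: bas_def)

lemma bas_Pair: "bas z (p, q) = bas (fst z) p * bas (snd z) q"
  by (auto simp: bas_def prod_eq_iff)

lemma bnd_pair: "bnd v M q = (\<Sum>a\<in>UNIV. \<Sum>b\<in>UNIV. v (a, b) * M (a, b) q)"
  by (simp add: bnd_def sum.cartesian_product)

lemma bnd_bas_Pair_left: "bnd v (\<lambda>y. bas (c, y)) (p, q) = bas c p * v q"
proof -
  have "bnd v (\<lambda>y. bas (c, y)) (p, q) = bas c p * (\<Sum>y\<in>UNIV. v y * bas y q)"
    unfolding sum_distrib_left by (simp add: bnd_def bas_Pair mult_ac)
  then show ?thesis by simp
qed

lemma bnd_bas_Pair_right: "bnd v (\<lambda>y. bas (y, c)) (p, q) = v p * bas c q"
  by (simp add: bnd_def bas_Pair flip: mult.assoc sum_distrib_right)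

lemma bnd_bas_triple:
  fixes v :: "'p::finite \<times> 'q::finite \<Rightarrow> 'k::field"
  shows "bnd v (\<lambda>y. bas (fst y, snd y, c)) (p, q, r) = v (p, q) * bas c r"
proof -
  have "bas (fst y, snd y, c) (p, q, r) = (bas (y, c) ((p, q), r) :: 'k)" for y
    by (simp add: bas_Pair mult.assoc)
  then have "bnd v (\<lambda>y. bas (fst y, snd y, c)) (p, q, r) = bnd v (\<lambda>y. bas (y, c)) ((p, q), r)"
    by (simp add: bnd_def)
  then show ?thesis by (simp add: bnd_bas_Pair_right)
qed

lemma cop_eq_bnd: "cop H x = bnd x (hcm H)"
proof -
  have "hcom H l i j = hcm H l (i, j)" for l i j
    unfolding hcm_def cop_def by simp
  then show ?thesis by (simp add: cop_def bnd_def fun_eq_iff)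
qed

lemma eps_eq_bnd: "eps H x = bnd x (hcu H) ()"
  by (simp add: eps_def bnd_def hcu_def)

lemma hmul_eq_bnd: "hmul H x y = bnd x (\<lambda>i. bnd y (\<lambda>j. hmk H (i, j)))"
proof -
  have "hmu H i j l = hmk H (i, j) l" for i j l
    unfolding hmk_def hmul_def by (simp add: mult.assoc flip: sum_distrib_left)
  then show ?thesis by (simp add: hmul_def bnd_def fun_eq_iff sum_distrib_left mult.assoc)
qed

lemma ant_eq_bnd: "ant H x = bnd x (hak H)"
  by (simp add: ant_def bnd_def hak_def)

section \<open>The Hopf algebra axioms as identities between kernels\<close>

locale cocomm_hopf =
  fixes H :: "('i::finite, 'k::field) hopf_data"
  assumes is_hopf: "is_hopf H" and cocommutative: "cocommutative H"
begin

abbreviation "\<Delta> \<equiv> hcm H"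
abbreviation "\<epsilon> \<equiv> hcu H"
abbreviation "\<mu> \<equiv> hmk H"

text \<open>\<open>is_hopf\<close> states its axioms as coordinate sums. At a fixed coordinate each
  unit vector in the binds is a Kronecker delta, and summing it out leaves exactly such a
  sum.\<close>

lemma ccoalg_hopf: "ccoalg \<Delta> \<epsilon>"
  unfolding ccoalg_def
proof (intro conjI allI)
  fix x
  show "bnd (\<Delta> x) (\<lambda>z. bnd (\<Delta> (snd z)) (\<lambda>y. bas (fst z, fst y, snd y))) =
      bnd (\<Delta> x) (\<lambda>z. bnd (\<Delta> (fst z)) (\<lambda>y. bas (fst y, snd y, snd z)))"
  proof
    fix w :: "'i \<times> 'i \<times> 'i"
    obtain p q r where w: "w = (p, q, r)" by (cases w)
    have 1: "bnd (\<Delta> (snd z)) (\<lambda>y. bas (fst z, fst y, snd y)) (p, q, r)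
        = bas (fst z) p * \<Delta> (snd z) (q, r)" for z
      by (simp add: bnd_bas_Pair_left bnd_bas_Pair_right)
    have 2: "bnd (\<Delta> (fst z)) (\<lambda>y. bas (fst y, snd y, snd z)) (p, q, r)
        = \<Delta> (fst z) (p, q) * bas (snd z) r" for z
        by (rule bnd_bas_triple)
    have "bnd (\<Delta> x) (\<lambda>z. bnd (\<Delta> (snd z)) (\<lambda>y. bas (fst z, fst y, snd y))) w
        = (\<Sum>a\<in>UNIV. \<Sum>b\<in>UNIV. bas a p * (\<Delta> x (a, b) * \<Delta> b (q, r)))"
      unfolding w bnd_pair [of "\<Delta> x"] 1 by (simp add: mult_ac)
    also have "\<dots> = (\<Sum>b\<in>UNIV. \<Delta> x (p, b) * \<Delta> b (q, r))"
      by (simp add: bas_sym [of _ p] flip: sum_distrib_left)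
    also have "\<dots> = (\<Sum>a\<in>UNIV. \<Delta> x (a, r) * \<Delta> a (p, q))"
      using is_hopf by (simp add: is_hopf_def hcm_def)
    also have "\<dots> = (\<Sum>a\<in>UNIV. \<Sum>b\<in>UNIV. bas r b * (\<Delta> x (a, b) * \<Delta> a (p, q)))"
      by simp
    also have "\<dots> = bnd (\<Delta> x) (\<lambda>z. bnd (\<Delta> (fst z)) (\<lambda>y. bas (fst y, snd y, snd z))) w"
      unfolding w bnd_pair [of "\<Delta> x"] 2 by (simp add: mult_ac bas_sym [of _ r])
    finally show "bnd (\<Delta> x) (\<lambda>z. bnd (\<Delta> (snd z)) (\<lambda>y. bas (fst z, fst y, snd y))) w =
      bnd (\<Delta> x) (\<lambda>z. bnd (\<Delta> (fst z)) (\<lambda>y. bas (fst y, snd y, snd z))) w" .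
  qed
  show "bnd (\<Delta> x) (\<lambda>z. bnd (\<epsilon> (fst z)) (\<lambda>_. bas (snd z))) = bas x"
  proof
    fix j
    have "bnd (\<Delta> x) (\<lambda>z. bnd (\<epsilon> (fst z)) (\<lambda>_. bas (snd z))) j
        = (\<Sum>i\<in>UNIV. \<Sum>b\<in>UNIV. bas j b * (\<Delta> x (i, b) * eps H (bas i)))"
      unfolding bnd_pair [of "\<Delta> x"] by (simp add: bnd_def UNIV_unit hcu_def mult_ac bas_sym [of _ j])
    also have "\<dots> = (\<Sum>i\<in>UNIV. cop H (bas x) (i, j) * eps H (bas i))"
      by (simp add: hcm_def)
    also have "\<dots> = bas x j"
    proof -
      have "(\<lambda>j. \<Sum>i\<in>UNIV. cop H (bas x) (i, j) * eps H (bas i)) = bas x"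
        using is_hopf unfolding is_hopf_def by blast
      then show ?thesis by (rule fun_cong)
    qed
    finally show "bnd (\<Delta> x) (\<lambda>z. bnd (\<epsilon> (fst z)) (\<lambda>_. bas (snd z))) j = bas x j" .
  qed
  show "bnd (\<Delta> x) (\<lambda>z. bas (snd z, fst z)) = \<Delta> x"
  proof
    fix w :: "'i \<times> 'i"
    obtain p q where w: "w = (p, q)" by (cases w)
    have "bnd (\<Delta> x) (\<lambda>z. bas (snd z, fst z)) w = (\<Sum>a\<in>UNIV. bas q a * (\<Sum>b\<in>UNIV. bas p b * \<Delta> x (a, b)))"
      by (simp only: w bnd_pair bas_Pair fst_conv snd_conv sum_distrib_left bas_sym [of _ p] bas_sym [of _ q] mult_ac)
    also have "\<dots> = \<Delta> x w"
      using cocommutative by (simp add: cocommutative_def hcm_def w)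
    finally show "bnd (\<Delta> x) (\<lambda>z. bas (snd z, fst z)) w = \<Delta> x w" .
  qed
qed

lemma mult_assoc: "bnd (\<mu> (i, j)) (\<lambda>l. \<mu> (l, k)) = bnd (\<mu> (j, k)) (\<lambda>l. \<mu> (i, l))"
proof -
  have "hmul H (hmul H (bas i) (bas j)) (bas k) = hmul H (bas i) (hmul H (bas j) (bas k))"
    using is_hopf by (simp add: is_hopf_def)
  then show ?thesis by (simp add: hmul_eq_bnd)
qed

lemma mult_one: "bnd (hone H) (\<lambda>i. \<mu> (i, j)) = bas j" "bnd (hone H) (\<lambda>i. \<mu> (j, i)) = bas j"
proof -
  have "hmul H (hone H) (bas j) = bas j" "hmul H (bas j) (hone H) = bas j"
    using is_hopf by (simp_all add: is_hopf_def)
  then show "bnd (hone H) (\<lambda>i. \<mu> (i, j)) = bas j" "bnd (hone H) (\<lambda>i. \<mu> (j, i)) = bas j"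
    by (simp_all add: hmul_eq_bnd)
qed

lemma antipode:
  "bnd (\<Delta> x) (\<lambda>z. bnd (hak H (fst z)) (\<lambda>i. \<mu> (i, snd z))) = bnd (\<epsilon> x) (\<lambda>_. hone H)"
  "bnd (\<Delta> x) (\<lambda>z. bnd (hak H (snd z)) (\<lambda>i. \<mu> (fst z, i))) = bnd (\<epsilon> x) (\<lambda>_. hone H)"
proof -
  have 1: "(\<lambda>l. \<Sum>i\<in>UNIV. \<Sum>j\<in>UNIV. cop H (bas x) (i, j) * hmul H (ant H (bas i)) (bas j) l)
            = (\<lambda>l. eps H (bas x) * hone H l)"
    and 2: "(\<lambda>l. \<Sum>i\<in>UNIV. \<Sum>j\<in>UNIV. cop H (bas x) (i, j) * hmul H (bas i) (ant H (bas j)) l)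
            = (\<lambda>l. eps H (bas x) * hone H l)"
    using is_hopf by (simp_all add: is_hopf_def)
  have e: "bnd (\<epsilon> x) (\<lambda>_. hone H) = (\<lambda>l. eps H (bas x) * hone H l)"
    by (simp add: bnd_def hcu_def UNIV_unit)
  show "bnd (\<Delta> x) (\<lambda>z. bnd (hak H (fst z)) (\<lambda>i. \<mu> (i, snd z))) = bnd (\<epsilon> x) (\<lambda>_. hone H)"
    unfolding e 1 [symmetric] by (rule ext) (simp add: bnd_pair hmul_eq_bnd ant_eq_bnd cop_eq_bnd)
  show "bnd (\<Delta> x) (\<lambda>z. bnd (hak H (snd z)) (\<lambda>i. \<mu> (fst z, i))) = bnd (\<epsilon> x) (\<lambda>_. hone H)"
    unfolding e 2 [symmetric] by (rule ext) (simp add: bnd_pair hmul_eq_bnd ant_eq_bnd cop_eq_bnd)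
qed

section \<open>The convolution group of points\<close>

abbreviation "tcm \<equiv> tens_cm \<Delta> \<Delta>"
abbreviation "tcu \<equiv> tens_cu \<epsilon> \<epsilon>"

lemma cmap_mult: "cmap tcm tcu \<Delta> \<epsilon> \<mu>"
  unfolding cmap_def
proof (intro conjI allI)
  fix w :: "'i \<times> 'i"
  have "bnd (\<mu> w) \<Delta> = cop H (hmul H (bas (fst w)) (bas (snd w)))"
    by (simp add: cop_eq_bnd hmul_eq_bnd)
  also have "\<dots> = bnd (\<Delta> (fst w)) (\<lambda>z. bnd (\<Delta> (snd w)) (\<lambda>y.
        bnd (\<mu> (fst z, fst y)) (\<lambda>i. bnd (\<mu> (snd z, snd y)) (\<lambda>j. bas (i, j)))))" (is "?l = ?r")
  proof
    fix v :: "'i \<times> 'i"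
    obtain p q where v: "v = (p, q)" by (cases v)
    have 1: "bnd (\<mu> (a, b)) (\<lambda>i. bnd (\<mu> (a', b')) (\<lambda>j. bas (i, j))) (p, q)
        = \<mu> (a, b) p * \<mu> (a', b') q" for a b a' b'
    proof -
      have "bnd (\<mu> (a, b)) (\<lambda>i. bnd (\<mu> (a', b')) (\<lambda>j. bas (i, j))) (p, q)
          = (\<Sum>i\<in>UNIV. \<mu> (a, b) i * bas i p * \<mu> (a', b') q)"
        by (simp add: bnd_def [of "\<mu> (a, b)"] bnd_bas_Pair_left mult.assoc)
      then show ?thesis by (simp flip: sum_distrib_right)
    qed
    have "?r v = (\<Sum>i\<in>UNIV. \<Sum>j\<in>UNIV. \<Sum>i'\<in>UNIV. \<Sum>j'\<in>UNIV.
           \<Delta> (fst w) (i, j) * (\<Delta> (snd w) (i', j') * (\<mu> (i, i') p * \<mu> (j, j') q)))"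
      by (simp add: v 1 bnd_pair [of "\<Delta> _"] sum_distrib_left)
    moreover have "cop H (hmul H (bas (fst w)) (bas (snd w))) (p, q) =
        (\<Sum>i\<in>UNIV. \<Sum>j\<in>UNIV. \<Sum>i'\<in>UNIV. \<Sum>j'\<in>UNIV. cop H (bas (fst w)) (i, j) *
           cop H (bas (snd w)) (i', j') * hmul H (bas i) (bas i') p * hmul H (bas j) (bas j') q)"
      using is_hopf unfolding is_hopf_def by blast
    ultimately show "?l v = ?r v"
      by (simp add: v hcm_def hmk_def mult.assoc)
  qed
  also have "\<dots> = pair tcm \<mu> \<mu> w"
    by (simp add: pair_def tens_cm_def bnd_assoc)
  finally show "bnd (\<mu> w) \<Delta> = pair tcm \<mu> \<mu> w" .
  have "eps H (hmul H (bas (fst w)) (bas (snd w))) = eps H (bas (fst w)) * eps H (bas (snd w))"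
    using is_hopf by (simp add: is_hopf_def)
  then show "bnd (\<mu> w) \<epsilon> = tcu w"
    by (simp add: fun_eq_iff hmul_eq_bnd) (simp add: eps_eq_bnd tens_cu_def bnd_def UNIV_unit)
qed

definition onep :: "('c \<Rightarrow> unit \<Rightarrow> 'k) \<Rightarrow> 'c \<Rightarrow> 'i \<Rightarrow> 'k" where
  "onep e x = bnd (e x) (\<lambda>_. hone H)"

definition mulp :: "('c::finite \<Rightarrow> 'c \<times> 'c \<Rightarrow> 'k) \<Rightarrow> ('c \<Rightarrow> 'i \<Rightarrow> 'k) \<Rightarrow> ('c \<Rightarrow> 'i \<Rightarrow> 'k) \<Rightarrow> 'c \<Rightarrow> 'i \<Rightarrow> 'k" where
  "mulp d u v x = bnd (pair d u v x) \<mu>"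

definition invp :: "('c \<Rightarrow> 'i \<Rightarrow> 'k) \<Rightarrow> 'c \<Rightarrow> 'i \<Rightarrow> 'k" where
  "invp u x = bnd (u x) (hak H)"

lemma mulp_eq: "mulp d u v x = bnd (d x) (\<lambda>z. bnd (u (fst z)) (\<lambda>i. bnd (v (snd z)) (\<lambda>j. \<mu> (i, j))))"
  by (simp add: mulp_def pair_def bnd_assoc)

lemma mulp_assoc:
  assumes C: "ccoalg d e"
  shows "mulp d (mulp d u v) w = mulp d u (mulp d v w)"
proof
  fix x
  have "mulp d (mulp d u v) w x = bnd (d x) (\<lambda>z. bnd (d (fst z)) (\<lambda>y. bnd (u (fst y))
      (\<lambda>i. bnd (v (snd y)) (\<lambda>j.
     bnd (\<mu> (i, j)) (\<lambda>l. bnd (w (snd z)) (\<lambda>k. \<mu> (l, k)))))))"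
    by (simp add: mulp_eq bnd_assoc)
  also have "\<dots> = bnd (d x) (\<lambda>z. bnd (d (fst z)) (\<lambda>y. bnd (u (fst y)) (\<lambda>i. bnd (v (snd y)) (\<lambda>j.
     bnd (w (snd z)) (\<lambda>k. bnd (\<mu> (j, k)) (\<lambda>l. \<mu> (i, l)))))))"
    by (subst bnd_comm [of "\<mu> _"]) (simp add: mult_assoc)
  also have "\<dots> = bnd (d x) (\<lambda>z. bnd (d (snd z)) (\<lambda>y. bnd (u (fst z)) (\<lambda>i. bnd (v (fst y)) (\<lambda>j.
     bnd (w (snd y)) (\<lambda>k. bnd (\<mu> (j, k)) (\<lambda>l. \<mu> (i, l)))))))"
    by (rule ccoalg_coassoc [OF C, symmetric, where F="\<lambda>a b c. bnd (u a) (\<lambda>i. bnd (v b) (\<lambda>j.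
     bnd (w c) (\<lambda>k. bnd (\<mu> (j, k)) (\<lambda>l. \<mu> (i, l)))))"])
  also have "\<dots> = mulp d u (mulp d v w) x"
    by (subst bnd_comm [of "d _" "u _"]) (simp add: mulp_eq bnd_assoc)
  finally show "mulp d (mulp d u v) w x = mulp d u (mulp d v w) x" .
qed

lemma mulp_onep_left:
  assumes C: "ccoalg d e"
  shows "mulp d (onep e) u = u"
proof
  fix x
  have "mulp d (onep e) u x = bnd (d x) (\<lambda>z. bnd (e (fst z)) (\<lambda>_. bnd (u (snd z)) (\<lambda>j. bnd (hone H)
      (\<lambda>i. \<mu> (i, j)))))"
    by (subst bnd_comm [of "u _"]) (simp add: mulp_eq onep_def bnd_assoc)
  then show "mulp d (onep e) u x = u x"
    by (simp add: mult_one ccoalg_counit_left [OF C])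
qed

lemma mulp_onep_right:
  assumes C: "ccoalg d e"
  shows "mulp d u (onep e) = u"
proof
  fix x
  have "mulp d u (onep e) x = bnd (d x) (\<lambda>z. bnd (e (snd z)) (\<lambda>_. bnd (u (fst z)) (\<lambda>j. bnd (hone H)
      (\<lambda>i. \<mu> (j, i)))))"
    by (subst bnd_comm [of "e _"]) (simp add: mulp_eq onep_def bnd_assoc)
  then show "mulp d u (onep e) x = u x"
    by (simp add: mult_one ccoalg_counit_right [OF C])
qed

text \<open>As u is a coalgebra map, u(x_1) (x) u(x_2) is the comultiplication of u(x), so the
  antipode axiom applies to the single element u(x).\<close>

lemma mulp_invp_left:
  assumes u: "cmap d e \<Delta> \<epsilon> u"
  shows "mulp d (invp u) u = onep e"
proof
  fix x
  have "mulp d (invp u) u x = bnd (d x) (\<lambda>z. bnd (u (fst z)) (\<lambda>i. bnd (u (snd z)) (\<lambda>j. bnd (hak H i)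
      (\<lambda>l. \<mu> (l, j)))))"
    by (subst bnd_comm [of "u _" "hak H _"]) (simp add: mulp_eq invp_def bnd_assoc)
  also have "\<dots> = bnd (u x) (\<lambda>i. bnd (\<Delta> i) (\<lambda>z. bnd (hak H (fst z)) (\<lambda>l. \<mu> (l, snd z))))"
    by (rule cmap_cm_cont [OF u, symmetric, where F="\<lambda>i j. bnd (hak H i) (\<lambda>l. \<mu> (l, j))"])
  finally show "mulp d (invp u) u x = onep e x"
    by (simp add: antipode cmap_cu_cont [OF u] onep_def)
qed

lemma mulp_invp_right:
  assumes u: "cmap d e \<Delta> \<epsilon> u"
  shows "mulp d u (invp u) = onep e"
proof
  fix x
  have "mulp d u (invp u) x = bnd (d x) (\<lambda>z. bnd (u (fst z)) (\<lambda>i. bnd (u (snd z)) (\<lambda>j. bnd (hak H j)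
      (\<lambda>l. \<mu> (i, l)))))"
    by (simp add: mulp_eq invp_def bnd_assoc)
  also have "\<dots> = bnd (u x) (\<lambda>i. bnd (\<Delta> i) (\<lambda>z. bnd (hak H (snd z)) (\<lambda>l. \<mu> (fst z, l))))"
    by (rule cmap_cm_cont [OF u, symmetric, where F="\<lambda>i j. bnd (hak H j) (\<lambda>l. \<mu> (i, l))"])
  finally show "mulp d u (invp u) x = onep e x"
    by (simp add: antipode cmap_cu_cont [OF u] onep_def)
qed

lemma comult_hone: "bnd (hone H) \<Delta> = bnd (hone H) (\<lambda>i. bnd (hone H) (\<lambda>j. bas (i, j)))"
proof -
  have "cop H (hone H) v = bnd (hone H) (\<lambda>i. bnd (hone H) (\<lambda>j. bas (i, j))) v" for v
  proof -
    obtain p q where v: "v = (p, q)" by (cases v)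
    have "bnd (hone H) (\<lambda>i. bnd (hone H) (\<lambda>j. bas (i, j))) v = (\<Sum>i\<in>UNIV. hone H i * bas i p * hone H q)"
      by (simp add: v bnd_def [of _ "\<lambda>i. bnd (hone H) (M i)" for M] bnd_bas_Pair_left mult.assoc)
    then show ?thesis
      using is_hopf by (simp add: v is_hopf_def flip: sum_distrib_right)
  qed
  then show ?thesis
    by (simp add: cop_eq_bnd fun_eq_iff)
qed

lemma cmap_onep:
  assumes C: "ccoalg d e"
  shows "cmap d e \<Delta> \<epsilon> (onep e)"
  unfolding cmap_def
proof (intro conjI allI)
  fix x
  have "bnd (onep e x) \<Delta> = bnd (e x) (\<lambda>_. bnd (hone H) (\<lambda>i. bnd (hone H) (\<lambda>j. bas (i, j))))"
    by (simp add: onep_def bnd_assoc comult_hone)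
  also have "\<dots> = bnd (d x) (\<lambda>z. bnd (e (fst z)) (\<lambda>_. bnd (e (snd z)) (\<lambda>_. bnd (hone H) (\<lambda>i. bnd (hone H)
      (\<lambda>j. bas (i, j))))))"
    by (simp add: ccoalg_counit_left [OF C, where F="\<lambda>y. bnd (e y) _"])
  also have "\<dots> = bnd (d x) (\<lambda>z. bnd (e (fst z)) (\<lambda>_. bnd (hone H) (\<lambda>i. bnd (e (snd z)) (\<lambda>_. bnd (hone H)
      (\<lambda>j. bas (i, j))))))"
    by (subst bnd_comm [of "e _" "hone H"]) simp
  finally show "bnd (onep e x) \<Delta> = pair d (onep e) (onep e) x"
    by (simp add: pair_def onep_def bnd_assoc)
  have "eps H (hone H) = 1" using is_hopf by (simp add: is_hopf_def)
  then have "bnd (hone H) \<epsilon> = (\<lambda>_. 1)" by (simp add: eps_eq_bnd fun_eq_iff)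
  moreover have "bas () = (\<lambda>_::unit. 1::'k)" by (simp add: bas_def)
  ultimately have "bnd (hone H) \<epsilon> = bas ()" by simp
  then show "bnd (onep e x) \<epsilon> = e x"
    by (simp add: onep_def bnd_assoc)
qed

lemma cmap_mulp:
  assumes "ccoalg d e" "cmap d e \<Delta> \<epsilon> u" "cmap d e \<Delta> \<epsilon> v"
  shows "cmap d e \<Delta> \<epsilon> (mulp d u v)"
  unfolding mulp_def by (rule cmap_comp [OF cmap_pair [OF assms] cmap_mult])

text \<open>The projections of H (x) H form the generic pair of points: by \<open>pair_fstp\<close>
  and \<open>pair_sndp\<close> every pair of points arises from them by composition with
  \<open>pair\<close>.\<close>

definition fstp :: "'i \<times> 'i \<Rightarrow> 'i \<Rightarrow> 'k" where "fstp z = bnd (\<epsilon> (snd z)) (\<lambda>_. bas (fst z))"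
definition sndp :: "'i \<times> 'i \<Rightarrow> 'i \<Rightarrow> 'k" where "sndp z = bnd (\<epsilon> (fst z)) (\<lambda>_. bas (snd z))"

lemma ccoalg_tensor: "ccoalg tcm tcu"
  by (rule ccoalg_tens [OF ccoalg_hopf ccoalg_hopf])

lemma counit_comult: "bnd (\<Delta> x) (\<lambda>z. bnd (\<epsilon> (fst z)) (\<lambda>_. bnd (\<epsilon> (snd z)) F)) = bnd (\<epsilon> x) F"
  by (simp add: ccoalg_counit_left [OF ccoalg_hopf, where F="\<lambda>y. bnd (\<epsilon> y) _"])

lemma cmap_fstp: "cmap tcm tcu \<Delta> \<epsilon> fstp"
  unfolding cmap_def
proof (intro conjI allI)
  fix p :: "'i \<times> 'i"
  have "pair tcm fstp fstp p = bnd (\<Delta> (fst p)) (\<lambda>z. bnd (\<Delta> (snd p)) (\<lambda>w. bnd (\<epsilon> (fst w))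
      (\<lambda>_. bnd (\<epsilon> (snd w)) (\<lambda>_. bas z))))"
    by (simp add: pair_def fstp_def tens_cm_def bnd_assoc)
  also have "\<dots> = bnd (\<epsilon> (snd p)) (\<lambda>_. \<Delta> (fst p))"
    by (simp add: counit_comult, subst bnd_comm) simp
  finally show "bnd (fstp p) \<Delta> = pair tcm fstp fstp p"
    by (simp add: fstp_def bnd_assoc)
  show "bnd (fstp p) \<epsilon> = tcu p"
    by (simp add: fstp_def bnd_assoc tens_cu_def) (simp add: bnd_def UNIV_unit mult.commute)
qed

lemma cmap_sndp: "cmap tcm tcu \<Delta> \<epsilon> sndp"
  unfolding cmap_def
proof (intro conjI allI)
  fix p :: "'i \<times> 'i"
  have "pair tcm sndp sndp p = bnd (\<Delta> (fst p)) (\<lambda>z. bnd (\<Delta> (snd p)) (\<lambda>w. bnd (\<epsilon> (fst z))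
      (\<lambda>_. bnd (\<epsilon> (snd z)) (\<lambda>_. bas w))))"
    by (simp add: pair_def sndp_def tens_cm_def bnd_assoc)
  also have "\<dots> = bnd (\<Delta> (fst p)) (\<lambda>z. bnd (\<epsilon> (fst z)) (\<lambda>_. bnd (\<epsilon> (snd z)) (\<lambda>_. \<Delta> (snd p))))"
    by (subst bnd_comm [of "\<Delta> (snd p)"], subst bnd_comm [of "\<Delta> (snd p)"]) simp
  finally show "bnd (sndp p) \<Delta> = pair tcm sndp sndp p"
    by (simp add: sndp_def bnd_assoc counit_comult)
  show "bnd (sndp p) \<epsilon> = tcu p"
    by (simp add: sndp_def bnd_assoc tens_cu_def)
qed

text \<open>The map \<open>h \<otimes> l \<mapsto> h\<^sub>1 \<otimes> f(h\<^sub>2) l\<close>. For f the identity it is a coalgebra map, and its inverse is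
  obtained with f the antipode; hence the antipode is a coalgebra map.\<close>

definition bet :: "('i \<Rightarrow> 'i \<Rightarrow> 'k) \<Rightarrow> 'i \<times> 'i \<Rightarrow> 'i \<times> 'i \<Rightarrow> 'k" where
  "bet f p = bnd (\<Delta> (fst p)) (\<lambda>z. bnd (f (snd z)) (\<lambda>i. bnd (\<mu> (i, snd p)) (\<lambda>j. bas (fst z, j))))"

text \<open>\<open>bet g\<close> keeps the leg h_1, which \<open>bet f\<close> splits again, so the
  composite is h_1 (x) f(h_2) g(h_3) l. Thus \<open>bet\<close> turns convolution into composition,
  and convolution inverses into inverse maps.\<close>

lemma bet_comp: "bnd (bet g p) (bet f) = bet (mulp \<Delta> f g) p"
proof -
  have "bnd (bet g p) (bet f) = bnd (\<Delta> (fst p)) (\<lambda>z. bnd (g (snd z)) (\<lambda>i. bnd (\<mu> (i, snd p)) (\<lambda>j.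
     bnd (\<Delta> (fst z)) (\<lambda>y. bnd (f (snd y)) (\<lambda>k. bnd (\<mu> (k, j)) (\<lambda>l. bas (fst y, l)))))))"
    by (simp add: bet_def bnd_assoc)
  also have "\<dots> = bnd (\<Delta> (fst p)) (\<lambda>z. bnd (\<Delta> (fst z)) (\<lambda>y. bnd (f (snd y)) (\<lambda>k. bnd (g (snd z)) (\<lambda>i.
      bnd (bnd (\<mu> (i, snd p)) (\<lambda>j. \<mu> (k, j))) (\<lambda>l. bas (fst y, l))))))"
    unfolding bnd_assoc
    by (subst bnd_comm [of "\<mu> _" "\<Delta> _"], subst bnd_comm [of "\<mu> _" "f _"], subst bnd_comm [of "g _" "\<Delta> _"], subst bnd_comm [of "g _" "f _"]) simp
  also have "\<dots> = bnd (\<Delta> (fst p)) (\<lambda>z. bnd (\<Delta> (fst z)) (\<lambda>y. bnd (f (snd y)) (\<lambda>k. bnd (g (snd z)) (\<lambda>i.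
      bnd (\<mu> (k, i)) (\<lambda>j. bnd (\<mu> (j, snd p)) (\<lambda>l. bas (fst y, l)))))))"
    by (simp add: mult_assoc [symmetric] bnd_assoc)
  also have "\<dots> = bnd (\<Delta> (fst p)) (\<lambda>z. bnd (\<Delta> (snd z)) (\<lambda>y. bnd (f (fst y)) (\<lambda>k. bnd (g (snd y)) (\<lambda>i.
      bnd (\<mu> (k, i)) (\<lambda>j. bnd (\<mu> (j, snd p)) (\<lambda>l. bas (fst z, l)))))))"
    by (rule ccoalg_coassoc [OF ccoalg_hopf, symmetric, where F="\<lambda>a b c. bnd (f b) (\<lambda>k. bnd (g c) (\<lambda>i.
      bnd (\<mu> (k, i)) (\<lambda>j. bnd (\<mu> (j, snd p)) (\<lambda>l. bas (a, l)))))"])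
  finally show ?thesis
    by (simp add: bet_def mulp_eq bnd_assoc)
qed

lemma bet_onep: "bet (onep \<epsilon>) p = bas p"
proof -
  have "bet (onep \<epsilon>) p = bnd (\<Delta> (fst p)) (\<lambda>z. bnd (\<epsilon> (snd z)) (\<lambda>_. bnd (bnd (hone H) (\<lambda>i. \<mu> (i, snd p)))
      (\<lambda>j. bas (fst z, j))))"
    by (simp add: bet_def onep_def bnd_assoc)
  then show ?thesis by (simp add: mult_one ccoalg_counit_right [OF ccoalg_hopf, where F="\<lambda>x. bas (x, _)"])
qed

text \<open>h_1 (x) h_2 l is the pair formed by the first projection and the multiplication. Both
  are coalgebra maps on the cocommutative coalgebra H (x) H, so \<open>cmap_pair\<close>
  applies.\<close>

lemma cmap_bet_bas: "cmap tcm tcu tcm tcu (bet bas)"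
proof -
  have "bet bas = pair tcm fstp \<mu>"
  proof
    fix p :: "'i \<times> 'i"
    have "pair tcm fstp \<mu> p = bnd (\<Delta> (fst p)) (\<lambda>z. bnd (\<Delta> (snd p)) (\<lambda>y. bnd (\<epsilon> (fst y))
        (\<lambda>_. bnd (\<mu> (snd z, snd y)) (\<lambda>j. bas (fst z, j)))))"
      by (simp add: pair_def fstp_def tens_cm_def bnd_assoc)
    also have "\<dots> = bet bas p"
      by (simp add: bet_def ccoalg_counit_left [OF ccoalg_hopf, where F="\<lambda>x. bnd (\<mu> (_, x)) _"])
    finally show "bet bas p = pair tcm fstp \<mu> p" by simp
  qed
  then show ?thesis using cmap_pair [OF ccoalg_tensor cmap_fstp cmap_mult] by simp
qed

lemma invp_bas: "invp bas = hak H"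
  by (simp add: invp_def fun_eq_iff)

lemma cmap_antipode: "cmap \<Delta> \<epsilon> \<Delta> \<epsilon> (hak H)"
proof -
  have "cmap tcm tcu tcm tcu (bet (hak H))"
  proof (rule cmap_inverse [OF cmap_bet_bas])
    show "bnd (bet bas x) (bet (hak H)) = bas x" for x
      using mulp_invp_left [OF cmap_bas [of \<Delta> \<epsilon>]] by (simp add: bet_comp invp_bas bet_onep)
    show "bnd (bet (hak H) x) (bet bas) = bas x" for x
      using mulp_invp_right [OF cmap_bas [of \<Delta> \<epsilon>]] by (simp add: bet_comp invp_bas bet_onep)
  qed
  \<comment> \<open>S is recovered from the inverse by sending x to x (x) 1, then to x_1 (x) S(x_2),
    then to \<epsilon>(x_1) S(x_2) = S(x): a composite of coalgebra maps.\<close>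
  from cmap_comp [OF cmap_comp [OF cmap_pair [OF ccoalg_hopf cmap_bas cmap_onep [OF ccoalg_hopf]] this] cmap_sndp]
  have "cmap \<Delta> \<epsilon> \<Delta> \<epsilon> (\<lambda>x. bnd (bnd (pair \<Delta> bas (onep \<epsilon>) x) (bet (hak H))) sndp)" .
  moreover have "bnd (bnd (pair \<Delta> bas (onep \<epsilon>) x) (bet (hak H))) sndp = hak H x" for x
  proof -
    have "bnd (bnd (pair \<Delta> bas (onep \<epsilon>) x) (bet (hak H))) sndp = bnd (\<Delta> x) (\<lambda>z. bnd (\<epsilon> (snd z))
        (\<lambda>_. bnd (hone H) (\<lambda>i.
        bnd (\<Delta> (fst z)) (\<lambda>y. bnd (hak H (snd y)) (\<lambda>l. bnd (\<mu> (l, i)) (\<lambda>j. bnd (\<epsilon> (fst y)) (\<lambda>_. bas j)))))))"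
      by (simp add: pair_def onep_def bet_def sndp_def bnd_assoc)
    also have "\<dots> = bnd (hone H) (\<lambda>i. bnd (\<Delta> x) (\<lambda>y. bnd (\<epsilon> (fst y)) (\<lambda>_. bnd (hak H (snd y))
        (\<lambda>l. \<mu> (l, i)))))"
    proof -
      have "bnd (hone H) (\<lambda>i. bnd (\<Delta> x) (\<lambda>y. bnd (\<epsilon> (fst y)) (\<lambda>_. bnd (hak H (snd y)) (\<lambda>l. \<mu> (l, i)))))
        = bnd (hone H) (\<lambda>i. bnd (\<Delta> x) (\<lambda>y. bnd (hak H (snd y)) (\<lambda>l. bnd (\<mu> (l, i)) (\<lambda>j. bnd (\<epsilon> (fst y))
            (\<lambda>_. bas j)))))"
        by (subst bnd_comm [of "\<mu> _" "\<epsilon> _"], subst bnd_comm [of "hak H _" "\<epsilon> _"]) simp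
      then show ?thesis
        by (simp add: ccoalg_counit_right [OF ccoalg_hopf, where F="\<lambda>z. bnd (hone H) (\<lambda>i.
        bnd (\<Delta> z) (\<lambda>y. bnd (hak H (snd y)) (\<lambda>l. bnd (\<mu> (l, i)) (\<lambda>j. bnd (\<epsilon> (fst y)) (\<lambda>_. bas j)))))"])
    qed
    also have "\<dots> = bnd (hak H x) (\<lambda>l. bnd (hone H) (\<lambda>i. \<mu> (l, i)))"
      by (simp add: ccoalg_counit_left [OF ccoalg_hopf, where F="\<lambda>y. bnd (hak H y) _"], rule bnd_comm)
    finally show ?thesis by (simp add: mult_one)
  qed
  ultimately show ?thesis by simp
qed

lemma cmap_invp:
  assumes "cmap d e \<Delta> \<epsilon> u"
  shows "cmap d e \<Delta> \<epsilon> (invp u)"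
  unfolding invp_def by (rule cmap_comp [OF assms cmap_antipode])

end

section \<open>Convolution and the action on points\<close>

locale kalgebra =
  fixes \<phi> :: "'k::field \<Rightarrow> 'a::ring_1"
  assumes kalg: "kalg \<phi>"
begin

lemma phi_add: "\<phi> (x + y) = \<phi> x + \<phi> y"
  and phi_mult: "\<phi> (x * y) = \<phi> x * \<phi> y"
  and phi_one [simp]: "\<phi> 1 = 1"
  and phi_central: "\<phi> x * a = a * \<phi> x"
  using kalg unfolding kalg_def by blast+

lemma phi_zero [simp]: "\<phi> 0 = 0"
  using phi_add [of 0 0] by simp

lemma phi_sum: "\<phi> (sum f S) = (\<Sum>x\<in>S. \<phi> (f x))"
  by (induction S rule: infinite_finite_induct) (simp_all add: phi_add)

lemma phi_left_commute: "a * (\<phi> x * b) = \<phi> x * (a * b)"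
  by (simp add: phi_central mult.assoc)

text \<open>Elements of A are not coordinate vectors, so \<open>bnd\<close> does not reach them;
  this is its counterpart with values in A, where scalars act through \<open>\<phi>\<close>.\<close>

definition lin :: "('p::finite \<Rightarrow> 'k) \<Rightarrow> ('p \<Rightarrow> 'a) \<Rightarrow> 'a" where
  "lin v f = (\<Sum>p\<in>UNIV. \<phi> (v p) * f p)"

lemma lin_bas [simp]: "lin (bas p) f = f p"
proof -
  have "\<phi> (bas p q) * f q = (if q = p then f q else 0)" for q by (simp add: bas_def)
  then show ?thesis by (simp add: lin_def)
qed

lemma lin_bnd: "lin (bnd v M) f = lin v (\<lambda>p. lin (M p) f)"
proof -
  have "(\<Sum>q\<in>UNIV. \<Sum>p\<in>UNIV. \<phi> (v p * M p q) * f q) = (\<Sum>p\<in>UNIV. \<Sum>q\<in>UNIV. \<phi> (v p * M p q) * f q)"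
    by (rule sum.swap)
  then show ?thesis
    by (simp add: lin_def bnd_def phi_sum phi_mult sum_distrib_left sum_distrib_right mult.assoc)
qed

lemma lin_comm: "lin v (\<lambda>p. lin w (\<lambda>q. F p q)) = lin w (\<lambda>q. lin v (\<lambda>p. F p q))"
  unfolding lin_def sum_distrib_left
  by (subst sum.swap) (intro sum.cong refl phi_left_commute)

lemma mult_lin: "a * lin v f = lin v (\<lambda>p. a * f p)"
  by (simp add: lin_def sum_distrib_left phi_left_commute)

lemma lin_mult: "lin v f * a = lin v (\<lambda>p. f p * a)"
  by (simp add: lin_def sum_distrib_right mult.assoc)

lemma lin_cong: "(\<And>p. f p = g p) \<Longrightarrow> lin v f = lin v g"
  by (simp add: lin_def)

lemma lin_sum: "lin v (\<lambda>p. \<Sum>x\<in>S. f x p) = (\<Sum>x\<in>S. lin v (f x))"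
  unfolding lin_def sum_distrib_left by (rule sum.swap)

text \<open>The vector identity with a unit vector as continuation is already universal; applying
  \<open>lin\<close> to it gives the A-valued form. The next lemmas follow the same pattern.\<close>

lemma lin_coassoc:
  assumes "ccoalg d e"
  shows "lin (d x) (\<lambda>z. lin (d (snd z)) (\<lambda>y. F (fst z) (fst y) (snd y)))
       = lin (d x) (\<lambda>z. lin (d (fst z)) (\<lambda>y. F (fst y) (snd y) (snd z)))"
  using arg_cong [OF ccoalg_coassoc [OF assms, of x "\<lambda>a b c. bas (a, b, c)"], of "\<lambda>v. lin v
      (\<lambda>q. F (fst q) (fst (snd q)) (snd (snd q)))"]
  by (simp add: lin_bnd)

lemma lin_swap:
  assumes "ccoalg d e"
  shows "lin (d x) (\<lambda>z. F (fst z) (snd z)) = lin (d x) (\<lambda>z. F (snd z) (fst z))"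
  using arg_cong [OF ccoalg_swap [OF assms, of x "\<lambda>a b. bas (a, b)"], of "\<lambda>v. lin v (\<lambda>q. F (fst q) (snd q))"]
  by (simp add: lin_bnd)

lemma lin_counit_left:
  assumes "ccoalg d e"
  shows "lin (d x) (\<lambda>z. lin (e (fst z)) (\<lambda>_. F (snd z))) = F x"
  using arg_cong [OF ccoalg_counit_left [OF assms, of x bas], of "\<lambda>v. lin v F"]
  by (simp add: lin_bnd)

lemma lin_counit_right:
  assumes "ccoalg d e"
  shows "lin (d x) (\<lambda>z. lin (e (snd z)) (\<lambda>_. F (fst z))) = F x"
  using arg_cong [OF ccoalg_counit_right [OF assms, of x bas], of "\<lambda>v. lin v F"]
  by (simp add: lin_bnd)

lemma lin_cmap_cm:
  assumes "cmap d e d' e' u"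
  shows "lin (u x) (\<lambda>i. lin (d' i) (\<lambda>y. F (fst y) (snd y)))
    = lin (d x) (\<lambda>z. lin (u (fst z)) (\<lambda>i. lin (u (snd z)) (\<lambda>j. F i j)))"
  using arg_cong [OF cmap_cm_cont [OF assms, of x "\<lambda>i j. bas (i, j)"], of "\<lambda>v. lin v (\<lambda>q. F (fst q) (snd q))"]
  by (simp add: lin_bnd)

lemma lin_cmap_cu:
  assumes "cmap d e d' e' u"
  shows "lin (u x) (\<lambda>i. lin (e' i) F) = lin (e x) F"
  using arg_cong [OF cmap_cu [OF assms, of x], of "\<lambda>v. lin v F"]
  by (simp add: lin_bnd)

definition conv :: "('c::finite \<Rightarrow> 'c \<times> 'c \<Rightarrow> 'k) \<Rightarrow> ('c \<Rightarrow> 'a) \<Rightarrow> ('c \<Rightarrow> 'a) \<Rightarrow> 'c \<Rightarrow> 'a" where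
  "conv d f g x = lin (d x) (\<lambda>z. f (fst z) * g (snd z))"

definition cst :: "('c \<Rightarrow> unit \<Rightarrow> 'k) \<Rightarrow> 'a \<Rightarrow> 'c \<Rightarrow> 'a" where
  "cst e a x = lin (e x) (\<lambda>_. a)"

definition pull :: "('c \<Rightarrow> 'i::finite \<Rightarrow> 'k) \<Rightarrow> ('i \<Rightarrow> 'a) \<Rightarrow> 'c \<Rightarrow> 'a" where
  "pull u f x = lin (u x) f"

lemma conv_assoc:
  assumes "ccoalg d e"
  shows "conv d (conv d f g) h = conv d f (conv d g h)"
  using lin_coassoc [OF assms, where F="\<lambda>a b c. f a * g b * h c"]
  by (simp add: conv_def fun_eq_iff lin_mult mult_lin mult.assoc)

lemma conv_cst_left:
  assumes "ccoalg d e"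
  shows "conv d (cst e a) f = (\<lambda>x. a * f x)"
  using lin_counit_left [OF assms, where F="\<lambda>x. a * f x"]
  by (simp add: conv_def cst_def fun_eq_iff lin_mult)

lemma conv_cst_right:
  assumes "ccoalg d e"
  shows "conv d f (cst e a) = (\<lambda>x. f x * a)"
  using lin_counit_right [OF assms, where F="\<lambda>x. f x * a"]
  by (simp add: conv_def cst_def fun_eq_iff mult_lin)

text \<open>Pulling back along a coalgebra map is a homomorphism of convolution algebras. It carries
  identities proved on tensor products over to arbitrary points.\<close>

lemma pull_conv:
  assumes "cmap d e d' e' u"
  shows "pull u (conv d' f g) = conv d (pull u f) (pull u g)"
proof
  fix x
  have "conv d (pull u f) (pull u g) x = lin (d x) (\<lambda>z. lin (u (fst z)) (\<lambda>i. lin (u (snd z))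
      (\<lambda>j. f i * g j)))"
    unfolding conv_def pull_def lin_mult by (simp add: mult_lin)
  then show "pull u (conv d' f g) x = conv d (pull u f) (pull u g) x"
    using lin_cmap_cm [OF assms, where F="\<lambda>i j. f i * g j" and x=x]
    by (simp add: conv_def [abs_def] pull_def)
qed

lemma pull_pull: "pull u (pull v f) = pull (\<lambda>x. bnd (u x) v) f"
  by (simp add: pull_def [abs_def] lin_bnd)

lemma pull_bas [simp]: "pull bas f = f"
  by (simp add: pull_def fun_eq_iff)

lemma pull_pair: "pull (pair d u v) F x = lin (d x) (\<lambda>z. lin (u (fst z)) (\<lambda>i. lin (v (snd z))
    (\<lambda>j. F (i, j))))"
  by (simp add: pull_def pair_def lin_bnd)

lemma conv_tens: "conv (tens_cm d d') f g p =
    lin (d (fst p)) (\<lambda>z. lin (d' (snd p)) (\<lambda>w. f (fst z, fst w) * g (snd z, snd w)))"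
  by (simp add: conv_def tens_cm_def lin_bnd)

text \<open>Linearity is given for binary sums and scalar multiples, so the coordinates of
  \<open>h\<close> are switched on one at a time.\<close>

lemma hlin_eq_lin:
  assumes "hlin \<phi> f"
  shows "f h = lin h (\<lambda>i. f (bas i))"
proof -
  have f0: "f (\<lambda>_. 0) = 0"
    using assms [unfolded hlin_def, rule_format, of "\<lambda>_. 0" "\<lambda>_. 0" 0] by (simp add: hsc_def)
  have "f (\<lambda>j. if j \<in> S then h j else 0) = (\<Sum>i\<in>S. \<phi> (h i) * f (bas i))" if "finite S" for S
    using that
  proof (induction S rule: finite_induct)
    case empty
    then show ?case using f0 by simp
  next
    case (insert s S)
    have "(\<lambda>j. if j \<in> insert s S then h j else 0) = hadd (hsc (h s) (bas s)) (\<lambda>j. if j \<in> S then h j else 0)"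
      using insert by (auto simp: hadd_def hsc_def bas_def fun_eq_iff)
    then show ?case using insert assms by (simp add: hlin_def)
  qed
  from this [of UNIV] show ?thesis by (simp add: lin_def)
qed

lemma alin_lin:
  assumes "alin \<phi> g"
  shows "g (lin v f) = lin v (\<lambda>p. g (f p))"
proof -
  have g0: "g 0 = 0"
    using assms [unfolded alin_def, rule_format, of 0 0 0] by simp
  have "g (\<Sum>p\<in>S. \<phi> (v p) * f p) = (\<Sum>p\<in>S. \<phi> (v p) * g (f p))" for S
    by (induction S rule: infinite_finite_induct) (use g0 assms in \<open>simp_all add: alin_def\<close>)
  then show ?thesis by (simp add: lin_def)
qed

end

section \<open>The twisted partial action on basis vectors\<close>

locale tpa_setting = kalgebra \<phi> + cocomm_hopf H
  for \<phi> :: "'k::field \<Rightarrow> 'a::ring_1" and H :: "('i::finite, 'k) hopf_data" +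
  fixes act :: "('i \<Rightarrow> 'k) \<Rightarrow> 'a \<Rightarrow> 'a" and om om' :: "('i \<Rightarrow> 'k) \<Rightarrow> ('i \<Rightarrow> 'k) \<Rightarrow> 'a"
  assumes sym_tpa: "sym_tpa H \<phi> act om om'"
begin

lemma tpa: "tpa H \<phi> act om"
  using sym_tpa by (simp add: sym_tpa_def)

definition actb :: "'i \<Rightarrow> 'a \<Rightarrow> 'a" where "actb i a = act (bas i) a"
definition omb :: "'i \<times> 'i \<Rightarrow> 'a" where "omb z = om (bas (fst z)) (bas (snd z))"
definition omb' :: "'i \<times> 'i \<Rightarrow> 'a" where "omb' z = om' (bas (fst z)) (bas (snd z))"

lemma sw2_bas: "sw2 H \<phi> (bas i) F = lin (\<Delta> i) (\<lambda>z. F (bas (fst z)) (bas (snd z)))"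
  by (simp add: sw2_def lin_def hcm_def)

lemma act_eq: "act h a = lin h (\<lambda>i. actb i a)"
  unfolding actb_def using tpa by (intro hlin_eq_lin [of "\<lambda>h. act h a"]) (simp add: tpa_def)

lemma om_eq: "om x y = lin x (\<lambda>i. lin y (\<lambda>j. omb (i, j)))"
proof -
  have b: "hbilin \<phi> om" using tpa by (simp add: tpa_def)
  have "om x y = lin x (\<lambda>i. om (bas i) y)"
    using b by (intro hlin_eq_lin [of "\<lambda>h. om h y"]) (simp add: hbilin_def)
  moreover have "om (bas i) y = lin y (\<lambda>j. omb (i, j))" for i
    unfolding omb_def fst_conv snd_conv using b by (intro hlin_eq_lin) (simp add: hbilin_def)
  ultimately show ?thesis by simp
qed

lemma actb_lin: "actb i (lin v f) = lin v (\<lambda>p. actb i (f p))"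
  unfolding actb_def using tpa by (intro alin_lin) (simp add: tpa_def)

lemma hmul_bas: "hmul H (bas i) (bas j) = \<mu> (i, j)"
  by (simp add: hmk_def)

lemma act_hone: "lin (hone H) (\<lambda>i. actb i a) = a"
  using tpa by (simp add: tpa_def act_eq)

lemma actb_mult: "actb i (a * b) = lin (\<Delta> i) (\<lambda>z. actb (fst z) a * actb (snd z) b)"
  using tpa by (simp add: tpa_def sw2_bas actb_def)

lemma twisted_assoc: "lin (\<Delta> i) (\<lambda>z. lin (\<Delta> j) (\<lambda>y. actb (fst z) (actb (fst y) a) * omb (snd z, snd y)))
  = lin (\<Delta> i) (\<lambda>z. lin (\<Delta> j) (\<lambda>y. omb (fst z, fst y) * lin (\<mu> (snd z, snd y)) (\<lambda>k. actb k a)))"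
proof -
  have "sw2 H \<phi> (bas i) (\<lambda>h1 h2. sw2 H \<phi> (bas j) (\<lambda>l1 l2. act h1 (act l1 a) * om h2 l2))
            = sw2 H \<phi> (bas i) (\<lambda>h1 h2. sw2 H \<phi> (bas j) (\<lambda>l1 l2. om h1 l1 * act (hmul H h2 l2) a))"
    using tpa unfolding tpa_def by blast
  then show ?thesis
    by (simp add: sw2_bas hmul_bas act_eq [of "\<mu> _"]) (simp add: actb_def omb_def)
qed

definition idb :: "'i \<Rightarrow> 'a" where "idb i = actb i 1"

text \<open>Centrality of e is tested on the map h to \<epsilon>(h) a, whose convolution with e on
  either side is multiplication by a. Hence every value of e is central in A.\<close>

lemma idb_central: "idb i * a = a * idb i"
proof -
  have "hlin \<phi> (\<lambda>h. \<phi> (eps H h) * a)"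
    by (simp add: hlin_def eps_def hadd_def hsc_def phi_add phi_mult distrib_right sum.distrib mult.assoc flip: sum_distrib_left)
  then have "conv1 H \<phi> (\<lambda>h. act h 1) (\<lambda>h. \<phi> (eps H h) * a) = conv1 H \<phi> (\<lambda>h. \<phi> (eps H h) * a) (\<lambda>h. act h 1)"
    using sym_tpa by (simp add: sym_tpa_def)
  from fun_cong [OF this, of "bas i"]
  have *: "lin (\<Delta> i) (\<lambda>z. idb (fst z) * (\<phi> (eps H (bas (snd z))) * a)) = lin (\<Delta> i)
      (\<lambda>z. \<phi> (eps H (bas (fst z))) * a * idb (snd z))"
    by (simp add: conv1_def sw2_bas idb_def actb_def)
  have e: "\<phi> (eps H (bas j)) * b = lin (\<epsilon> j) (\<lambda>_. b)" for j b
    by (simp add: lin_def UNIV_unit hcu_def)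
  show ?thesis
    using * unfolding mult.assoc e mult_lin
    by (simp add: lin_mult lin_counit_left [OF ccoalg_hopf, where F="\<lambda>x. a * idb x"] lin_counit_right [OF ccoalg_hopf, where F="\<lambda>x. idb x * a"])
qed

lemma omb_hone: "lin (hone H) (\<lambda>i. omb (i, j)) = idb j" "lin (hone H) (\<lambda>i. omb (j, i)) = idb j"
proof -
  have "om (hone H) (bas j) = act (bas j) 1" "om (bas j) (hone H) = act (bas j) 1"
    using sym_tpa unfolding sym_tpa_def by blast+
  then show "lin (hone H) (\<lambda>i. omb (i, j)) = idb j" "lin (hone H) (\<lambda>i. omb (j, i)) = idb j"
    by (simp_all add: om_eq idb_def actb_def)
qed

lemma cocycle:
  "lin (\<Delta> i) (\<lambda>z. lin (\<Delta> j) (\<lambda>y. lin (\<Delta> k) (\<lambda>w.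
      actb (fst z) (omb (fst y, fst w)) * lin (\<mu> (snd y, snd w)) (\<lambda>l. omb (snd z, l)))))
   = lin (\<Delta> i) (\<lambda>z. lin (\<Delta> j) (\<lambda>y. omb (fst z, fst y) * lin (\<mu> (snd z, snd y)) (\<lambda>l. omb (l, k))))"
proof -
  have "sw2 H \<phi> (bas i) (\<lambda>h1 h2. sw2 H \<phi> (bas j) (\<lambda>l1 l2. sw2 H \<phi> (bas k) (\<lambda>m1 m2.
                 act h1 (om l1 m1) * om h2 (hmul H l2 m2))))
            = sw2 H \<phi> (bas i) (\<lambda>h1 h2. sw2 H \<phi> (bas j) (\<lambda>l1 l2. om h1 l1 * om (hmul H h2 l2) (bas k)))"
    using sym_tpa unfolding sym_tpa_def by blast
  then show ?thesis
    by (simp add: sw2_bas hmul_bas om_eq act_eq)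
qed

text \<open>The two factors on the right are f_1, which depends on its second argument through the
  counit, and f_2, which is e evaluated at the product.\<close>

lemma omb_inverse:
  "conv tcm omb omb' = conv tcm (\<lambda>z. lin (\<epsilon> (snd z)) (\<lambda>_. idb (fst z))) (pull \<mu> idb)"
  "conv tcm omb' omb = conv tcm (\<lambda>z. lin (\<epsilon> (snd z)) (\<lambda>_. idb (fst z))) (pull \<mu> idb)"
proof -
  have c: "conv tcm (\<lambda>z. f (bas (fst z)) (bas (snd z))) (\<lambda>z. g (bas (fst z)) (bas (snd z))) p
      = conv2 H \<phi> f g (bas (fst p)) (bas (snd p))" for f g p
    by (simp add: conv_tens conv2_def sw2_bas)
  have e: "act (bas i) 1 * \<phi> (eps H (bas j)) = lin (\<epsilon> j) (\<lambda>_. idb i)" for i j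
    by (simp add: lin_def UNIV_unit hcu_def phi_central idb_def actb_def)
  have m: "act (hmul H (bas (fst z)) (bas (snd z))) 1 = pull \<mu> idb z" for z
    by (simp add: hmul_bas act_eq pull_def idb_def [abs_def])
  have "conv2 H \<phi> om om' = conv2 H \<phi> (\<lambda>h l. act h 1 * \<phi> (eps H l)) (\<lambda>h l. act (hmul H h l) 1)"
     "conv2 H \<phi> om' om = conv2 H \<phi> (\<lambda>h l. act h 1 * \<phi> (eps H l)) (\<lambda>h l. act (hmul H h l) 1)"
    using sym_tpa unfolding sym_tpa_def by blast+
  then show "conv tcm omb omb' = conv tcm (\<lambda>z. lin (\<epsilon> (snd z)) (\<lambda>_. idb (fst z))) (pull \<mu> idb)"
  "conv tcm omb' omb = conv tcm (\<lambda>z. lin (\<epsilon> (snd z)) (\<lambda>_. idb (fst z))) (pull \<mu> idb)"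
    using c [of om om'] c [of om' om] c [of "\<lambda>h l. act h 1 * \<phi> (eps H l)" "\<lambda>h l. act (hmul H h l) 1"]
    unfolding m e by (simp_all add: fun_eq_iff omb_def [abs_def] omb'_def [abs_def])
qed

lemma actb_idb: "actb i (idb k) = lin (\<Delta> i) (\<lambda>z. idb (fst z) * pull \<mu> idb (snd z, k))"
proof -
  have "act (bas i) (act (bas k) 1) = sw2 H \<phi> (bas i) (\<lambda>h1 h2. act h1 1 * act (hmul H h2 (bas k)) 1)"
    using sym_tpa unfolding sym_tpa_def by blast
  then show ?thesis
    by (simp add: sw2_bas hmul_bas act_eq pull_def idb_def [abs_def])
qed

end

section \<open>The partial action in the convolution algebra Hom(C, A)\<close>

locale tpa_points = tpa_setting \<phi> H act om om'
  for \<phi> :: "'k::field \<Rightarrow> 'a::ring_1" and H :: "('i::finite, 'k) hopf_data"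
  and act om om' +
  fixes d :: "'c::finite \<Rightarrow> 'c \<times> 'c \<Rightarrow> 'k" and e :: "'c \<Rightarrow> unit \<Rightarrow> 'k"
  assumes ccoalg: "ccoalg d e"
begin

abbreviation conv_inf (infixl "\<star>" 70) where "f \<star> g \<equiv> conv d f g"
abbreviation pmul (infixl "\<odot>" 85) where "u \<odot> v \<equiv> mulp d u v"
abbreviation "point \<equiv> cmap d e \<Delta> \<epsilon>"

definition pact :: "('c \<Rightarrow> 'i \<Rightarrow> 'k) \<Rightarrow> ('c \<Rightarrow> 'a) \<Rightarrow> 'c \<Rightarrow> 'a" (infixr "\<rhd>" 80) where
  "u \<rhd> f = (\<lambda>x. lin (d x) (\<lambda>z. lin (u (fst z)) (\<lambda>i. actb i (f (snd z)))))"

definition "\<omega> u v = pull (pair d u v) omb"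
definition "\<omega>' u v = pull (pair d u v) omb'"
definition idp :: "('c \<Rightarrow> 'i \<Rightarrow> 'k) \<Rightarrow> 'c \<Rightarrow> 'a" where "idp u = pull u idb"

lemmas star_assoc = conv_assoc [OF ccoalg]

lemma pull_pair_actb: "pull (pair d u v) (\<lambda>z. actb (fst z) (f (snd z))) = u \<rhd> pull v f"
  by (simp add: fun_eq_iff pull_pair pact_def actb_lin) (simp add: pull_def actb_lin)

text \<open>When u is a point, x to u(x_1) (x) x_2 is a coalgebra map. Seeing the action as a
  pullback along it reduces its properties to identities on H (x) C.\<close>

lemma pact_eq_pull: "u \<rhd> f = pull (pair d u bas) (\<lambda>z. actb (fst z) (f (snd z)))"
  by (simp add: pull_pair_actb)

text \<open>A counit in the third argument pads a function of two arguments. This lets \<omega>(u,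
  v) be convolved with functions of three arguments on a triple tensor product.\<close>

lemma pull_pair_eps_third:
  assumes "cmap d e d' e' w"
  shows "pull (pair d u (pair d v w)) (\<lambda>q. lin (e' (snd (snd q))) (\<lambda>_. F (fst q, fst (snd q))))
      = pull (pair d u v) F"
proof
  fix x
  have "lin (pair d v w y) (\<lambda>q. lin (e' (snd q)) (\<lambda>_. F (i, fst q))) = lin (v y) (\<lambda>j. F (i, j))" for y i
  proof -
    have "lin (pair d v w y) (\<lambda>q. lin (e' (snd q)) (\<lambda>_. F (i, fst q)))
       = lin (d y) (\<lambda>z. lin (v (fst z)) (\<lambda>j. lin (e (snd z)) (\<lambda>_. F (i, j))))"
      by (simp add: pair_def lin_bnd lin_cmap_cu [OF assms])
    also have "\<dots> = lin (d y) (\<lambda>z. lin (e (snd z)) (\<lambda>_. lin (v (fst z)) (\<lambda>j. F (i, j))))"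
      by (subst lin_comm [of "v _"]) simp
    finally show ?thesis by (simp add: lin_counit_right [OF ccoalg, where F="\<lambda>y. lin (v y) _"])
  qed
  then show "pull (pair d u (pair d v w)) (\<lambda>q. lin (e' (snd (snd q))) (\<lambda>_. F (fst q, fst (snd q)))) x
      = pull (pair d u v) F x"
    by (simp add: pull_pair)
qed

lemma pull_pair_mult_third:
  "pull (pair d u (pair d v w)) (\<lambda>q. lin (\<mu> (fst q, fst (snd q))) (\<lambda>l. G (l, snd (snd q))))
      = pull (pair d (u \<odot> v) w) G"
proof
  fix x
  have "pull (pair d (u \<odot> v) w) G x = lin (d x) (\<lambda>z. lin (d (fst z)) (\<lambda>y. lin (u (fst y))
      (\<lambda>i. lin (v (snd y)) (\<lambda>j.
     lin (\<mu> (i, j)) (\<lambda>l. lin (w (snd z)) (\<lambda>k. G (l, k)))))))"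
    by (simp add: pull_pair mulp_eq lin_bnd)
  also have "\<dots> = lin (d x) (\<lambda>z. lin (d (snd z)) (\<lambda>y. lin (u (fst z)) (\<lambda>i. lin (v (fst y)) (\<lambda>j.
     lin (\<mu> (i, j)) (\<lambda>l. lin (w (snd y)) (\<lambda>k. G (l, k)))))))"
    by (rule lin_coassoc [OF ccoalg, symmetric, where F="\<lambda>a b c. lin (u a) (\<lambda>i. lin (v b) (\<lambda>j.
     lin (\<mu> (i, j)) (\<lambda>l. lin (w c) (\<lambda>k. G (l, k)))))"])
  also have "\<dots> = lin (d x) (\<lambda>z. lin (u (fst z)) (\<lambda>i. lin (d (snd z)) (\<lambda>y. lin (v (fst y)) (\<lambda>j.
     lin (w (snd y)) (\<lambda>k. lin (\<mu> (i, j)) (\<lambda>l. G (l, k)))))))"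
    by (subst lin_comm [of "d _" "u _"], subst lin_comm [of "\<mu> _" "w _"]) simp
  also have "\<dots> = pull (pair d u (pair d v w)) (\<lambda>q. lin (\<mu> (fst q, fst (snd q))) (\<lambda>l. G (l, snd (snd q)))) x"
    by (simp add: pull_pair) (simp add: pair_def lin_bnd)
  finally show "pull (pair d u (pair d v w)) (\<lambda>q. lin (\<mu> (fst q, fst (snd q)))
      (\<lambda>l. G (l, snd (snd q)))) x = pull (pair d (u \<odot> v) w) G x"
    by simp
qed

lemma pull_pair_mult: "pull (pair d u v) (pull \<mu> f) = pull (u \<odot> v) f"
  by (simp add: pull_pull mulp_def [abs_def])

lemma pull_pair_eps:
  assumes "cmap d e d' e' v"
  shows "pull (pair d u v) (\<lambda>z. lin (e' (snd z)) (\<lambda>_. F (fst z))) = pull u F"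
proof
  fix x
  have "pull (pair d u v) (\<lambda>z. lin (e' (snd z)) (\<lambda>_. F (fst z))) x = lin (d x) (\<lambda>z. lin (u (fst z))
      (\<lambda>i. lin (e (snd z)) (\<lambda>_. F i)))"
    by (simp add: pull_pair lin_cmap_cu [OF assms])
  also have "\<dots> = lin (d x) (\<lambda>z. lin (e (snd z)) (\<lambda>_. lin (u (fst z)) F))"
    by (subst lin_comm [of "u _"]) simp
  finally show "pull (pair d u v) (\<lambda>z. lin (e' (snd z)) (\<lambda>_. F (fst z))) x = pull u F x"
    by (simp add: lin_counit_right [OF ccoalg, where F="\<lambda>y. lin (u y) _"] pull_def)
qed

lemma pact_star:
  assumes u: "point u"
  shows "u \<rhd> (f \<star> g) = (u \<rhd> f) \<star> (u \<rhd> g)"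
proof -
  let ?a = "\<lambda>f z. actb (fst z) (f (snd z))"
  have "?a (f \<star> g) = conv (tens_cm \<Delta> d) (?a f) (?a g)"
  proof
    fix p :: "'i \<times> 'c"
    have "?a (f \<star> g) p = lin (d (snd p)) (\<lambda>w. lin (\<Delta> (fst p))
        (\<lambda>z. actb (fst z) (f (fst w)) * actb (snd z) (g (snd w))))"
      by (simp add: conv_def actb_lin actb_mult)
    then show "?a (f \<star> g) p = conv (tens_cm \<Delta> d) (?a f) (?a g) p"
      by (simp add: conv_tens) (rule lin_comm)
  qed
  then show ?thesis
    unfolding pact_eq_pull by (simp add: pull_conv [OF cmap_pair [OF ccoalg u cmap_bas]])
qed

text \<open>Every factor is the pullback, along x to u(x_1) (x) v(x_2) (x) x_3, of a function on H
  (x) H (x) C. There the identity is (T3) with the argument from C inserted in f, and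
  \<open>pull_conv\<close> transports it.\<close>

lemma pact_pact_omega:
  assumes u: "point u" and v: "point v"
  shows "(u \<rhd> v \<rhd> f) \<star> \<omega> u v = \<omega> u v \<star> (u \<odot> v \<rhd> f)"
proof -
  let ?D = "tens_cm \<Delta> (tens_cm \<Delta> d)"
  let ?T = "pair d u (pair d v bas)"
  let ?X = "\<lambda>q. actb (fst q) (actb (fst (snd q)) (f (snd (snd q))))"
  let ?O = "\<lambda>q. lin (e (snd (snd q))) (\<lambda>_. omb (fst q, fst (snd q)))"
  let ?Y = "\<lambda>q. lin (\<mu> (fst q, fst (snd q))) (\<lambda>l. actb l (f (snd (snd q))))"
  have T: "cmap d e ?D (tens_cu \<epsilon> (tens_cu \<epsilon> e)) ?T"
    by (intro cmap_pair ccoalg u v cmap_bas)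
  have X: "pull ?T ?X = u \<rhd> v \<rhd> f"
    using pull_pair_actb [of u "pair d v bas" "\<lambda>z. actb (fst z) (f (snd z))"] by (simp add: pact_eq_pull)
  have O: "pull ?T ?O = \<omega> u v"
    unfolding \<omega>_def by (rule pull_pair_eps_third [OF cmap_bas])
  have Y: "pull ?T ?Y = u \<odot> v \<rhd> f"
    using pull_pair_mult_third [of u v bas "\<lambda>z. actb (fst z) (f (snd z))"] by (simp add: pact_eq_pull)
  have "conv ?D ?X ?O = conv ?D ?O ?Y"
  proof
    fix q :: "'i \<times> 'i \<times> 'c"
    let ?i = "fst q" and ?j = "fst (snd q)" and ?c = "snd (snd q)"
    have "conv ?D ?X ?O q = lin (\<Delta> ?i) (\<lambda>z. lin (\<Delta> ?j) (\<lambda>y. lin (d ?c) (\<lambda>w. lin (e (snd w)) (\<lambda>_.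
       actb (fst z) (actb (fst y) (f (fst w))) * omb (snd z, snd y)))))"
      by (simp add: conv_def tens_cm_def lin_bnd mult_lin)
    also have "\<dots> = lin (\<Delta> ?i) (\<lambda>z. lin (\<Delta> ?j) (\<lambda>y. actb (fst z) (actb (fst y) (f ?c)) * omb (snd z, snd y)))"
      by (simp add: lin_counit_right [OF ccoalg, where F="\<lambda>w. actb _ (actb _ (f w)) * _"])
    also have "\<dots> = lin (\<Delta> ?i) (\<lambda>z. lin (\<Delta> ?j) (\<lambda>y. omb (fst z, fst y) * lin (\<mu> (snd z, snd y))
        (\<lambda>k. actb k (f ?c))))"
      by (rule twisted_assoc)
    also have "\<dots> = lin (\<Delta> ?i) (\<lambda>z. lin (\<Delta> ?j) (\<lambda>y. lin (d ?c) (\<lambda>w. lin (e (fst w)) (\<lambda>_.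
       omb (fst z, fst y) * lin (\<mu> (snd z, snd y)) (\<lambda>k. actb k (f (snd w)))))))"
      by (simp add: lin_counit_left [OF ccoalg, where F="\<lambda>w. _ * lin _ (\<lambda>k. actb k (f w))"])
    also have "\<dots> = conv ?D ?O ?Y q"
      by (simp add: conv_def tens_cm_def lin_bnd lin_mult)
    finally show "conv ?D ?X ?O q = conv ?D ?O ?Y q" .
  qed
  then have "pull ?T (conv ?D ?X ?O) = pull ?T (conv ?D ?O ?Y)" by simp
  then show ?thesis
    by (simp add: pull_conv [OF T] X Y O)
qed

text \<open>Condition (C) is an identity in the convolution algebra of H (x) H (x) H, pulled back
  along x to u(x_1) (x) v(x_2) (x) w(x_3).\<close>

lemma omega_cocycle:
  assumes u: "point u" and v: "point v" and w: "point w"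
  shows "(u \<rhd> \<omega> v w) \<star> \<omega> u (v \<odot> w) = \<omega> u v \<star> \<omega> (u \<odot> v) w"
proof -
  let ?D = "tens_cm \<Delta> (tens_cm \<Delta> \<Delta>)"
  let ?T = "pair d u (pair d v w)"
  let ?X = "\<lambda>q. actb (fst q) (omb (snd q))"
  let ?O = "\<lambda>q. lin (\<epsilon> (snd (snd q))) (\<lambda>_. omb (fst q, fst (snd q)))"
  let ?Y = "\<lambda>q. lin (\<mu> (snd q)) (\<lambda>l. omb (fst q, l))"
  let ?Z = "\<lambda>q. lin (\<mu> (fst q, fst (snd q))) (\<lambda>l. omb (l, snd (snd q)))"
  have T: "cmap d e ?D (tens_cu \<epsilon> (tens_cu \<epsilon> \<epsilon>)) ?T"
    by (intro cmap_pair ccoalg u v w)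
  have X: "pull ?T ?X = u \<rhd> \<omega> v w"
    by (simp add: pull_pair_actb \<omega>_def)
  have O: "pull ?T ?O = \<omega> u v"
    unfolding \<omega>_def by (rule pull_pair_eps_third [OF w])
  have Y: "pull ?T ?Y = \<omega> u (v \<odot> w)"
    by (simp add: fun_eq_iff \<omega>_def pull_pair) (simp add: mulp_def lin_bnd)
  have Z: "pull ?T ?Z = \<omega> (u \<odot> v) w"
    unfolding \<omega>_def by (rule pull_pair_mult_third)
  have "conv ?D ?X ?Y = conv ?D ?O ?Z"
  proof
    fix q :: "'i \<times> 'i \<times> 'i"
    let ?i = "fst q" and ?j = "fst (snd q)" and ?c = "snd (snd q)"
    have "conv ?D ?X ?Y q = lin (\<Delta> ?i) (\<lambda>z. lin (\<Delta> ?j) (\<lambda>y. omb (fst z, fst y) * lin (\<mu> (snd z, snd y))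
        (\<lambda>l. omb (l, ?c))))"
      by (simp add: conv_def tens_cm_def lin_bnd cocycle)
    also have "\<dots> = lin (\<Delta> ?i) (\<lambda>z. lin (\<Delta> ?j) (\<lambda>y. lin (\<Delta> ?c) (\<lambda>w. lin (\<epsilon> (fst w)) (\<lambda>_.
       omb (fst z, fst y) * lin (\<mu> (snd z, snd y)) (\<lambda>l. omb (l, snd w))))))"
      by (simp add: lin_counit_left [OF ccoalg_hopf, where F="\<lambda>w. _ * lin _ (\<lambda>l. omb (l, w))"])
    also have "\<dots> = conv ?D ?O ?Z q"
      by (simp add: conv_def tens_cm_def lin_bnd lin_mult)
    finally show "conv ?D ?X ?Y q = conv ?D ?O ?Z q" .
  qed
  then have "pull ?T (conv ?D ?X ?Y) = pull ?T (conv ?D ?O ?Z)" by simp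
  then show ?thesis
    by (simp add: pull_conv [OF T] X Y O Z)
qed

lemma omega_inverse:
  assumes u: "point u" and v: "point v"
  shows "\<omega> u v \<star> \<omega>' u v = idp u \<star> idp (u \<odot> v)" "\<omega>' u v \<star> \<omega> u v = idp u \<star> idp (u \<odot> v)"
  using arg_cong [OF omb_inverse(1), of "pull (pair d u v)"] arg_cong [OF omb_inverse(2), of "pull (pair d u v)"]
  by (simp_all add: pull_conv [OF cmap_pair [OF ccoalg u v]] pull_pair_mult \<omega>_def \<omega>'_def idp_def pull_pair_eps [OF v])

lemma pact_cst:
  shows "u \<rhd> cst e a = pull u (\<lambda>i. actb i a)"
proof
  fix x
  have "(u \<rhd> cst e a) x = lin (d x) (\<lambda>z. lin (e (snd z)) (\<lambda>_. lin (u (fst z)) (\<lambda>i. actb i a)))"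
    unfolding pact_def cst_def actb_lin by (subst lin_comm [of "u _"]) simp
  then show "(u \<rhd> cst e a) x = pull u (\<lambda>i. actb i a) x"
    by (simp add: lin_counit_right [OF ccoalg, where F="\<lambda>y. lin (u y) _"] pull_def)
qed

lemma pact_one: "u \<rhd> cst e 1 = idp u"
  by (simp add: pact_cst idp_def idb_def [abs_def])

lemma pact_onep: "onep e \<rhd> f = f"
  by (simp add: pact_def onep_def lin_bnd act_hone fun_eq_iff lin_counit_left [OF ccoalg])

lemma omega_onep: "\<omega> (onep e) u = idp u" "\<omega> u (onep e) = idp u"
proof -
  have "\<omega> (onep e) u x = lin (d x) (\<lambda>z. lin (e (fst z)) (\<lambda>_. lin (u (snd z)) (\<lambda>j. lin (hone H)
      (\<lambda>i. omb (i, j)))))" for x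
    by (subst lin_comm [of "u _"]) (simp add: \<omega>_def pull_pair onep_def lin_bnd)
  then show "\<omega> (onep e) u = idp u"
    by (simp add: omb_hone fun_eq_iff lin_counit_left [OF ccoalg, where F="\<lambda>y. lin (u y) _"] idp_def pull_def)
  have "\<omega> u (onep e) x = lin (d x) (\<lambda>z. lin (e (snd z)) (\<lambda>_. lin (u (fst z)) (\<lambda>j. lin (hone H)
      (\<lambda>i. omb (j, i)))))" for x
    by (subst lin_comm [of "e _"]) (simp add: \<omega>_def pull_pair onep_def lin_bnd)
  then show "\<omega> u (onep e) = idp u"
    by (simp add: omb_hone fun_eq_iff lin_counit_right [OF ccoalg, where F="\<lambda>y. lin (u y) _"] idp_def pull_def)
qed

text \<open>The values of e are central in A, and cocommutativity of C exchanges the two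
  legs.\<close>

lemma idp_central: "idp u \<star> f = f \<star> idp u"
proof
  fix x
  have "idp u (fst z) * f (snd z) = f (snd z) * idp u (fst z)" for z
    by (simp add: idp_def pull_def lin_mult mult_lin idb_central)
  then have "(idp u \<star> f) x = lin (d x) (\<lambda>z. f (snd z) * idp u (fst z))" by (simp add: conv_def)
  also have "\<dots> = (f \<star> idp u) x"
    unfolding conv_def by (rule lin_swap [OF ccoalg, where F="\<lambda>a b. f b * idp u a"])
  finally show "(idp u \<star> f) x = (f \<star> idp u) x" .
qed

text \<open>This is the symmetry condition: on H (x) H it says that h acting on k.1 is the
  convolution of f_1 and f_2, and f_1, f_2 pull back to e(u), e(uv).\<close>

lemma pact_idp:
  assumes u: "point u" and v: "point v"
  shows "u \<rhd> idp v = idp u \<star> idp (u \<odot> v)"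
proof -
  have "(\<lambda>z. actb (fst z) (idb (snd z))) = conv tcm (\<lambda>z. lin (\<epsilon> (snd z)) (\<lambda>_. idb (fst z))) (pull \<mu> idb)"
  proof
    fix p
    have "conv tcm (\<lambda>z. lin (\<epsilon> (snd z)) (\<lambda>_. idb (fst z))) (pull \<mu> idb) p
      = lin (\<Delta> (fst p)) (\<lambda>z. lin (\<Delta> (snd p)) (\<lambda>w. lin (\<epsilon> (fst w))
          (\<lambda>_. idb (fst z) * pull \<mu> idb (snd z, snd w))))"
      by (simp add: conv_tens lin_mult)
    then show "actb (fst p) (idb (snd p)) = conv tcm (\<lambda>z. lin (\<epsilon> (snd z)) (\<lambda>_. idb (fst z))) (pull \<mu> idb) p"
      by (simp add: lin_counit_left [OF ccoalg_hopf, where F="\<lambda>w. _ * pull \<mu> idb (_, w)"] actb_idb)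
  qed
  from arg_cong [OF this, of "pull (pair d u v)"] show ?thesis
    by (simp add: pull_conv [OF cmap_pair [OF ccoalg u v]] pull_pair_mult pull_pair_actb idp_def pull_pair_eps [OF v])
qed

end

section \<open>Products in the partial crossed product\<close>

context tpa_points
begin

lemma star_one_left [simp]: "cst e 1 \<star> f = f" and star_one_right [simp]: "f \<star> cst e 1 = f"
  by (simp_all add: conv_cst_left [OF ccoalg] conv_cst_right [OF ccoalg])

lemma idp_onep: "idp (onep e) = cst e 1"
  using pact_one [of "onep e"] by (simp add: pact_onep)

text \<open>Multiplicativity of the action, applied to the product of f with the constant 1, which u
  sends to e(u).\<close>

lemma pact_idp_absorb:
  assumes "point u"
  shows "(u \<rhd> f) \<star> idp u = u \<rhd> f" "idp u \<star> (u \<rhd> f) = u \<rhd> f"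
proof -
  show "(u \<rhd> f) \<star> idp u = u \<rhd> f"
    using pact_star [OF assms, of f "cst e 1"] by (simp add: pact_one)
  then show "idp u \<star> (u \<rhd> f) = u \<rhd> f" by (simp add: idp_central)
qed

lemma idp_idem:
  assumes "point u"
  shows "idp u \<star> idp u = idp u"
  using pact_idp_absorb(1) [OF assms, of "cst e 1"] by (simp add: pact_one)

text \<open>The cocycle identity at the triple \<open>w, w\<^sup>-\<^sup>1, w\<close>. Both
  \<omega>(w, 1) and \<omega>(1, w) equal e(w), and the one on the left is absorbed.\<close>

lemma pact_omega_inv:
  assumes w: "point w"
  shows "w \<rhd> \<omega> (invp w) w = \<omega> w (invp w) \<star> idp w"
  using omega_cocycle [OF w cmap_invp [OF w] w]
  by (simp add: mulp_invp_left [OF w] mulp_invp_right [OF w] omega_onep pact_idp_absorb [OF w])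

text \<open>The identity produces a left inverse of \<open>\<omega>(w, w\<^sup>-\<^sup>1)\<close>
  relative to e(w). An inserted e(w) turns \<open>\<omega>(w, w\<^sup>-\<^sup>1)\<close> into the
  image of \<open>\<omega>(w\<^sup>-\<^sup>1, w)\<close> under w, so the action can be factored out
  of a product equal to \<open>e(w\<^sup>-\<^sup>1)\<close>.\<close>

lemma pact_omega'_inv:
  assumes w: "point w"
  shows "(w \<rhd> \<omega>' (invp w) w) \<star> \<omega> w (invp w) = idp w"
proof -
  note iw = cmap_invp [OF w]
  have "(w \<rhd> \<omega>' (invp w) w) \<star> \<omega> w (invp w) = ((w \<rhd> \<omega>' (invp w) w) \<star> idp w) \<star> \<omega> w (invp w)"
    by (simp add: pact_idp_absorb [OF w])
  also have "\<dots> = (w \<rhd> \<omega>' (invp w) w) \<star> (\<omega> w (invp w) \<star> idp w)"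
    by (simp add: star_assoc idp_central)
  also have "\<dots> = w \<rhd> (\<omega>' (invp w) w \<star> \<omega> (invp w) w)"
    by (simp add: pact_star [OF w] pact_omega_inv [OF w])
  also have "\<dots> = w \<rhd> idp (invp w)"
    by (simp add: omega_inverse [OF iw w] mulp_invp_left [OF w] idp_onep)
  also have "\<dots> = idp w"
    by (simp add: pact_idp [OF w iw] mulp_invp_right [OF w] idp_onep)
  finally show ?thesis .
qed

text \<open>Conjugation by the inverse of the point w: in the crossed product it is
  \<open>\<gamma>'(w) f \<gamma>(w)\<close>.\<close>

definition conj :: "('c \<Rightarrow> 'a) \<Rightarrow> ('c \<Rightarrow> 'i \<Rightarrow> 'k) \<Rightarrow> 'c \<Rightarrow> 'a" where
  "conj f w = \<omega>' (invp w) w \<star> (invp w \<rhd> f) \<star> \<omega> (invp w) w"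

text \<open>In the crossed product this says \<gamma>(w) \<gamma>'(w) f \<gamma>(w) = f \<gamma>(w).
  Twisted associativity for w and its inverse brings f out of the two actions, and
  \<open>pact_omega'_inv\<close> removes the remaining twists.\<close>

lemma pact_conj:
  assumes w: "point w"
  shows "w \<rhd> conj f w = f \<star> idp w"
proof -
  note iw = cmap_invp [OF w]
  have "w \<rhd> conj f w = (w \<rhd> \<omega>' (invp w) w) \<star> ((w \<rhd> invp w \<rhd> f) \<star> \<omega> w (invp w)) \<star> idp w"
    by (simp add: conj_def pact_star [OF w] pact_omega_inv [OF w] star_assoc)
  also have "\<dots> = (w \<rhd> \<omega>' (invp w) w) \<star> \<omega> w (invp w) \<star> f \<star> idp w"
    by (simp add: pact_pact_omega [OF w iw] mulp_invp_right [OF w] pact_onep star_assoc)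
  also have "\<dots> = idp w \<star> (f \<star> idp w)"
    by (simp add: pact_omega'_inv [OF w] star_assoc)
  also have "\<dots> = f \<star> idp w"
    by (simp add: idp_central [of w "f \<star> idp w"] star_assoc idp_idem [OF w])
  finally show ?thesis .
qed

text \<open>The coefficient of \<gamma>(uv) in a \<gamma>(u) \<gamma>(v) c is on the right. On the
  left stands that of \<gamma>(uv) c q, with q the conjugate of a \<omega>(u, v). Since c commutes
  with q, \<open>pact_conj\<close> clears the conjugate before uv acts on c, and (T3) splits that
  action into u and v.\<close>

lemma move_right:
  assumes u: "point u" and v: "point v" and c: "\<And>a. c * a = a * c"
  shows "u \<odot> v \<rhd> (cst e c \<star> conj (cst e a \<star> \<omega> u v) (u \<odot> v)) = cst e a \<star> (u \<rhd> v \<rhd> cst e c) \<star> \<omega> u v"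
proof -
  let ?w = "u \<odot> v"
  have w: "point ?w" by (rule cmap_mulp [OF ccoalg u v])
  let ?f = "cst e a \<star> \<omega> u v"
  have "cst e c \<star> conj ?f ?w = conj ?f ?w \<star> cst e c"
    by (simp add: conv_cst_left [OF ccoalg] conv_cst_right [OF ccoalg] c)
  then have "?w \<rhd> (cst e c \<star> conj ?f ?w) = ?f \<star> (idp ?w \<star> (?w \<rhd> cst e c))"
    by (simp add: pact_star [OF w] pact_conj [OF w] star_assoc)
  also have "\<dots> = cst e a \<star> (\<omega> u v \<star> (?w \<rhd> cst e c))"
    by (simp add: pact_idp_absorb [OF w] star_assoc)
  finally show ?thesis
    by (simp add: pact_pact_omega [OF u v, symmetric] star_assoc)
qed

lemma mulp_invp_cancel:
  assumes u: "point u" and v: "point v"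
  shows "invp (u \<odot> v) \<odot> u = invp v"
proof -
  have w: "point (u \<odot> v)" by (rule cmap_mulp [OF ccoalg u v])
  have "invp (u \<odot> v) \<odot> u = invp (u \<odot> v) \<odot> u \<odot> (v \<odot> invp v)"
    by (simp add: mulp_invp_right [OF v] mulp_onep_right [OF ccoalg])
  also have "\<dots> = (invp (u \<odot> v) \<odot> (u \<odot> v)) \<odot> invp v"
    by (simp add: mulp_assoc [OF ccoalg])
  finally show ?thesis
    by (simp add: mulp_invp_left [OF w] mulp_onep_left [OF ccoalg])
qed

text \<open>The same conjugate q satisfies q \<gamma>'(v) = \<gamma>'(uv) a \<gamma>(u). Both sides
  are multiples of \<open>\<gamma>(v\<^sup>-\<^sup>1)\<close>, because
  \<open>(uv)\<^sup>-\<^sup>1 u = v\<^sup>-\<^sup>1\<close>, and the lemma equates their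
  coefficients.\<close>

lemma move_left:
  assumes u: "point u" and v: "point v"
  shows "conj (cst e a \<star> \<omega> u v) (u \<odot> v) \<star> (\<omega>' (invp v) v \<star> idp (invp v))
    = \<omega>' (invp (u \<odot> v)) (u \<odot> v) \<star> idp (invp (u \<odot> v)) \<star> (invp (u \<odot> v) \<rhd> (cst e a \<star> idp u))
        \<star> \<omega> (invp (u \<odot> v)) u"
proof -
  let ?w = "u \<odot> v" and ?v' = "invp v"
  let ?w' = "invp ?w"
  have w: "point ?w" by (rule cmap_mulp [OF ccoalg u v])
  note iw = cmap_invp [OF w] and iv = cmap_invp [OF v]
  note cancel = mulp_invp_cancel [OF u v]
  have "conj (cst e a \<star> \<omega> u v) ?w \<star> (\<omega>' ?v' v \<star> idp ?v')
      = \<omega>' ?w' ?w \<star> (?w' \<rhd> cst e a) \<star> ((?w' \<rhd> \<omega> u v) \<star> \<omega> ?w' ?w) \<star> (\<omega>' ?v' v \<star> idp ?v')"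
    by (simp add: conj_def pact_star [OF iw] star_assoc)
  \<comment> \<open>The cocycle identity at \<open>(uv)\<^sup>-\<^sup>1, u, v\<close> brings
    \<omega> and \<omega>' of \<open>v\<^sup>-\<^sup>1, v\<close> side by side, where they cancel up
    to e.\<close>
  also have "\<dots> = \<omega>' ?w' ?w \<star> (?w' \<rhd> cst e a) \<star> \<omega> ?w' u \<star> (\<omega> ?v' v \<star> \<omega>' ?v' v) \<star> idp ?v'"
    by (simp add: omega_cocycle [OF iw u v] cancel star_assoc)
  also have "\<dots> = \<omega>' ?w' ?w \<star> (?w' \<rhd> cst e a) \<star> (\<omega> ?w' u \<star> idp (?w' \<odot> u))"
    by (simp add: omega_inverse [OF iv v] mulp_invp_left [OF v] idp_onep idp_idem [OF iv] cancel star_assoc)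
  also have "\<dots> = \<omega>' ?w' ?w \<star> (idp ?w' \<star> (?w' \<rhd> cst e a) \<star> idp ?w') \<star> (\<omega> ?w' u \<star> idp (?w' \<odot> u))"
    by (simp add: pact_idp_absorb [OF iw])
  \<comment> \<open>The two central idempotents are gathered because their product is the image of
    e(u) under \<open>(uv)\<^sup>-\<^sup>1\<close>.\<close>
  also have "\<dots> = \<omega>' ?w' ?w \<star> idp ?w' \<star> ((?w' \<rhd> cst e a) \<star> (idp ?w' \<star> idp (?w' \<odot> u))) \<star> \<omega> ?w' u"
    by (simp add: idp_central [of "?w' \<odot> u" "\<omega> ?w' u"] star_assoc)
  finally show ?thesis
    by (simp add: pact_star [OF iw] pact_idp [OF iw u])
qed

end

lemma bnd_pair_natural:
  assumes "cmap d' e' d e \<tau>"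
  shows "bnd (\<tau> x) (pair d u v) = pair d' (\<lambda>x. bnd (\<tau> x) u) (\<lambda>x. bnd (\<tau> x) v) x"
proof -
  have "bnd (\<tau> x) (pair d u v) = bnd (d' x) (\<lambda>z. bnd (\<tau> (fst z)) (\<lambda>k. bnd (\<tau> (snd z)) (\<lambda>l. bnd (u k)
      (\<lambda>i. bnd (v l) (\<lambda>j. bas (i, j))))))"
    unfolding pair_def by (rule cmap_cm_cont [OF assms, where F="\<lambda>k l. bnd (u k) (\<lambda>i. bnd (v l)
        (\<lambda>j. bas (i, j)))"])
  also have "\<dots> = bnd (d' x) (\<lambda>z. bnd (\<tau> (fst z)) (\<lambda>k. bnd (u k) (\<lambda>i. bnd (\<tau> (snd z)) (\<lambda>l. bnd (v l)
      (\<lambda>j. bas (i, j))))))"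
    by (subst bnd_comm [of "\<tau> _" "u _"]) simp
  finally show ?thesis by (simp add: pair_def bnd_assoc)
qed

section \<open>Coordinates and the product rule in A (x) H\<close>

context tpa_setting
begin

lemma tpa_points_intro: "ccoalg d e \<Longrightarrow> tpa_points \<phi> H act om om' d e"
  by (simp add: tpa_points_def tpa_points_axioms_def tpa_setting_axioms)

text \<open>\<open>P\<close> is the case C = H with generic point \<open>bas\<close>;
  \<open>T\<close> is the case C = H (x) H with generic pair \<open>fstp\<close>,
  \<open>sndp\<close>.\<close>

sublocale P: tpa_points \<phi> H act om om' \<Delta> \<epsilon>
  by (rule tpa_points_intro [OF ccoalg_hopf])

sublocale T: tpa_points \<phi> H act om om' tcm tcu
  by (rule tpa_points_intro [OF ccoalg_tensor])

text \<open>The m-th coordinate function on H. Convolving with its pullback reads off coordinate m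
  of an element of A (x) H, so that products there become convolution products.\<close>

definition xb :: "'i \<Rightarrow> 'i \<Rightarrow> 'a" where "xb m i = \<phi> (bas i m)"

lemma pull_xb: "pull u (xb m) x = \<phi> (u x m)"
proof -
  have "pull u (xb m) x = \<phi> (\<Sum>i\<in>UNIV. u x i * bas i m)"
    by (simp add: pull_def lin_def xb_def phi_sum phi_mult del: sum_bas_mult)
  then show ?thesis by simp
qed

text \<open>With \<open>P = f * e(s)\<close> this is the element \<open>f(h\<^sub>1) # s(h\<^sub>2)\<close>, where h is the i-th basis vector.\<close>

definition elt :: "('i \<Rightarrow> 'a) \<Rightarrow> ('i \<Rightarrow> 'i \<Rightarrow> 'k) \<Rightarrow> 'i \<Rightarrow> 'i \<Rightarrow> 'a" where
  "elt P s i m = conv \<Delta> P (pull s (xb m)) i"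

text \<open>Coordinate m of \<omega>(h_1, l_1) (x) h_2 l_2.\<close>

definition prodc :: "'i \<Rightarrow> 'i \<times> 'i \<Rightarrow> 'a" where
  "prodc m = conv tcm omb (pull \<mu> (xb m))"

text \<open>\<open>cop3\<close> is nested to the left. Nested to the right, the legs h_2, h_3 stand
  together, and \<omega> and the product of H merge into \<open>prodc\<close>.\<close>

lemma smul_eq:
  "smul H \<phi> act om x y m = (\<Sum>i\<in>UNIV. \<Sum>j\<in>UNIV. x i * lin (\<Delta> i) (\<lambda>z. actb (fst z) (y j) * prodc m (snd z, j)))"
proof -
  have sw3: "sw3 H \<phi> (bas i) F = lin (\<Delta> i) (\<lambda>z. lin (\<Delta> (snd z))
      (\<lambda>y. F (bas (fst z)) (bas (fst y)) (bas (snd y))))" for i F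
  proof -
    have "cop3 H (bas i) = bnd (\<Delta> i) (\<lambda>z. bnd (\<Delta> (fst z)) (\<lambda>y. bas (fst y, snd y, snd z)))"
    proof
      fix w :: "'i \<times> 'i \<times> 'i"
      obtain p q r where w: "w = (p, q, r)" by (cases w)
      have hc: "hcom H l i j = \<Delta> l (i, j)" for l i j
        unfolding hcm_def cop_def by simp
      have 2: "bnd (\<Delta> (fst z)) (\<lambda>y. bas (fst y, snd y, snd z)) (p, q, r)
          = \<Delta> (fst z) (p, q) * bas (snd z) r" for z
        by (rule bnd_bas_triple)
      have "cop3 H (bas i) w = (\<Sum>u\<in>UNIV. \<Delta> i (u, r) * \<Delta> u (p, q))"
        by (simp add: cop3_def w hc mult.assoc flip: sum_distrib_left)
      also have "\<dots> = (\<Sum>a\<in>UNIV. \<Sum>b\<in>UNIV. bas r b * (\<Delta> i (a, b) * \<Delta> a (p, q)))"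
        by simp
      also have "\<dots> = bnd (\<Delta> i) (\<lambda>z. bnd (\<Delta> (fst z)) (\<lambda>y. bas (fst y, snd y, snd z))) w"
        unfolding w bnd_pair [of "\<Delta> i"] 2 by (simp add: mult_ac bas_sym [of _ r])
      finally show "cop3 H (bas i) w = bnd (\<Delta> i) (\<lambda>z. bnd (\<Delta> (fst z)) (\<lambda>y. bas (fst y, snd y, snd z))) w" .
    qed
    then have "sw3 H \<phi> (bas i) F = lin (bnd (\<Delta> i) (\<lambda>z. bnd (\<Delta> (fst z)) (\<lambda>y. bas (fst y, snd y, snd z))))
        (\<lambda>p. F (bas (fst p)) (bas (fst (snd p))) (bas (snd (snd p))))"
      by (simp add: sw3_def lin_def)
    also have "\<dots> = lin (\<Delta> i) (\<lambda>z. lin (\<Delta> (fst z)) (\<lambda>y. F (bas (fst y)) (bas (snd y)) (bas (snd z))))"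
      by (simp add: lin_bnd)
    finally show ?thesis
      using lin_coassoc [OF ccoalg_hopf, of i "\<lambda>a b c. F (bas a) (bas b) (bas c)"] by simp
  qed
  have "x i * lin (\<Delta> i) (\<lambda>z. actb (fst z) (y j) * prodc m (snd z, j)) =
    sw3 H \<phi> (bas i) (\<lambda>h1 h2 h3. sw2 H \<phi> (bas j)
        (\<lambda>l1 l2. x i * act h1 (y j) * om h2 l1 * \<phi> (hmul H h3 l2 m)))" for i j
    by (simp add: sw3 sw2_bas prodc_def conv_tens pull_xb hmul_bas mult_lin mult.assoc) (simp add: actb_def omb_def)
  then show ?thesis by (simp add: smul_def)
qed

lemma elt_eq: "elt P s i m = lin (\<Delta> i) (\<lambda>z. P (fst z) * \<phi> (s (snd z) m))"
  by (simp add: elt_def conv_def pull_xb)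

lemma sum_elt: "(\<Sum>k\<in>UNIV. elt P s i k * G k) = lin (\<Delta> i) (\<lambda>z. P (fst z) * lin (s (snd z)) G)"
  by (simp add: elt_eq lin_mult mult.assoc lin_sum [symmetric] sum_distrib_left [symmetric]) (simp add: lin_def)

lemma sum_actb_elt: "(\<Sum>k\<in>UNIV. actb l (elt P s i k) * G k) = lin (\<Delta> i)
    (\<lambda>z. actb l (P (fst z)) * lin (s (snd z)) G)"
proof -
  have "actb l (a * \<phi> x) = actb l a * \<phi> x" for a x
    using tpa unfolding tpa_def alin_def actb_def by (metis phi_central)
  then show ?thesis
    by (simp add: elt_eq actb_lin lin_mult mult.assoc lin_sum [symmetric] sum_distrib_left [symmetric]) (simp add: lin_def)
qed

lemma pair_proj: "pair tcm (\<lambda>x. bnd (fstp x) s) (\<lambda>x. bnd (sndp x) s') p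
    = bnd (s (fst p)) (\<lambda>k. bnd (s' (snd p)) (\<lambda>l. bas (k, l)))"
proof -
  have "pair tcm (\<lambda>x. bnd (fstp x) s) (\<lambda>x. bnd (sndp x) s') p
    = bnd (\<Delta> (fst p)) (\<lambda>z. bnd (\<Delta> (snd p)) (\<lambda>w. bnd (\<epsilon> (fst w)) (\<lambda>_. bnd (s (fst z)) (\<lambda>k.
        bnd (\<epsilon> (snd z)) (\<lambda>_. bnd (s' (snd w)) (\<lambda>l. bas (k, l)))))))"
    by (simp add: pair_def tens_cm_def fstp_def sndp_def bnd_assoc)
  also have "\<dots> = bnd (\<Delta> (fst p)) (\<lambda>z. bnd (s (fst z)) (\<lambda>k.
        bnd (\<epsilon> (snd z)) (\<lambda>_. bnd (s' (snd p)) (\<lambda>l. bas (k, l)))))"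
    by (simp add: ccoalg_counit_left [OF ccoalg_hopf, where F="\<lambda>w. bnd _ (\<lambda>k. bnd _ (\<lambda>_. bnd (s' w)
        (\<lambda>l. bas (k, l))))"])
  also have "\<dots> = bnd (\<Delta> (fst p)) (\<lambda>z. bnd (\<epsilon> (snd z)) (\<lambda>_. bnd (s (fst z)) (\<lambda>k.
         bnd (s' (snd p)) (\<lambda>l. bas (k, l)))))"
    by (subst bnd_comm [of "s _" "\<epsilon> _"]) simp
  finally show ?thesis
    by (simp add: ccoalg_counit_right [OF ccoalg_hopf, where F="\<lambda>w. bnd (s w) _"])
qed

lemma conv_pull_fstp: "conv tcm (pull fstp P) G p = lin (\<Delta> (fst p)) (\<lambda>z. P (fst z) * G (snd z, snd p))"
proof -
  have "conv tcm (pull fstp P) G p = lin (\<Delta> (fst p)) (\<lambda>z. lin (\<Delta> (snd p)) (\<lambda>w. lin (\<epsilon> (fst w))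
      (\<lambda>_. P (fst z) * G (snd z, snd w))))"
    by (simp add: conv_tens pull_def fstp_def lin_bnd lin_mult)
  then show ?thesis
    by (simp add: lin_counit_left [OF ccoalg_hopf, where F="\<lambda>w. _ * G (_, w)"])
qed

lemma conv_pull_sndp: "conv tcm G (pull sndp P) p = lin (\<Delta> (snd p)) (\<lambda>z. G (fst p, fst z) * P (snd z))"
proof -
  have "conv tcm G (pull sndp P) p = lin (\<Delta> (fst p)) (\<lambda>z. lin (\<Delta> (snd p)) (\<lambda>w. lin (\<epsilon> (snd z))
      (\<lambda>_. G (fst z, fst w) * P (snd w))))"
    by (simp add: conv_tens pull_def sndp_def lin_bnd mult_lin)
  also have "\<dots> = lin (\<Delta> (fst p)) (\<lambda>z. lin (\<epsilon> (snd z)) (\<lambda>_. lin (\<Delta> (snd p))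
      (\<lambda>w. G (fst z, fst w) * P (snd w))))"
    by (subst lin_comm [of "\<Delta> (snd p)"]) simp
  finally show ?thesis
    by (simp add: lin_counit_right [OF ccoalg_hopf, where F="\<lambda>z. lin _ (\<lambda>w. G (z, fst w) * P (snd w))"])
qed

text \<open>The rule P \<gamma>(u) Q \<gamma>(v) = P (u \<rhd> Q) \<omega>(u, v) \<gamma>(uv), read
  in coordinate m, for the generic pair of points followed by s and s'.\<close>

lemma smul_elt:
  assumes s: "cmap \<Delta> \<epsilon> \<Delta> \<epsilon> s" and s': "cmap \<Delta> \<epsilon> \<Delta> \<epsilon> s'"
  defines "u \<equiv> \<lambda>x. bnd (fstp x) s" and "v \<equiv> \<lambda>x. bnd (sndp x) s'"
  shows "(\<lambda>p. smul H \<phi> act om (elt P s (fst p)) (elt Q s' (snd p)) m)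
    = conv tcm (pull fstp P) (conv tcm (T.pact u (pull sndp Q)) (conv tcm
        (T.\<omega> u v) (pull (mulp tcm u v) (xb m))))"
proof
  fix p :: "'i \<times> 'i"
  let ?i = "fst p" and ?j = "snd p"
  have u: "cmap tcm tcu \<Delta> \<epsilon> u" unfolding u_def by (rule cmap_comp [OF cmap_fstp s])
  have v: "cmap tcm tcu \<Delta> \<epsilon> v" unfolding v_def by (rule cmap_comp [OF cmap_sndp s'])
  let ?R = "\<lambda>k j. lin (\<Delta> j) (\<lambda>w. actb (fst k) (Q (fst w)) * lin (s' (snd w)) (\<lambda>l. prodc m (snd k, l)))"
  have inner: "(\<Sum>j\<in>UNIV. lin (\<Delta> i) (\<lambda>z. actb (fst z) (elt Q s' ?j j) * prodc m (snd z, j))) = lin (\<Delta> i)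
      (\<lambda>z. ?R z ?j)" for i
    by (simp add: lin_sum [symmetric] sum_actb_elt)
  have "smul H \<phi> act om (elt P s ?i) (elt Q s' ?j) m = (\<Sum>i\<in>UNIV. elt P s ?i i * lin (\<Delta> i) (\<lambda>z. ?R z ?j))"
    by (simp add: smul_eq sum_distrib_left [symmetric] inner)
  also have "\<dots> = lin (\<Delta> ?i) (\<lambda>z. P (fst z) * lin (s (snd z)) (\<lambda>i. lin (\<Delta> i) (\<lambda>y. ?R (fst y, snd y) ?j)))"
    by (simp add: sum_elt)
  also have "\<dots> = lin (\<Delta> ?i) (\<lambda>z. P (fst z) * lin (\<Delta> (snd z)) (\<lambda>y. lin (s (fst y)) (\<lambda>k. lin (s (snd y))
      (\<lambda>k'. ?R (k, k') ?j))))"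
    by (subst lin_cmap_cm [OF s, where F="\<lambda>a b. ?R (a, b) ?j"]) simp
  finally have L: "smul H \<phi> act om (elt P s ?i) (elt Q s' ?j) m = \<dots>" .
  have 1: "T.pact u (pull sndp Q) = (\<lambda>q. lin (s (fst q)) (\<lambda>k. actb k (Q (snd q))))"
  proof -
    have "T.pact u (pull sndp Q) = pull (pair tcm u (\<lambda>x. bnd (sndp x) bas)) (\<lambda>z. actb (fst z) (Q (snd z)))"
      by (simp add: T.pull_pair_actb)
    then show ?thesis
      unfolding u_def
          by (simp only: fun_eq_iff pull_def pair_proj lin_bnd lin_bas bnd_bas fst_conv snd_conv simp_thms)
  qed
  have 2: "conv tcm (T.\<omega> u v) (pull (mulp tcm u v) (xb m)) = (\<lambda>q. lin (s (fst q)) (\<lambda>k. lin (s' (snd q))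
      (\<lambda>l. prodc m (k, l))))"
  proof -
    have "conv tcm (T.\<omega> u v) (pull (mulp tcm u v) (xb m)) = pull (pair tcm u v) (prodc m)"
      by (simp add: T.\<omega>_def T.pull_pair_mult [symmetric] prodc_def pull_conv [OF cmap_pair [OF ccoalg_tensor u v]])
    then show ?thesis
      unfolding u_def v_def by (simp add: fun_eq_iff pull_def pair_proj lin_bnd)
  qed
  have 3: "conv tcm (\<lambda>q. lin (s (fst q)) (\<lambda>k. actb k (Q (snd q)))) (\<lambda>q. lin (s (fst q))
      (\<lambda>k. lin (s' (snd q)) (\<lambda>l. prodc m (k, l)))) (i, ?j)
    = lin (\<Delta> i) (\<lambda>y. lin (s (fst y)) (\<lambda>k. lin (s (snd y)) (\<lambda>k'. ?R (k, k') ?j)))" for i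
  proof -
    have "conv tcm (\<lambda>q. lin (s (fst q)) (\<lambda>k. actb k (Q (snd q)))) (\<lambda>q. lin (s (fst q))
        (\<lambda>k. lin (s' (snd q)) (\<lambda>l. prodc m (k, l)))) (i, ?j)
      = lin (\<Delta> i) (\<lambda>y. lin (\<Delta> ?j) (\<lambda>w. lin (s (fst y)) (\<lambda>k. actb k (Q (fst w)) * lin (s (snd y))
          (\<lambda>k'. lin (s' (snd w)) (\<lambda>l. prodc m (k', l))))))"
      by (simp add: conv_tens lin_mult)
    also have "\<dots> = lin (\<Delta> i) (\<lambda>y. lin (\<Delta> ?j) (\<lambda>w. lin (s (fst y)) (\<lambda>k. lin (s (snd y))
        (\<lambda>k'. actb k (Q (fst w)) * lin (s' (snd w)) (\<lambda>l. prodc m (k', l))))))"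
      by (simp add: mult_lin)
    also have "\<dots> = lin (\<Delta> i) (\<lambda>y. lin (s (fst y)) (\<lambda>k. lin (s (snd y)) (\<lambda>k'. ?R (k, k') ?j)))"
      by (subst lin_comm [of "\<Delta> ?j" "s _"], subst lin_comm [of "\<Delta> ?j" "s _"]) simp
    finally show ?thesis .
  qed
  show "smul H \<phi> act om (elt P s ?i) (elt Q s' ?j) m =
     conv tcm (pull fstp P) (conv tcm (T.pact u (pull sndp Q)) (conv tcm
         (T.\<omega> u v) (pull (mulp tcm u v) (xb m)))) p"
    unfolding L 1 2 conv_pull_fstp 3 ..
qed

end

section \<open>The product rule for arbitrary points\<close>

context tpa_points
begin

lemma pull_omega_natural:
  assumes "cmap d e tcm tcu \<tau>"
  shows "pull \<tau> (T.\<omega> u v) = \<omega> (\<lambda>x. bnd (\<tau> x) u) (\<lambda>x. bnd (\<tau> x) v)"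
  by (simp add: \<omega>_def T.\<omega>_def pull_pull bnd_pair_natural [OF assms])

lemma pull_pact_natural:
  assumes "cmap d e tcm tcu \<tau>"
  shows "pull \<tau> (T.pact u f) = (\<lambda>x. bnd (\<tau> x) u) \<rhd> pull \<tau> f"
  by (simp add: T.pact_eq_pull pull_pull bnd_pair_natural [OF assms] pull_pair_actb)

lemma bnd_mulp_natural:
  assumes "cmap d e tcm tcu \<tau>"
  shows "bnd (\<tau> x) (mulp tcm u v) = ((\<lambda>x. bnd (\<tau> x) u) \<odot> (\<lambda>x. bnd (\<tau> x) v)) x"
  by (simp add: mulp_def [abs_def] bnd_assoc [symmetric] bnd_pair_natural [OF assms])

lemma pair_fstp:
  assumes "point \<tau>"
  shows "bnd (pair d \<sigma> \<tau> x) fstp = \<sigma> x"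
proof -
  have "bnd (pair d \<sigma> \<tau> x) fstp = bnd (d x) (\<lambda>z. bnd (\<sigma> (fst z)) (\<lambda>i. bnd (e (snd z)) (\<lambda>_. bas i)))"
    by (simp add: pair_def fstp_def bnd_assoc cmap_cu_cont [OF assms])
  also have "\<dots> = bnd (d x) (\<lambda>z. bnd (e (snd z)) (\<lambda>_. \<sigma> (fst z)))"
    by (subst bnd_comm [of "\<sigma> _"]) simp
  finally show ?thesis by (simp add: ccoalg_counit_right [OF ccoalg])
qed

lemma pair_sndp:
  assumes "point \<sigma>"
  shows "bnd (pair d \<sigma> \<tau> x) sndp = \<tau> x"
proof -
  have "bnd (pair d \<sigma> \<tau> x) sndp = bnd (d x) (\<lambda>z. bnd (\<tau> (snd z)) (\<lambda>j. bnd (\<sigma> (fst z)) (\<lambda>i. bnd (\<epsilon> i)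
      (\<lambda>_. bas j))))"
    by (subst bnd_comm [of "\<tau> _"]) (simp add: pair_def sndp_def bnd_assoc)
  also have "\<dots> = bnd (d x) (\<lambda>z. bnd (e (fst z)) (\<lambda>_. \<tau> (snd z)))"
    unfolding cmap_cu_cont [OF assms] by (subst bnd_comm [of "\<tau> _"]) simp
  finally show ?thesis by (simp add: ccoalg_counit_left [OF ccoalg])
qed

text \<open>The generic case \<open>smul_elt\<close> is pulled back along the pair of \<sigma> and
  \<tau>; all its ingredients are natural for coalgebra maps.\<close>

lemma pull_smul_elt:
  assumes s: "cmap \<Delta> \<epsilon> \<Delta> \<epsilon> s" and s': "cmap \<Delta> \<epsilon> \<Delta> \<epsilon> s'" and \<sigma>: "point \<sigma>" and \<tau>: "point \<tau>"
  defines "u \<equiv> \<lambda>x. bnd (\<sigma> x) s" and "v \<equiv> \<lambda>x. bnd (\<tau> x) s'"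
  shows "pull (pair d \<sigma> \<tau>) (\<lambda>p. smul H \<phi> act om (elt P s (fst p)) (elt Q s' (snd p)) m)
    = pull \<sigma> P \<star> (u \<rhd> pull \<tau> Q) \<star> \<omega> u v \<star> pull (u \<odot> v) (xb m)"
proof -
  have p: "cmap d e tcm tcu (pair d \<sigma> \<tau>)" by (rule cmap_pair [OF ccoalg \<sigma> \<tau>])
  show ?thesis
    unfolding smul_elt [OF s s'] pull_conv [OF p] u_def v_def
    by (simp add: pull_omega_natural [OF p] pull_pact_natural [OF p] pull_pull bnd_mulp_natural [OF p]
        bnd_assoc [symmetric] pair_fstp [OF \<tau>] pair_sndp [OF \<sigma>] star_assoc)
qed

end

section \<open>Membership in the partial crossed product\<close>

context tpa_points
begin

text \<open>Cocommutativity moves the argument of g to the last leg. The two legs fed to w are then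
  adjacent and become the comultiplication of w(x_1), which exhibits \<gamma>(w) g as a combination
  of the \<gamma>(b_k) with coefficients on the right.\<close>

lemma pact_star_xb:
  assumes w: "point w"
  shows "((w \<rhd> g) \<star> pull w (xb m)) x
    = lin (d x) (\<lambda>z. lin (w (fst z)) (\<lambda>k. lin (\<Delta> k) (\<lambda>y. actb (fst y) (g (snd z)) * xb m (snd y))))"
proof -
  let ?F = "\<lambda>a b c. lin (w a) (\<lambda>k. lin (w b) (\<lambda>l. actb k (g c) * xb m l))"
  have "((w \<rhd> g) \<star> pull w (xb m)) x = lin (d x) (\<lambda>z. lin (d (fst z)) (\<lambda>y. ?F (fst y) (snd z) (snd y)))"
    unfolding conv_def pact_def pull_def lin_mult by (simp add: mult_lin)
  also have "\<dots> = lin (d x) (\<lambda>z. lin (d (snd z)) (\<lambda>y. ?F (fst z) (snd y) (fst y)))"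
    by (rule lin_coassoc [OF ccoalg, symmetric, where F="\<lambda>a b c. ?F a c b"])
  also have "\<dots> = lin (d x) (\<lambda>z. lin (d (snd z)) (\<lambda>y. ?F (fst z) (fst y) (snd y)))"
    by (rule lin_cong, rule lin_swap [OF ccoalg])
  also have "\<dots> = lin (d x) (\<lambda>z. lin (d (fst z)) (\<lambda>y. ?F (fst y) (snd y) (snd z)))"
    by (rule lin_coassoc [OF ccoalg])
  also have "\<dots> = lin (d x) (\<lambda>z. lin (w (fst z)) (\<lambda>k. lin (\<Delta> k)
      (\<lambda>y. actb (fst y) (g (snd z)) * xb m (snd y))))"
    by (rule lin_cong, rule lin_cmap_cm [OF w, symmetric])
  finally show ?thesis .
qed

end

context tpa_setting
begin

lemma actb_add: "actb i (a + b) = actb i a + actb i b"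
  and actb_phi: "actb i (\<phi> x * a) = \<phi> x * actb i a"
  using tpa unfolding tpa_def alin_def actb_def by blast+

lemma actb_sum: "actb i (sum f S) = (\<Sum>x\<in>S. actb i (f x))"
proof -
  have "actb i 0 = 0" using actb_add [of i 0 0] by simp
  then show ?thesis by (induction S rule: infinite_finite_induct) (simp_all add: actb_add)
qed

lemma conv_actb: "conv \<Delta> (\<lambda>k. actb k a) (\<lambda>k. actb k b) = (\<lambda>k. actb k (a * b))"
  by (simp add: conv_def actb_mult fun_eq_iff)

lemma conv_actb_idb: "conv \<Delta> (\<lambda>k. actb k a) idb = (\<lambda>k. actb k a)"
  using conv_actb [of a 1] by (simp add: idb_def [abs_def])

lemma sharp_bas: "sharp H \<phi> act a (bas i) = elt (\<lambda>k. a * idb k) bas i"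
  by (rule ext) (simp add: sharp_def sw2_bas elt_eq idb_def actb_def)

lemma sharp_eq: "sharp H \<phi> act a h m = lin h (\<lambda>i. sharp H \<phi> act a (bas i) m)"
  by (simp add: sharp_def sw2_def hcm_def [symmetric] cop_eq_bnd [of H h] lin_def [symmetric] lin_bnd)

lemma sharp_hone: "sharp H \<phi> act a (hone H) m = a * \<phi> (hone H m)"
proof -
  have "sharp H \<phi> act a (hone H) m = lin (bnd (hone H) \<Delta>) (\<lambda>z. a * idb (fst z) * xb m (snd z))"
    by (simp add: sharp_eq [of _ "hone H"] sharp_bas elt_eq lin_bnd xb_def)
  also have "\<dots> = lin (hone H) (\<lambda>i. a * idb i * lin (hone H) (xb m))"
    by (simp add: comult_hone lin_bnd mult_lin)
  also have "\<dots> = a * lin (hone H) idb * lin (hone H) (xb m)"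
    by (simp add: mult_lin [of a] lin_mult)
  also have "\<dots> = a * \<phi> (hone H m)"
    using act_hone [of 1] pull_xb [of "\<lambda>_. hone H" m] by (simp add: idb_def [abs_def] pull_def)
  finally show ?thesis .
qed

text \<open>As 1 is group-like, the sum over its legs factors; with \<omega>(h, 1) = e(h) this
  leaves coordinate m of 1 # h.\<close>

lemma prodc_hone_right: "lin (hone H) (\<lambda>j. prodc m (k, j)) = conv \<Delta> idb (xb m) k"
proof -
  have "lin (hone H) (\<lambda>j. prodc m (k, j)) = lin (\<Delta> k) (\<lambda>z. lin (bnd (hone H) \<Delta>)
      (\<lambda>w. omb (fst z, fst w) * lin (\<mu> (snd z, snd w)) (xb m)))"
    by (subst lin_bnd, subst lin_comm [of "\<Delta> k"]) (simp add: prodc_def conv_tens pull_def)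
  also have "\<dots> = lin (\<Delta> k) (\<lambda>z. lin (hone H) (\<lambda>i. omb (fst z, i)) * lin (bnd (hone H)
      (\<lambda>j. \<mu> (snd z, j))) (xb m))"
    unfolding comult_hone lin_bnd lin_mult by (simp add: mult_lin)
  finally show ?thesis by (simp add: omb_hone mult_one conv_def)
qed

lemma prodc_hone_left: "lin (hone H) (\<lambda>j. prodc m (j, k)) = conv \<Delta> idb (xb m) k"
proof -
  have "lin (hone H) (\<lambda>j. prodc m (j, k)) = lin (bnd (hone H) \<Delta>) (\<lambda>w. lin (\<Delta> k)
      (\<lambda>z. omb (fst w, fst z) * lin (\<mu> (snd w, snd z)) (xb m)))"
    by (simp add: prodc_def conv_tens pull_def lin_bnd)
  also have "\<dots> = lin (\<Delta> k) (\<lambda>z. lin (bnd (hone H) \<Delta>)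
      (\<lambda>w. omb (fst w, fst z) * lin (\<mu> (snd w, snd z)) (xb m)))"
    by (rule lin_comm)
  also have "\<dots> = lin (\<Delta> k) (\<lambda>z. lin (hone H) (\<lambda>i. omb (i, fst z)) * lin (bnd (hone H)
      (\<lambda>j. \<mu> (j, snd z))) (xb m))"
    unfolding comult_hone lin_bnd lin_mult by (simp add: mult_lin)
  finally show ?thesis by (simp add: omb_hone mult_one conv_def)
qed

lemma smul_sharp_hone_right:
  "smul H \<phi> act om x (sharp H \<phi> act q (hone H)) m = (\<Sum>i\<in>UNIV. x i * conv \<Delta> (\<lambda>k. actb k q) (xb m) i)"
proof -
  have "(\<Sum>j\<in>UNIV. lin (\<Delta> i) (\<lambda>z. actb (fst z) (sharp H \<phi> act q (hone H) j) * prodc m (snd z, j)))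
     = conv \<Delta> (\<lambda>k. actb k q) (xb m) i" for i
  proof -
    have "(\<Sum>j\<in>UNIV. lin (\<Delta> i) (\<lambda>z. actb (fst z) (sharp H \<phi> act q (hone H) j) * prodc m (snd z, j)))
     = lin (\<Delta> i) (\<lambda>z. \<Sum>j\<in>UNIV. actb (fst z) (\<phi> (hone H j) * q) * prodc m (snd z, j))"
      by (simp add: lin_sum sharp_hone phi_central [of _ q])
    also have "\<dots> = lin (\<Delta> i) (\<lambda>z. actb (fst z) q * lin (hone H) (\<lambda>j. prodc m (snd z, j)))"
      by (simp add: actb_phi mult_lin) (simp add: lin_def mult.assoc)
    also have "\<dots> = conv \<Delta> (\<lambda>k. actb k q) (conv \<Delta> idb (xb m)) i"
      by (simp add: prodc_hone_right conv_def [of _ _ "conv \<Delta> idb (xb m)"])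
    finally show ?thesis
      by (simp add: P.star_assoc [symmetric] conv_actb_idb)
  qed
  then show ?thesis by (simp add: smul_eq sum_distrib_left [symmetric])
qed

text \<open>The sum on the right is coordinate m of the projection of y onto the crossed product. It
  is removed later for elements that the projection fixes.\<close>

lemma smul_sharp_hone_left:
  "smul H \<phi> act om (sharp H \<phi> act q (hone H)) y m = q * (\<Sum>j\<in>UNIV. y j * conv \<Delta> idb (xb m) j)"
proof -
  have "(\<Sum>i\<in>UNIV. sharp H \<phi> act q (hone H) i * lin (\<Delta> i) (\<lambda>z. actb (fst z) (y j) * prodc m (snd z, j)))
    = q * (y j * conv \<Delta> idb (xb m) j)" for j
  proof -
    have "(\<Sum>i\<in>UNIV. sharp H \<phi> act q (hone H) i * lin (\<Delta> i) (\<lambda>z. actb (fst z) (y j) * prodc m (snd z, j)))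
      = q * lin (bnd (hone H) \<Delta>) (\<lambda>z. actb (fst z) (y j) * prodc m (snd z, j))"
      unfolding lin_bnd by (simp add: sharp_hone mult.assoc lin_def [of "hone H"] sum_distrib_left)
    also have "\<dots> = q * (lin (hone H) (\<lambda>i. actb i (y j)) * lin (hone H) (\<lambda>k. prodc m (k, j)))"
      unfolding comult_hone lin_bnd lin_mult by (simp add: mult_lin)
    finally show ?thesis by (simp add: act_hone prodc_hone_left)
  qed
  then show ?thesis
    unfolding smul_eq by (subst sum.swap) (simp add: sum_distrib_left)
qed

lemma smul_sum_left: "smul H \<phi> act om (\<lambda>m. \<Sum>s\<in>S. x s m) y m = (\<Sum>s\<in>S. smul H \<phi> act om (x s) y m)"
proof -
  have "(\<Sum>i\<in>UNIV. \<Sum>j\<in>UNIV. \<Sum>s\<in>S. G s i j) = (\<Sum>s\<in>S. \<Sum>i\<in>UNIV. \<Sum>j\<in>UNIV. G s i j)" for G :: "_ \<Rightarrow> 'i \<Rightarrow> 'i \<Rightarrow> 'a"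
    by (subst sum.swap [of _ S]) (intro sum.cong refl sum.swap)
  then show ?thesis by (simp add: smul_eq sum_distrib_right)
qed

lemma smul_sum_right: "smul H \<phi> act om y (\<lambda>m. \<Sum>s\<in>S. x s m) m = (\<Sum>s\<in>S. smul H \<phi> act om y (x s) m)"
proof -
  have "(\<Sum>i\<in>UNIV. \<Sum>j\<in>UNIV. \<Sum>s\<in>S. G s i j) = (\<Sum>s\<in>S. \<Sum>i\<in>UNIV. \<Sum>j\<in>UNIV. G s i j)" for G :: "_ \<Rightarrow> 'i \<Rightarrow> 'i \<Rightarrow> 'a"
    by (subst sum.swap [of _ S]) (intro sum.cong refl sum.swap)
  then show ?thesis by (simp add: smul_eq actb_sum sum_distrib_right lin_sum sum_distrib_left)
qed

lemma smul_lin_left: "smul H \<phi> act om (\<lambda>m. lin v (\<lambda>q. x q m)) y m = lin v (\<lambda>q. smul H \<phi> act om (x q) y m)"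
proof -
  have "smul H \<phi> act om (\<lambda>m. \<phi> a * x m) y m = \<phi> a * smul H \<phi> act om x y m" for a x
    by (simp add: smul_eq sum_distrib_left mult.assoc)
  then show ?thesis by (simp add: lin_def smul_sum_left)
qed

lemma smul_lin_right: "smul H \<phi> act om y (\<lambda>m. lin v (\<lambda>q. x q m)) m = lin v (\<lambda>q. smul H \<phi> act om y (x q) m)"
proof -
  have "smul H \<phi> act om y (\<lambda>m. \<phi> a * x m) m = \<phi> a * smul H \<phi> act om y x m" for a x
    by (simp add: smul_eq sum_distrib_left actb_phi mult.assoc mult_lin [symmetric] phi_left_commute [of "y _"])
  then show ?thesis by (simp add: lin_def smul_sum_right)
qed

section \<open>The span of the elements a # h\<close>

abbreviation "B \<equiv> smash_set H \<phi> act"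

lemma smash_setI: "x = (\<lambda>m. \<Sum>j<(n::nat). sharp H \<phi> act (a j) (h j) m) \<Longrightarrow> x \<in> B"
  unfolding smash_set_def by (rule CollectI) (intro exI)

lemma smash_set_zero: "(\<lambda>_. 0) \<in> B"
  by (rule smash_setI [where n=0]) simp

lemma smash_set_sharp: "sharp H \<phi> act a h \<in> B"
  by (rule smash_setI [where n=1 and a="\<lambda>_. a" and h="\<lambda>_. h"]) simp

lemma smash_set_add:
  assumes "x \<in> B" "y \<in> B"
  shows "(\<lambda>m. x m + y m) \<in> B"
proof -
  from assms obtain n n' :: nat and a a' :: "nat \<Rightarrow> 'a" and h h' :: "nat \<Rightarrow> 'i \<Rightarrow> 'k" where x: "x =
      (\<lambda>m. \<Sum>j<n. sharp H \<phi> act (a j) (h j) m)"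
    and y: "y = (\<lambda>m. \<Sum>j<n'. sharp H \<phi> act (a' j) (h' j) m)"
    unfolding smash_set_def by blast
  let ?a = "\<lambda>j. if j < n then a j else a' (j - n)" and ?h = "\<lambda>j. if j < n then h j else h' (j - n)"
  have s: "(\<Sum>j<n + k. f j) = (\<Sum>j<n. f j) + (\<Sum>j<k. f (n + j))" for f :: "nat \<Rightarrow> 'a" and k
    by (induction k) (simp_all add: add.assoc)
  have "(\<lambda>m. x m + y m) = (\<lambda>m. \<Sum>j<n + n'. sharp H \<phi> act (?a j) (?h j) m)"
    unfolding s x y by simp
  then show ?thesis by (rule smash_setI)
qed

lemma smash_set_sum: "(\<And>s. s \<in> S \<Longrightarrow> x s \<in> B) \<Longrightarrow> (\<lambda>m. \<Sum>s\<in>S. x s m) \<in> B"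
  by (induction S rule: infinite_finite_induct) (simp_all add: smash_set_zero smash_set_add)

lemma smash_set_mult:
  assumes "x \<in> B"
  shows "(\<lambda>m. q * x m) \<in> B"
proof -
  from assms obtain n :: nat and a :: "nat \<Rightarrow> 'a" and h :: "nat \<Rightarrow> 'i \<Rightarrow> 'k" where x: "x =
      (\<lambda>m. \<Sum>j<n. sharp H \<phi> act (a j) (h j) m)"
    unfolding smash_set_def by blast
  have "q * sharp H \<phi> act a h m = sharp H \<phi> act (q * a) h m" for a h m
    by (simp add: sharp_def sw2_def sum_distrib_left mult.assoc phi_left_commute [of q])
  then have "(\<lambda>m. q * x m) = (\<lambda>m. \<Sum>j<n. sharp H \<phi> act (q * a j) (h j) m)"
    by (simp add: x sum_distrib_left)
  then show ?thesis by (rule smash_setI)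
qed

lemma smash_set_lin: "(\<And>p. x p \<in> B) \<Longrightarrow> (\<lambda>m. lin v (\<lambda>p. x p m)) \<in> B"
  unfolding lin_def by (intro smash_set_sum smash_set_mult)

text \<open>The defining sums have arbitrary length; expanding each h in the basis and collecting
  the coefficients in A makes them sums over the finite index type.\<close>

lemma smash_set_bas:
  assumes "x \<in> B"
  obtains a where "x = (\<lambda>m. \<Sum>i\<in>UNIV. sharp H \<phi> act (a i) (bas i) m)"
proof -
  from assms obtain n :: nat and a :: "nat \<Rightarrow> 'a" and h :: "nat \<Rightarrow> 'i \<Rightarrow> 'k" where x: "x =
      (\<lambda>m. \<Sum>j<n. sharp H \<phi> act (a j) (h j) m)"
    unfolding smash_set_def by blast
  have *: "(\<Sum>j<n. sharp H \<phi> act (b j) l m) = sharp H \<phi> act (\<Sum>j<n. b j) l m" for b l m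
    by (simp add: sharp_def sw2_def sum_distrib_left sum_distrib_right) (rule sum.swap)
  have "x = (\<lambda>m. \<Sum>j<n. \<Sum>i\<in>UNIV. sharp H \<phi> act (\<phi> (h j i) * a j) (bas i) m)"
    by (simp add: x sharp_eq [of _ "h _"] lin_def) (simp add: sharp_def sw2_def sum_distrib_left mult.assoc phi_left_commute [of "\<phi> _" "_ :: 'k"])
  also have "\<dots> = (\<lambda>m. \<Sum>i\<in>UNIV. sharp H \<phi> act (\<Sum>j<n. \<phi> (h j i) * a j) (bas i) m)"
    by (subst sum.swap) (simp add: *)
  finally show ?thesis by (rule that)
qed

text \<open>Since P absorbs e(s), projecting does not change the element, and the projection is
  visibly a combination of the elements 1 # b_j.\<close>

lemma elt_absorb_mem:
  assumes s: "cmap \<Delta> \<epsilon> \<Delta> \<epsilon> s" and P: "conv \<Delta> P (P.idp s) = P"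
  shows "elt P s i \<in> B"
    and "(\<Sum>j\<in>UNIV. elt P s i j * conv \<Delta> idb (xb m) j) = elt P s i m"
proof -
  show *: "(\<Sum>j\<in>UNIV. elt P s i j * conv \<Delta> idb (xb m) j) = elt P s i m" for m
  proof -
    have "(\<Sum>j\<in>UNIV. elt P s i j * conv \<Delta> idb (xb m) j) = conv \<Delta> P (pull s (conv \<Delta> idb (xb m))) i"
      by (simp add: sum_elt conv_def [of _ P] pull_def)
    also have "\<dots> = conv \<Delta> (conv \<Delta> P (P.idp s)) (pull s (xb m)) i"
      by (simp add: pull_conv [OF s] P.star_assoc P.idp_def)
    finally show ?thesis by (simp add: P elt_def)
  qed
  have "elt P s i = (\<lambda>m. \<Sum>j\<in>UNIV. elt P s i j * elt idb bas j m)"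
    using * by (simp add: elt_def [of idb])
  also have "\<dots> = (\<lambda>m. \<Sum>j\<in>UNIV. elt P s i j * sharp H \<phi> act 1 (bas j) m)"
    by (simp add: sharp_bas)
  also have "\<dots> \<in> B" by (intro smash_set_sum smash_set_mult smash_set_sharp)
  finally show "elt P s i \<in> B" .
qed

end

section \<open>The separability element\<close>

context tpa_setting
begin

text \<open>\<open>gam c\<close> is \<open>\<gamma>(h) c\<close> with \<open>\<gamma>(h) = 1 # h\<close>, and \<open>gam'\<close> is the partial convolution inverse
  \<open>\<gamma>'(h) = \<omega>'(S(h\<^sub>1), h\<^sub>2) # S(h\<^sub>3)\<close>.\<close>

definition gam :: "'a \<Rightarrow> 'i \<Rightarrow> 'i \<Rightarrow> 'a" where
  "gam c = elt (\<lambda>i. actb i c) bas"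

definition gam' :: "'i \<Rightarrow> 'i \<Rightarrow> 'a" where
  "gam' = elt (conv \<Delta> (P.\<omega>' (hak H) bas) (P.idp (hak H))) (hak H)"

text \<open>The coefficient in \<open>a \<gamma>(h) \<gamma>(l) c = \<gamma>(h\<^sub>1 l\<^sub>1) c
  rho(h\<^sub>2, l\<^sub>2)\<close>. The product hl of the generic pair is the point
  \<open>\<mu>\<close>, hence the conjugation by \<open>\<mu>\<close>.\<close>

definition rho :: "'a \<Rightarrow> 'i \<times> 'i \<Rightarrow> 'a" where
  "rho a = T.conj (conv tcm (cst tcu a) (T.\<omega> fstp sndp)) \<mu>"

text \<open>What multiplies \<gamma>(b_k) c from the right once h_1 l_1 is expanded in the basis.
  These are the entries of the matrix r.\<close>

definition rhoc :: "'a \<Rightarrow> 'i \<Rightarrow> 'i \<times> 'i \<Rightarrow> 'a" where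
  "rhoc a k = conv tcm (pull \<mu> (xb k)) (rho a)"

lemma pair_fstp_sndp: "pair tcm fstp sndp = bas"
proof
  fix p :: "'i \<times> 'i"
  show "pair tcm fstp sndp p = bas p" using pair_proj [of bas bas p] by simp
qed

lemma mulp_fstp_sndp: "mulp tcm fstp sndp = \<mu>"
  by (simp add: mulp_def [abs_def] pair_fstp_sndp)

lemma pull_mult_const: "pull u (\<lambda>k. a * f k) x = a * pull u f x"
  by (simp add: pull_def mult_lin)

lemma gam_sharp: "smul H \<phi> act om (gam c k) (sharp H \<phi> act q (hone H)) = elt (\<lambda>i. actb i (c * q)) bas k"
proof
  fix m
  have "smul H \<phi> act om (gam c k) (sharp H \<phi> act q (hone H)) m = conv \<Delta> (\<lambda>k. actb k c) (conv \<Delta>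
      (\<lambda>k. actb k q) (xb m)) k"
    by (simp add: smul_sharp_hone_right gam_def sum_elt conv_def [of _ "\<lambda>k. actb k c"])
  then show "smul H \<phi> act om (gam c k) (sharp H \<phi> act q (hone H)) m = elt (\<lambda>i. actb i (c * q)) bas k m"
    by (simp add: P.star_assoc [symmetric] conv_actb elt_def)
qed

text \<open>The product rule gives the coefficient a e(u) (u \<rhd> v \<rhd> c) \<omega>(u, v) for
  the generic pair. The action of u absorbs e(u), and \<open>move_right\<close> rewrites the rest as
  \<open>\<mu>\<close> acting on c times \<open>rho\<close>.\<close>

lemma smul_gam:
  assumes c: "\<And>a. c * a = a * c"
  shows "smul H \<phi> act om (sharp H \<phi> act a (bas i)) (gam c j) m
    = (\<Sum>k\<in>UNIV. smul H \<phi> act om (gam c k) (sharp H \<phi> act (rhoc a k (i, j)) (hone H)) m)"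
proof -
  note u = cmap_fstp and v = cmap_sndp
  have "(\<lambda>p. smul H \<phi> act om (elt (\<lambda>k. a * idb k) bas (fst p)) (elt (\<lambda>i. actb i c) bas (snd p)) m)
    = conv tcm (conv tcm (conv tcm (pull fstp (\<lambda>k. a * idb k)) (T.pact fstp (pull sndp (\<lambda>i. actb i c))))
        (T.\<omega> fstp sndp)) (pull \<mu> (xb m))"
    using T.pull_smul_elt [OF cmap_bas cmap_bas u v, of "\<lambda>k. a * idb k" "\<lambda>i. actb i c" m]
    by (simp add: pair_fstp_sndp mulp_fstp_sndp)
  also have "pull fstp (\<lambda>k. a * idb k) = conv tcm (cst tcu a) (T.idp fstp)"
    by (simp add: conv_cst_left [OF ccoalg_tensor] pull_mult_const fun_eq_iff T.idp_def)
  also have "pull sndp (\<lambda>i. actb i c) = T.pact sndp (cst tcu c)"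
    by (simp add: T.pact_cst)
  also have "conv tcm (conv tcm (cst tcu a) (T.idp fstp)) (T.pact fstp (T.pact sndp (cst tcu c))) =
     conv tcm (cst tcu a) (T.pact fstp (T.pact sndp (cst tcu c)))"
    by (simp add: T.star_assoc T.pact_idp_absorb [OF u])
  also have "conv tcm (conv tcm (cst tcu a) (T.pact fstp (T.pact sndp (cst tcu c)))) (T.\<omega> fstp sndp)
     = T.pact \<mu> (\<lambda>x. c * rho a x)"
    using T.move_right [OF u v c, of a]
        by (simp add: mulp_fstp_sndp rho_def conv_cst_left [OF ccoalg_tensor, of c])
  finally have "(\<lambda>p. smul H \<phi> act om (sharp H \<phi> act a (bas (fst p))) (gam c (snd p)) m)
     = conv tcm (T.pact \<mu> (\<lambda>x. c * rho a x)) (pull \<mu> (xb m))"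
    by (simp add: sharp_bas gam_def)
  from fun_cong [OF this, of "(i, j)"]
  have "smul H \<phi> act om (sharp H \<phi> act a (bas i)) (gam c j) m =
     lin (tcm (i, j)) (\<lambda>z. lin (\<mu> (fst z)) (\<lambda>k. lin (\<Delta> k)
         (\<lambda>y. actb (fst y) (c * rho a (snd z)) * xb m (snd y))))"
    by (simp add: T.pact_star_xb [OF cmap_mult])
  \<comment> \<open>The k-th coordinate of h_1 l_1 is a scalar, so it passes inside the action and
    joins \<open>rho\<close> to form \<open>rhoc\<close>.\<close>
  also have "\<dots> = (\<Sum>k\<in>UNIV. lin (\<Delta> k) (\<lambda>y. actb (fst y) (c * rhoc a k (i, j)) * xb m (snd y)))"
  proof -
    have "lin (\<Delta> k) (\<lambda>y. actb (fst y) (c * rhoc a k (i, j)) * xb m (snd y))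
      = lin (tcm (i, j)) (\<lambda>z. \<phi> (\<mu> (fst z) k) * lin (\<Delta> k)
          (\<lambda>y. actb (fst y) (c * rho a (snd z)) * xb m (snd y)))" for k
    proof -
      have "c * rhoc a k (i, j) = lin (tcm (i, j)) (\<lambda>z. \<phi> (\<mu> (fst z) k) * (c * rho a (snd z)))"
        by (simp add: rhoc_def conv_def pull_xb mult_lin phi_left_commute [of c])
      then have "lin (\<Delta> k) (\<lambda>y. actb (fst y) (c * rhoc a k (i, j)) * xb m (snd y))
        = lin (\<Delta> k) (\<lambda>y. lin (tcm (i, j))
            (\<lambda>z. \<phi> (\<mu> (fst z) k) * (actb (fst y) (c * rho a (snd z)) * xb m (snd y))))"
        by (simp add: actb_lin actb_phi lin_mult mult.assoc)
      also have "\<dots> = lin (tcm (i, j)) (\<lambda>z. lin (\<Delta> k)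
          (\<lambda>y. \<phi> (\<mu> (fst z) k) * (actb (fst y) (c * rho a (snd z)) * xb m (snd y))))"
        by (rule lin_comm)
      finally show ?thesis by (simp add: mult_lin)
    qed
    then show ?thesis by (simp add: lin_sum [symmetric] lin_def [of "\<mu> _"])
  qed
  finally show ?thesis by (simp add: gam_sharp elt_def conv_def)
qed

lemma pull_omega'_natural: "pull sndp (P.\<omega>' s s') = T.\<omega>' (\<lambda>x. bnd (sndp x) s) (\<lambda>x. bnd (sndp x) s')"
  by (simp add: P.\<omega>'_def T.\<omega>'_def pull_pull bnd_pair_natural [OF cmap_sndp])

lemma pull_mult_omega': "pull \<mu> (P.\<omega>' s s') = T.\<omega>' (\<lambda>x. bnd (\<mu> x) s) (\<lambda>x. bnd (\<mu> x) s')"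
  by (simp add: P.\<omega>'_def T.\<omega>'_def pull_pull bnd_pair_natural [OF cmap_mult])

lemma invp_eq: "(\<lambda>x. bnd (u x) (hak H)) = invp u"
  by (simp add: invp_def fun_eq_iff)

text \<open>Coordinate m of \<open>rho(h, l\<^sub>1) \<gamma>'(l\<^sub>2) = \<gamma>'(h\<^sub>1
  l\<^sub>1) (a # h\<^sub>2)\<close>, which is \<open>move_left\<close> for the generic
  pair.\<close>

lemma rho_gam':
  "conv tcm (rho a) (pull sndp (\<lambda>q. gam' q m)) = pull (pair tcm \<mu> fstp)
      (\<lambda>p. smul H \<phi> act om (gam' (fst p)) (sharp H \<phi> act a (bas (snd p))) m)"
proof -
  note u = cmap_fstp and v = cmap_sndp
  let ?v' = "invp sndp"
  let ?w' = "invp \<mu>"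
  have "pull sndp (\<lambda>q. gam' q m) = pull sndp (conv \<Delta>
      (conv \<Delta> (P.\<omega>' (hak H) bas) (P.idp (hak H))) (pull (hak H) (xb m)))"
    by (simp add: gam'_def elt_def [abs_def])
  also have "\<dots> = conv tcm (conv tcm (T.\<omega>' ?v' sndp) (T.idp ?v')) (pull ?v' (xb m))"
    by (simp add: pull_conv [OF v] pull_omega'_natural P.idp_def T.idp_def pull_pull invp_eq)
  finally have "conv tcm (rho a) (pull sndp (\<lambda>q. gam' q m))
     = conv tcm (conv tcm (T.conj (conv tcm (cst tcu a) (T.\<omega> fstp sndp)) \<mu>) (conv tcm (T.\<omega>' ?v' sndp)
         (T.idp ?v'))) (pull ?v' (xb m))"
    by (simp add: rho_def T.star_assoc)
  also have "\<dots> = conv tcm (conv tcm (conv tcm (conv tcm (T.\<omega>' ?w' \<mu>) (T.idp ?w')) (T.pact ?w'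
      (conv tcm (cst tcu a) (T.idp fstp)))) (T.\<omega> ?w' fstp)) (pull ?v' (xb m))"
    using T.move_left [OF u v, of a] by (simp add: mulp_fstp_sndp)
  also have "?v' = mulp tcm ?w' fstp"
    using T.mulp_invp_cancel [OF u v] by (simp add: mulp_fstp_sndp)
  also have "conv tcm (cst tcu a) (T.idp fstp) = pull fstp (\<lambda>k. a * idb k)"
    by (simp add: conv_cst_left [OF ccoalg_tensor] pull_mult_const fun_eq_iff T.idp_def)
  also have "conv tcm (T.\<omega>' ?w' \<mu>) (T.idp ?w') = pull \<mu> (conv \<Delta> (P.\<omega>' (hak H) bas) (P.idp (hak H)))"
    by (simp add: pull_conv [OF cmap_mult] pull_mult_omega' P.idp_def T.idp_def pull_pull invp_eq)
  finally show ?thesis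
    using T.pull_smul_elt [OF cmap_antipode cmap_bas cmap_mult u, of "conv \<Delta> (P.\<omega>' (hak H) bas) (P.idp (hak H))" "\<lambda>k. a * idb k" m]
    by (simp add: invp_eq gam'_def sharp_bas)
qed

end

section \<open>Tensor relations and separability\<close>

context tpa_setting
begin

text \<open>Chosen so that the sum of b_j (x) \<open>gam_t t j\<close> is t_1 (x)
  \<gamma>'(t_2).\<close>

definition gam_t :: "('i \<Rightarrow> 'k) \<Rightarrow> 'i \<Rightarrow> 'i \<Rightarrow> 'a" where
  "gam_t t j m = lin (\<lambda>q. cop H t (j, q)) (\<lambda>q. gam' q m)"

lemma sum_lin_cop: "(\<Sum>l\<in>UNIV. lin (\<lambda>q. cop H t (l, q)) (F l)) = lin t (\<lambda>k. lin (\<Delta> k) (\<lambda>z. F (fst z) (snd z)))"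
proof -
  have "(\<Sum>l\<in>UNIV. lin (\<lambda>q. cop H t (l, q)) (F l)) = lin (cop H t) (\<lambda>z. F (fst z) (snd z))"
    by (simp add: lin_def sum.cartesian_product split_def)
  then show ?thesis by (simp add: cop_eq_bnd lin_bnd)
qed

lemma mult_integral:
  assumes "left_integral H t"
  shows "bnd t (\<lambda>k. \<mu> (i, k)) = bnd (\<epsilon> i) (\<lambda>_. t)"
proof -
  have "hmul H (bas i) t = (\<lambda>l. eps H (bas i) * t l)" using assms by (simp add: left_integral_def)
  then show ?thesis by (simp add: hmul_eq_bnd bnd_def UNIV_unit hcu_def)
qed

text \<open>Here \<open>S\<close> is an arbitrary function, evaluated at (h_2 t_2, h_3) against
  coordinate j of h_1 t_1. As the product is a coalgebra map, the first two legs are the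
  comultiplication of h_1 t, and h_1 t = \<epsilon>(h_1) t.\<close>

lemma integral_shift:
  assumes t: "left_integral H t"
  shows "lin t (\<lambda>k. conv tcm (pull \<mu> (xb j)) (pull (pair tcm \<mu> fstp) S) (i, k)) = lin
      (\<lambda>q. cop H t (j, q)) (\<lambda>q. S (q, i))"
proof -
  let ?F = "\<lambda>k l. lin (\<Delta> k) (\<lambda>q. xb j (fst q) * S (snd q, l))"
  have "conv tcm (pull \<mu> (xb j)) (pull (pair tcm \<mu> fstp) S) p = lin (\<Delta> (fst p))
      (\<lambda>z. lin (\<mu> (fst z, snd p)) (\<lambda>k. ?F k (snd z)))" for p
  proof -
    have "conv tcm (pull \<mu> (xb j)) (pull (pair tcm \<mu> fstp) S) p =
       lin (tcm p) (\<lambda>z. lin (tcm (snd z)) (\<lambda>y. lin (\<mu> (fst z)) (\<lambda>a. lin (\<mu> (fst y))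
           (\<lambda>b. lin (fstp (snd y)) (\<lambda>l. xb j a * S (b, l))))))"
      by (subst lin_comm [of "tcm (snd _)"]) (simp only: conv_def pull_pair pull_def [of \<mu>] lin_mult, simp only: mult_lin)
    also have "\<dots> = lin (tcm p) (\<lambda>z. lin (tcm (fst z)) (\<lambda>y. lin (\<mu> (fst y)) (\<lambda>a. lin (\<mu> (snd y))
        (\<lambda>b. lin (fstp (snd z)) (\<lambda>l. xb j a * S (b, l))))))"
      by (rule lin_coassoc [OF ccoalg_tensor, where F="\<lambda>x y z. lin (\<mu> x) (\<lambda>a. lin (\<mu> y) (\<lambda>b. lin (fstp z)
          (\<lambda>l. xb j a * S (b, l))))"])
    also have "\<dots> = lin (tcm p) (\<lambda>z. lin (\<mu> (fst z)) (\<lambda>k. lin (\<Delta> k) (\<lambda>q. lin (fstp (snd z))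
        (\<lambda>l. xb j (fst q) * S (snd q, l)))))"
      by (rule lin_cong, rule lin_cmap_cm [OF cmap_mult, symmetric])
    also have "\<dots> = lin (tcm p) (\<lambda>z. lin (fstp (snd z)) (\<lambda>l. lin (\<mu> (fst z)) (\<lambda>k. ?F k l)))"
      by (subst lin_comm [of "\<Delta> _"], subst lin_comm [of "\<mu> _"]) simp
    also have "\<dots> = lin (\<Delta> (fst p)) (\<lambda>z. lin (\<Delta> (snd p)) (\<lambda>w. lin (\<epsilon> (snd w)) (\<lambda>_. lin (\<mu> (fst z, fst w))
        (\<lambda>k. ?F k (snd z)))))"
      by (simp add: tens_cm_def fstp_def lin_bnd)
    also have "\<dots> = lin (\<Delta> (fst p)) (\<lambda>z. lin (\<mu> (fst z, snd p)) (\<lambda>k. ?F k (snd z)))"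
      by (simp add: lin_counit_right [OF ccoalg_hopf, where F="\<lambda>w. lin (\<mu> (_, w)) _"])
    finally show ?thesis .
  qed
  then have "lin t (\<lambda>k. conv tcm (pull \<mu> (xb j)) (pull (pair tcm \<mu> fstp) S) (i, k))
    = lin t (\<lambda>k. lin (\<Delta> i) (\<lambda>z. lin (\<mu> (fst z, k)) (\<lambda>k. ?F k (snd z))))" by simp
  also have "\<dots> = lin (\<Delta> i) (\<lambda>z. lin (bnd t (\<lambda>k. \<mu> (fst z, k))) (\<lambda>k. ?F k (snd z)))"
    unfolding lin_bnd by (rule lin_comm)
  also have "\<dots> = lin (\<Delta> i) (\<lambda>z. lin (\<epsilon> (fst z)) (\<lambda>_. lin t (\<lambda>k. ?F k (snd z))))"
    by (simp add: mult_integral [OF t] lin_bnd)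
  also have "\<dots> = lin t (\<lambda>k. ?F k i)"
    by (rule lin_counit_left [OF ccoalg_hopf])
  also have "\<dots> = (\<Sum>l\<in>UNIV. lin (\<lambda>q. cop H t (l, q)) (\<lambda>q. xb j l * S (q, i)))"
    by (simp add: sum_lin_cop)
  also have "\<dots> = (\<Sum>l\<in>UNIV. if l = j then lin (\<lambda>q. cop H t (l, q)) (\<lambda>q. S (q, i)) else 0)"
    by (intro sum.cong refl) (auto simp: xb_def bas_def lin_def)
  finally show ?thesis by simp
qed

text \<open>The right side is a sum over (h_1 t_1)_j \<open>rho\<close>(h_2, t_2) \<gamma>'(t_3). By
  \<open>rho_gam'\<close> its last factors are \<gamma>'(h_2 t_2) (a # h_3), and the integral
  property removes h from the first two legs. The coefficients are those of
  \<open>smul_gam\<close>.\<close>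

lemma gam_t_smul:
  assumes t: "left_integral H t"
  shows "smul H \<phi> act om (gam_t t j) (sharp H \<phi> act a (bas i)) m = (\<Sum>l\<in>UNIV. rhoc a j (i, l) * gam_t t l m)"
proof -
  have "(\<Sum>l\<in>UNIV. rhoc a j (i, l) * gam_t t l m) = lin t (\<lambda>k. lin (\<Delta> k)
      (\<lambda>z. rhoc a j (i, fst z) * gam' (snd z) m))"
    by (simp add: gam_t_def mult_lin sum_lin_cop)
  also have "\<dots> = lin t (\<lambda>k. conv tcm (rhoc a j) (pull sndp (\<lambda>q. gam' q m)) (i, k))"
    by (simp add: conv_pull_sndp)
  also have "\<dots> = lin t (\<lambda>k. conv tcm (pull \<mu> (xb j)) (pull (pair tcm \<mu> fstp)
      (\<lambda>p. smul H \<phi> act om (gam' (fst p)) (sharp H \<phi> act a (bas (snd p))) m)) (i, k))"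
    by (simp add: rhoc_def T.star_assoc rho_gam')
  also have "\<dots> = lin (\<lambda>q. cop H t (j, q)) (\<lambda>q. smul H \<phi> act om (gam' q) (sharp H \<phi> act a (bas i)) m)"
    by (simp add: integral_shift [OF t])
  finally show ?thesis
    by (simp add: gam_t_def [abs_def] smul_lin_left)
qed

text \<open>The points of \<gamma>(t_1) and \<gamma>'(t_2) are the identity and the antipode. Their
  product is the unit point, so the result lies in A # 1; the twists cancel by
  \<open>pact_omega'_inv\<close>.\<close>

lemma sum_gam_gam_t:
  "(\<Sum>j\<in>UNIV. smul H \<phi> act om (gam c j) (gam_t t j) m) = act t c * \<phi> (hone H m)"
proof -
  note b = cmap_bas [of \<Delta> \<epsilon>]
  note a = cmap_invp [OF b, unfolded invp_bas]
  have inv: "mulp \<Delta> bas (hak H) = onep \<epsilon>"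
    using mulp_invp_right [OF b] by (simp add: invp_bas)
  have "(\<Sum>j\<in>UNIV. smul H \<phi> act om (gam c j) (gam_t t j) m)
    = lin t (\<lambda>k. lin (\<Delta> k) (\<lambda>z. smul H \<phi> act om (gam c (fst z)) (gam' (snd z)) m))"
    by (simp add: gam_t_def [abs_def] smul_lin_right sum_lin_cop)
  also have "\<dots> = lin t (pull (pair \<Delta> bas bas) (\<lambda>z. smul H \<phi> act om (gam c (fst z)) (gam' (snd z)) m))"
    by (rule lin_cong) (simp add: pull_pair)
  also have "pull (pair \<Delta> bas bas) (\<lambda>z. smul H \<phi> act om (gam c (fst z)) (gam' (snd z)) m)
     = conv \<Delta> (conv \<Delta> (conv \<Delta> (\<lambda>i. actb i c) (P.pact bas
         (conv \<Delta> (P.\<omega>' (hak H) bas) (P.idp (hak H))))) (P.\<omega> bas (hak H))) (pull (onep \<epsilon>) (xb m))"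
    using P.pull_smul_elt [OF b cmap_antipode b b, of "\<lambda>i. actb i c" "conv \<Delta> (P.\<omega>' (hak H) bas) (P.idp (hak H))" m]
    by (simp add: gam_def gam'_def inv)
  \<comment> \<open>The e(S) contained in \<open>gam'\<close> is sent by the identity point to e(h)
    e(1), which the other factor absorbs.\<close>
  also have "P.pact bas (conv \<Delta> (P.\<omega>' (hak H) bas) (P.idp (hak H))) = P.pact bas (P.\<omega>' (hak H) bas)"
    by (simp add: P.pact_star [OF b] P.pact_idp [OF b a] inv P.idp_onep P.pact_idp_absorb [OF b])
  also have "conv \<Delta> (conv \<Delta> (\<lambda>i. actb i c) (P.pact bas (P.\<omega>' (hak H) bas))) (P.\<omega> bas (hak H)) = conv \<Delta>
      (\<lambda>i. actb i c) idb"
    using P.pact_omega'_inv [OF b] by (simp add: P.star_assoc invp_bas P.idp_def)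
  also have "pull (onep \<epsilon>) (xb m) = cst \<epsilon> (\<phi> (hone H m))"
    using pull_xb [of "\<lambda>_. hone H" m] by (simp add: fun_eq_iff onep_def pull_def cst_def lin_bnd)
  finally show ?thesis
    by (simp add: conv_actb_idb conv_cst_right [OF ccoalg_hopf] lin_mult act_eq [of t])
qed

lemma gam_mem: "gam c j \<in> B"
  unfolding gam_def by (rule elt_absorb_mem(1) [OF cmap_bas]) (simp add: P.idp_def conv_actb_idb)

lemma gam_sharp_mem: "smul H \<phi> act om (gam c k) (sharp H \<phi> act q (hone H)) \<in> B"
  unfolding gam_sharp by (rule elt_absorb_mem(1) [OF cmap_bas]) (simp add: P.idp_def conv_actb_idb)

lemma gam'_absorb: "conv \<Delta> (conv \<Delta> (P.\<omega>' (hak H) bas) (P.idp (hak H))) (P.idp (hak H))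
    = conv \<Delta> (P.\<omega>' (hak H) bas) (P.idp (hak H))"
  by (simp add: P.star_assoc P.idp_idem [OF cmap_antipode])

lemma gam_t_mem: "gam_t t j \<in> B"
  unfolding gam_t_def [abs_def] gam'_def
      by (intro smash_set_lin elt_absorb_mem(1) [OF cmap_antipode gam'_absorb])

lemma sharp_hone_gam_t: "smul H \<phi> act om (sharp H \<phi> act q (hone H)) (gam_t t j) = (\<lambda>m. q * gam_t t j m)"
proof
  fix m
  have "(\<Sum>i\<in>UNIV. gam_t t j i * conv \<Delta> idb (xb m) i) = lin (\<lambda>q. cop H t (j, q))
      (\<lambda>q. \<Sum>i\<in>UNIV. gam' q i * conv \<Delta> idb (xb m) i)"
    by (simp add: gam_t_def lin_mult lin_sum)
  also have "\<dots> = gam_t t j m"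
    by (simp add: gam_t_def gam'_def elt_absorb_mem(2) [OF cmap_antipode gam'_absorb])
  finally show "smul H \<phi> act om (sharp H \<phi> act q (hone H)) (gam_t t j) m = q * gam_t t j m"
    by (simp add: smul_sharp_hone_left)
qed

text \<open>The matrix r is additive in x, so it is the sum of the matrices of the terms a_i # b_i.
  The same entries describe x on the \<gamma>(b_j) c from the left and on the \<open>gam_t\<close>
  from the right.\<close>

lemma bimodule_coefficients:
  assumes x: "x \<in> B" and t: "left_integral H t" and c: "\<And>a. c * a = a * c"
  obtains r where "\<And>j. smul H \<phi> act om x (gam c j) =
      (\<lambda>m. \<Sum>k\<in>UNIV. smul H \<phi> act om (gam c k) (sharp H \<phi> act (r k j) (hone H)) m)"
    and "\<And>k. smul H \<phi> act om (gam_t t k) x =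
        (\<lambda>m. \<Sum>j\<in>UNIV. smul H \<phi> act om (sharp H \<phi> act (r k j) (hone H)) (gam_t t j) m)"
proof -
  from x obtain a where x: "x = (\<lambda>m. \<Sum>i\<in>UNIV. sharp H \<phi> act (a i) (bas i) m)" by (rule smash_set_bas)
  define r where "r k j = (\<Sum>i\<in>UNIV. rhoc (a i) k (i, j))" for k j
  have s: "sharp H \<phi> act (r k j) (hone H) =
      (\<lambda>m. \<Sum>i\<in>UNIV. sharp H \<phi> act (rhoc (a i) k (i, j)) (hone H) m)" for k j
    by (simp add: sharp_hone fun_eq_iff r_def sum_distrib_right)
  show thesis
  proof (rule that)
    show "smul H \<phi> act om x (gam c j) =
        (\<lambda>m. \<Sum>k\<in>UNIV. smul H \<phi> act om (gam c k) (sharp H \<phi> act (r k j) (hone H)) m)" for j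
      unfolding x s by (rule ext) (simp only: smul_sum_left smul_sum_right smul_gam [OF c], rule sum.swap)
    show "smul H \<phi> act om (gam_t t k) x =
        (\<lambda>m. \<Sum>j\<in>UNIV. smul H \<phi> act om (sharp H \<phi> act (r k j) (hone H)) (gam_t t j) m)" for k
      unfolding x sharp_hone_gam_t r_def sum_distrib_right
          by (rule ext) (simp only: smul_sum_right gam_t_smul [OF t], rule sum.swap)
  qed
qed

end

section \<open>Relations in the tensor product over A\<close>

lemma vadd_zero: "vadd (\<lambda>_. 0) (\<lambda>_. 0) = (\<lambda>_. 0 :: 'a::monoid_add)"
  by (simp add: vadd_def)

lemma vadd_sum: "finite S \<Longrightarrow> s \<notin> S \<Longrightarrow> vadd (x s) (\<lambda>m. \<Sum>s\<in>S. x s m) = (\<lambda>m. \<Sum>s\<in>insert s S. x s m)"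
  by (simp add: vadd_def)

context
  fixes Ms :: "('i::finite \<Rightarrow> 'a::ring_1) set" and ract :: "('i \<Rightarrow> 'a) \<Rightarrow> 'r \<Rightarrow> 'i \<Rightarrow> 'a"
      and lact :: "'r \<Rightarrow> ('i \<Rightarrow> 'a) \<Rightarrow> 'i \<Rightarrow> 'a"
  assumes zero: "(\<lambda>_. 0) \<in> Ms" and sums: "\<And>S (x :: 'i \<Rightarrow> 'i \<Rightarrow> 'a). (\<And>s. x s \<in> Ms) \<Longrightarrow> (\<lambda>m. \<Sum>s\<in>S. x s m) \<in> Ms"
begin

abbreviation "TZ \<equiv> tensor_zero Ms Ms vadd vadd ract lact"

lemma tz_diff: "p \<in> TZ \<Longrightarrow> q \<in> TZ \<Longrightarrow> (\<lambda>z. p z - q z) \<in> TZ"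
  using tz_add [of p Ms Ms vadd vadd ract lact "\<lambda>z. - q z"] tz_neg [of q Ms Ms vadd vadd ract lact] by simp

lemma tz_sum: "(\<And>s. s \<in> S \<Longrightarrow> f s \<in> TZ) \<Longrightarrow> (\<lambda>z. \<Sum>s\<in>S. f s z) \<in> TZ"
  by (induction S rule: infinite_finite_induct) (simp_all add: tz_zero tz_add)

lemma tz_sum_left:
  fixes x :: "'i \<Rightarrow> 'i \<Rightarrow> 'a"
  assumes "\<And>s. x s \<in> Ms" "y \<in> Ms" "finite S"
  shows "(\<lambda>z. delta (\<lambda>m. \<Sum>s\<in>S. x s m, y) z - (\<Sum>s\<in>S. delta (x s, y) z)) \<in> TZ"
  using assms(3)
proof (induction S rule: finite_induct)
  case empty
  \<comment> \<open>The additivity relation for 0 + 0 = 0 leaves minus the generator 0 (x) y, hence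
    the negation.\<close>
  have "(\<lambda>z. - (delta (vadd (\<lambda>_. 0) (\<lambda>_. 0), y) z - delta (\<lambda>_. 0, y) z - delta (\<lambda>_. 0, y) z)) \<in> TZ"
    by (intro tz_neg tz_l zero assms)
  then show ?case by (simp add: vadd_zero)
next
  case (insert s S)
  have "(\<lambda>z. (delta (vadd (x s) (\<lambda>m. \<Sum>s\<in>S. x s m), y) z - delta (x s, y) z - delta (\<lambda>m. \<Sum>s\<in>S. x s m, y) z)
      + (delta (\<lambda>m. \<Sum>s\<in>S. x s m, y) z - (\<Sum>s\<in>S. delta (x s, y) z))) \<in> TZ"
    by (intro tz_add insert.IH tz_l assms sums)
  then show ?case using insert by (simp add: vadd_sum del: sum.insert) (simp add: algebra_simps)
qed

lemma tz_sum_right: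
  fixes y :: "'i \<Rightarrow> 'i \<Rightarrow> 'a"
  assumes "x \<in> Ms" "\<And>s. y s \<in> Ms" "finite S"
  shows "(\<lambda>z. delta (x, \<lambda>m. \<Sum>s\<in>S. y s m) z - (\<Sum>s\<in>S. delta (x, y s) z)) \<in> TZ"
  using assms(3)
proof (induction S rule: finite_induct)
  case empty
  have "(\<lambda>z. - (delta (x, vadd (\<lambda>_. 0) (\<lambda>_. 0)) z - delta (x, \<lambda>_. 0) z - delta (x, \<lambda>_. 0) z)) \<in> TZ"
    by (intro tz_neg tz_r zero assms)
  then show ?case by (simp add: vadd_zero)
next
  case (insert s S)
  have "(\<lambda>z. (delta (x, vadd (y s) (\<lambda>m. \<Sum>s\<in>S. y s m)) z - delta (x, y s) z - delta (x, \<lambda>m. \<Sum>s\<in>S. y s m) z)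
      + (delta (x, \<lambda>m. \<Sum>s\<in>S. y s m) z - (\<Sum>s\<in>S. delta (x, y s) z))) \<in> TZ"
    by (intro tz_add insert.IH tz_r assms sums)
  then show ?case using insert by (simp add: vadd_sum del: sum.insert) (simp add: algebra_simps)
qed

text \<open>Additivity expands both sides into double sums over j and k, and balancing identifies
  these term by term, which carries the matrix r across the tensor sign.\<close>

lemma tz_transfer:
  fixes g y :: "'i \<Rightarrow> 'i \<Rightarrow> 'a"
  assumes g: "\<And>i. g i \<in> Ms" and y: "\<And>i. y i \<in> Ms"
    and gr: "\<And>i q. ract (g i) q \<in> Ms" and yl: "\<And>i q. lact q (y i) \<in> Ms"
  shows "(\<lambda>z. (\<Sum>j\<in>UNIV. delta (\<lambda>m. \<Sum>k\<in>UNIV. ract (g k) (r k j) m, y j) z)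
     - (\<Sum>k\<in>UNIV. delta (g k, \<lambda>m. \<Sum>j\<in>UNIV. lact (r k j) (y j) m) z)) \<in> TZ"
proof -
  have 1: "(\<lambda>z. \<Sum>j\<in>UNIV. delta
      (\<lambda>m. \<Sum>k\<in>UNIV. ract (g k) (r k j) m, y j) z - (\<Sum>k\<in>UNIV. delta (ract (g k) (r k j), y j) z)) \<in> TZ"
    by (intro tz_sum tz_sum_left gr y finite)
  have 2: "(\<lambda>z. \<Sum>j\<in>UNIV. \<Sum>k\<in>UNIV. delta (ract (g k) (r k j), y j) z - delta (g k, lact (r k j) (y j)) z) \<in> TZ"
    by (intro tz_sum tz_bal g y)
  have 3: "(\<lambda>z. \<Sum>k\<in>UNIV. delta (g k, \<lambda>m. \<Sum>j\<in>UNIV. lact (r k j) (y j) m) z - (\<Sum>j\<in>UNIV. delta (g k, lact (r k j) (y j)) z)) \<in> TZ"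
    by (intro tz_sum tz_sum_right g yl finite)
  have s: "(\<Sum>k\<in>UNIV. \<Sum>j\<in>UNIV. delta (g k, lact (r k j) (y j)) z)
      = (\<Sum>j\<in>UNIV. \<Sum>k\<in>UNIV. delta (g k, lact (r k j) (y j)) z)" for z
    by (rule sum.swap)
  show ?thesis
    using tz_diff [OF tz_add [OF 1 2] 3] by (simp add: sum_subtractf s)
qed

end

text \<open>Different indices may give the same pair, so p counts multiplicities. Summing over the
  range of \<open>a\<close> and exchanging the sums restores one term per index.\<close>

lemma sum_support_delta:
  fixes f :: "'z \<Rightarrow> 'a::ring_1" and a :: "'i::finite \<Rightarrow> 'z"
  defines "p \<equiv> \<lambda>z. \<Sum>i\<in>UNIV. delta (a i) z"
  shows "(\<Sum>z\<in>{z. p z \<noteq> 0 \<and> Q z}. of_int (p z) * f z) = (\<Sum>i\<in>UNIV. if Q (a i) then f (a i) else 0)"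
proof -
  have supp: "{z. p z \<noteq> 0 \<and> Q z} \<subseteq> range a"
  proof
    fix z assume "z \<in> {z. p z \<noteq> 0 \<and> Q z}"
    then have "p z \<noteq> 0" by simp
    then obtain i where "delta (a i) z \<noteq> 0" unfolding p_def by (meson sum.neutral)
    then show "z \<in> range a" by (auto simp: delta_def split: if_splits)
  qed
  have "(\<Sum>z\<in>{z. p z \<noteq> 0 \<and> Q z}. of_int (p z) * f z) = (\<Sum>z\<in>range a. if Q z then of_int (p z) * f z else 0)"
    by (rule sum.mono_neutral_cong_left) (use supp in auto)
  also have "\<dots> = (\<Sum>z\<in>range a. \<Sum>i\<in>UNIV. if z = a i then (if Q z then f z else 0) else 0)"
    by (intro sum.cong refl) (auto simp: p_def delta_def of_int_sum sum_distrib_right intro!: sum.cong)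
  also have "\<dots> = (\<Sum>i\<in>UNIV. \<Sum>z\<in>range a. if z = a i then (if Q z then f z else 0) else 0)"
    by (rule sum.swap)
  also have "\<dots> = (\<Sum>i\<in>UNIV. if Q (a i) then f (a i) else 0)"
    by simp
  finally show ?thesis .
qed

lemma push_sum_delta:
  fixes a :: "'i::finite \<Rightarrow> 'z"
  shows "push g (\<lambda>z. \<Sum>i\<in>UNIV. delta (a i) z) w = (\<Sum>i\<in>UNIV. delta (g (a i)) w)"
  using sum_support_delta [where a=a and Q="\<lambda>z. g z = w" and f="\<lambda>_. 1 :: int"]
  by (simp add: push_def delta_def eq_commute [of w])

theorem theorem6p2:
  fixes H :: "('i::finite, 'k::field) hopf_data"
    and \<phi> :: "'k \<Rightarrow> 'a::ring_1"
    and act :: "('i \<Rightarrow> 'k) \<Rightarrow> 'a \<Rightarrow> 'a"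
    and om om' :: "('i \<Rightarrow> 'k) \<Rightarrow> ('i \<Rightarrow> 'k) \<Rightarrow> 'a"
    and t :: "'i \<Rightarrow> 'k"
    and c :: 'a
  assumes "is_hopf H"
    and "cocommutative H"
    and "kalg \<phi>"
    and "sym_tpa H \<phi> act om om'"
    and "left_integral H t"
    and "t \<noteq> (\<lambda>_. 0)"
    and "\<forall>a. c * a = a * c"
    and "act t c = 1"
  shows "smash_separable H \<phi> act om"
proof -
  interpret tpa_setting \<phi> H act om om'
    using assms by unfold_locales
  \<comment> \<open>The formal sum of these pairs represents \<gamma>(t_1) c (x)
    \<gamma>'(t_2).\<close>
  let ?a = "\<lambda>i. (gam c i, gam_t t i)"
  let ?p = "\<lambda>z. \<Sum>i\<in>UNIV. delta (?a i) z"
  have supp: "{z. ?p z \<noteq> 0} \<subseteq> range ?a"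
  proof
    fix z assume "z \<in> {z. ?p z \<noteq> 0}"
    then obtain i where "delta (?a i) z \<noteq> 0" by (metis (mono_tags, lifting) mem_Collect_eq sum.neutral)
    then show "z \<in> range ?a" by (auto simp: delta_def split: if_splits)
  qed
  show ?thesis
    unfolding smash_separable_def
  proof (intro exI [of _ ?p] conjI ballI)
    show "finite {z. ?p z \<noteq> 0}" using supp by (rule finite_subset) simp
    show "{z. ?p z \<noteq> 0} \<subseteq> B \<times> B" using supp gam_mem gam_t_mem by fastforce
    fix x assume "x \<in> B"
    with assms obtain r where
      l: "\<And>j. smul H \<phi> act om x (gam c j) =
          (\<lambda>m. \<Sum>k\<in>UNIV. smul H \<phi> act om (gam c k) (sharp H \<phi> act (r k j) (hone H)) m)"
      and r: "\<And>k. smul H \<phi> act om (gam_t t k) x =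
          (\<lambda>m. \<Sum>j\<in>UNIV. smul H \<phi> act om (sharp H \<phi> act (r k j) (hone H)) (gam_t t j) m)"
      using bimodule_coefficients [OF \<open>x \<in> B\<close> \<open>left_integral H t\<close>, of c] by blast
    show "(\<lambda>w. push (\<lambda>z. (smul H \<phi> act om x (fst z), snd z)) ?p w - push
        (\<lambda>z. (fst z, smul H \<phi> act om (snd z) x)) ?p w)
      \<in> tensor_zero B B vadd vadd (\<lambda>x a. smul H \<phi> act om x (sharp H \<phi> act a (hone H)))
               (\<lambda>a y. smul H \<phi> act om (sharp H \<phi> act a (hone H)) y)"
      \<comment> \<open>The rows and columns of r turn the two pushed sums into the two sides of
        \<open>tz_transfer\<close>.\<close>
      unfolding push_sum_delta fst_conv snd_conv l r
      by (rule tz_transfer)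
         (simp_all add: smash_set_zero smash_set_sum gam_mem gam_t_mem gam_sharp_mem sharp_hone_gam_t smash_set_mult)
  next
    show "(\<lambda>m. \<Sum>z\<in>{z. ?p z \<noteq> 0}. of_int (?p z) * smul H \<phi> act om (fst z) (snd z) m)
        = sharp H \<phi> act 1 (hone H)"
    proof
      fix m
      show "(\<Sum>z\<in>{z. ?p z \<noteq> 0}. of_int (?p z) * smul H \<phi> act om (fst z) (snd z) m)
          = sharp H \<phi> act 1 (hone H) m"
        \<comment> \<open>Multiplication gives (t.c) # 1, and t.c = 1 by hypothesis.\<close>
        using sum_support_delta [where a="?a" and Q="\<lambda>_. True" and f="\<lambda>z. smul H \<phi> act om (fst z) (snd z) m"]
        by (simp add: sum_gam_gam_t sharp_hone assms)
    qed
  qed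
qed

end
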